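(* Let $\lambda,\alpha\in\mathbb{C}^*$ and $\beta,\gamma,\eta,\epsilon,\theta\in\mathbb{C}$. Then there are isomorphisms of $\mathfrak{L}$-modules $$\Omega(\lambda,\alpha,\beta,\gamma)\otimes\overline{V}(\eta,\epsilon,\theta)\cong\mathrm{Ind}(\mathbb{C}[t]^{\Omega}_{\lambda,\alpha,\beta,\gamma,\eta,\epsilon,\theta}),$$ $$\Delta(\lambda,\alpha,\beta,\gamma)\otimes\overline{V}(\eta,\epsilon,\theta)\cong\mathrm{Ind}(\mathbb{C}[t]^{\Delta}_{\lambda,\alpha,\beta,\gamma,\eta,\epsilon,\theta}),$$ $$\Theta(\lambda,\alpha,\beta,\gamma)\otimes\overline{V}(\eta,\epsilon,\theta)\cong\mathrm{Ind}(\mathbb{C}[t]^{\Theta}_{\lambda,\alpha,\beta,\gamma,\eta,\epsilon,\theta}).$$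
   Context: All vector spaces are over $\mathbb{C}$; $\mathbb{C}^*=\mathbb{C}\setminus\{0\}$, $\mathbb{Z}_+$ is the set of nonnegative integers, $\mathbb{N}$ the set of positive integers. The affine-Virasoro algebra of type $A_1$, denoted $\mathfrak{L}$, is the Lie algebra with basis $\{e_i,f_i,h_i,d_i,C\mid i\in\mathbb{Z}\}$ and brackets $[e_i,f_j]=h_{i+j}+i\delta_{i+j,0}C$, $[h_i,e_j]=2e_{i+j}$, $[h_i,f_j]=-2f_{i+j}$, $[d_i,d_j]=(j-i)d_{i+j}+\delta_{i+j,0}\frac{i^3-i}{12}C$, $[d_i,h_j]=jh_{i+j}$, $[h_i,h_j]=2i\delta_{i+j,0}C$, $[d_i,e_j]=je_{i+j}$, $[d_i,f_j]=jf_{i+j}$, $[e_i,e_j]=[f_i,f_j]=[C,\mathfrak{L}]=0$. For $\lambda,\alpha\in\mathbb{C}^*$, $\beta,\gamma\in\mathbb{C}$, the $\mathfrak{L}$-modules $\Omega(\lambda,\alpha,\beta,\gamma)$, $\Delta(\lambda,\alpha,\beta,\gamma)$, $\Theta(\lambda,\alpha,\beta,\gamma)$ are all equal to the polynomial algebra $\mathbb{C}[s,t]$ as vector spaces. In all three, for $i\in\mathbb{Z}$ and $g(s,t)\in\mathbb{C}[s,t]$: $h_i\cdot g(s,t)=\lambda^i t\,g(s-i,t)$, $d_i\cdot g(s,t)=\lambda^i(s+i\gamma)g(s-i,t)$, $C\cdot g(s,t)=0$. The remaining actions are: - $\Omega$: $e_i\cdot g(s,t)=\lambda^i\alpha\,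 g(s-i,t-2)$, $f_i\cdot g(s,t)=-\frac{\lambda^i}{\alpha}(\frac t2-\beta)(\frac t2+\beta+1)g(s-i,t+2)$; - $\Delta$: $e_i\cdot g(s,t)=-\frac{\lambda^i}{\alpha}(\frac t2+\beta)(\frac t2-\beta-1)g(s-i,t-2)$, $f_i\cdot g(s,t)=\lambda^i\alpha\, g(s-i,t+2)$; - $\Theta$: $e_i\cdot g(s,t)=\lambda^i\alpha(\frac t2+\beta)g(s-i,t-2)$, $f_i\cdot g(s,t)=-\frac{\lambda^i}{\alpha}(\frac t2-\beta)g(s-i,t+2)$. For $\eta,\epsilon,\theta\in\mathbb{C}$, the Verma module is $\overline{V}(\eta,\epsilon,\theta)=U(\mathfrak{L})/I(\eta,\epsilon,\theta)$, where $I(\eta,\epsilon,\theta)$ is the left ideal of $U(\mathfrak{L})$ generated by $\{e_0,e_i,f_i,h_i,d_i\mid i\in\mathbb{N}\}\cup\{d_0-\eta,h_0-\epsilon,C-\theta\}$. Tensor products carry the usual action $x(u\otimes v)=xu\otimes v+u\otimes xv$ for $x\in\mathfrak{L}$. For $\lambda\in\mathbb{C}^*$ let $\mathfrak{b}_\lambda=\mathrm{span}_{\mathbb{C}}\{d_m-\lambda^m d_0,\ f_m,\ h_n,\ e_n,\ C\mid m\in\mathbb{N},n\in\mathbb{Z}_+\}$, a subalgebra of $\mathfrak{L}$. The $\mathfrak{b}_\lambda$-modules $\mathbb{C}[t]^{\Omega}_{\lambda,\alpha,\beta,\gamma,\eta,\epsilon,\theta}$, $\mathbb{C}[t]^{\Delta}_{\lambda,\alpha,\beta,\gamma,\eta,\epsilon,\theta}$,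 $\mathbb{C}[t]^{\Theta}_{\lambda,\alpha,\beta,\gamma,\eta,\epsilon,\theta}$ are the polynomial algebra $\mathbb{C}[t]$ as vector spaces, and in all three, for $m\in\mathbb{N}$, $n\in\mathbb{Z}_+$, $g(t)\in\mathbb{C}[t]$: $(d_m-\lambda^md_0)\circ g(t)=\lambda^m(m\gamma-\eta)g(t)$, $h_n\circ g(t)=\lambda^n(t+\delta_{n,0}\epsilon)g(t)$, $C\circ g(t)=\theta g(t)$. The remaining actions are: - superscript $\Omega$: $f_m\circ g(t)=-\frac{\lambda^m}{\alpha}(\frac t2-\beta)(\frac t2+\beta+1)g(t+2)$, $e_n\circ g(t)=\lambda^n\alpha\, g(t-2)$; - superscript $\Delta$: $f_m\circ g(t)=\lambda^m\alpha\, g(t+2)$, $e_n\circ g(t)=-\frac{\lambda^n}{\alpha}(\frac t2+\beta)(\frac t2-\beta-1)g(t-2)$; - superscript $\Theta$: $f_m\circ g(t)=-\frac{\lambda^m}{\alpha}(\frac t2-\beta)g(t+2)$, $e_n\circ g(t)=\lambda^n\alpha(\frac t2+\beta)g(t-2)$. For a $\mathfrak{b}_\lambda$-module $N$, $\mathrm{Ind}(N)=U(\mathfrak{L})\otimes_{U(\mathfrak{b}_\lambda)}N$. *)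

theory Defs
  imports
    "HOL-Library.Poly_Mapping"
    "HOL-Computational_Algebra.Polynomial"
    "HOL-Algebra.QuotRing"
    "HOL-Algebra.Module"
    Complex_Main
begin

text \<open>
  Complex vector spaces with a carrier are modules, in the sense of \<open>HOL-Algebra\<close>, over the
  following record; the fields \<open>mult\<close> and \<open>one\<close> of a module record play no role there.
\<close>

definition complex_ring :: "complex ring" where
  "complex_ring = \<lparr>carrier = UNIV, mult = (*), one = 1, zero = 0, add = (+)\<rparr>"


section \<open>Free vector spaces\<close>

text \<open>Finitely supported functions into the complex numbers, i.e. formal linear combinations.\<close>

definition scl :: "complex \<Rightarrow> ('a \<Rightarrow>\<^sub>0 complex) \<Rightarrow> ('a \<Rightarrow>\<^sub>0 complex)" where
  "scl c p = Poly_Mapping.map (\<lambda>z. c * z) p"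

abbreviation bas :: "'a \<Rightarrow> ('a \<Rightarrow>\<^sub>0 complex)" where
  "bas a \<equiv> Poly_Mapping.single a 1"

definition lin_ext :: "('a \<Rightarrow> ('b \<Rightarrow>\<^sub>0 complex)) \<Rightarrow> ('a \<Rightarrow>\<^sub>0 complex) \<Rightarrow> ('b \<Rightarrow>\<^sub>0 complex)" where
  "lin_ext f p = (\<Sum>a\<in>Poly_Mapping.keys p. scl (Poly_Mapping.lookup p a) (f a))"

lemma lookup_scl [simp]: "Poly_Mapping.lookup (scl c p) a = c * Poly_Mapping.lookup p a"
  by (simp add: scl_def Poly_Mapping.map.rep_eq when_def)

interpretation fvs: vector_space scl
  by unfold_locales (auto intro!: poly_mapping_eqI simp: lookup_add algebra_simps)

lemma lin_ext_bas [simp]: "lin_ext f (bas a) = f a"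
  by (simp add: lin_ext_def)

definition free_space :: "'a set \<Rightarrow> (complex, 'a \<Rightarrow>\<^sub>0 complex) module" where
  "free_space S = \<lparr>carrier = {p. Poly_Mapping.keys p \<subseteq> S}, mult = undefined, one = undefined,
     zero = 0, add = (+), smult = scl\<rparr>"


section \<open>Quotients\<close>

text \<open>
  The map induced by \<open>f\<close> on cosets, with values in the cosets of \<open>W\<close> in \<open>M\<close>; on representatives
  it is \<open>p \<mapsto> W + f p\<close>.  The union mirrors \<^const>\<open>rcoset_mult\<close> and is the common coset of all
  \<open>f p\<close> with \<open>p \<in> X\<close> whenever the induced map is well defined.
\<close>

definition coset_map ::
    "('b, 'm) ring_scheme \<Rightarrow> 'b set \<Rightarrow> ('a \<Rightarrow> 'b) \<Rightarrow> 'a set \<Rightarrow> 'b set" where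
  "coset_map M W f X = (\<Union>p\<in>X. W +>\<^bsub>M\<^esub> f p)"

definition quot_space :: "(complex, 'b, 'm) module_scheme \<Rightarrow> 'b set \<Rightarrow> (complex, 'b set) module" where
  "quot_space M W = \<lparr>carrier = a_rcosets\<^bsub>M\<^esub> W, mult = undefined, one = undefined,
     zero = W, add = set_add M, smult = (\<lambda>c. coset_map M W (\<lambda>v. c \<odot>\<^bsub>M\<^esub> v))\<rparr>"


section \<open>The affine-Virasoro algebra of type A1\<close>

datatype gen = Eg int | Fg int | Hg int | Dg int | Cg

type_synonym affvir = "gen \<Rightarrow>\<^sub>0 complex"

abbreviation "eL i \<equiv> bas (Eg i)"
abbreviation "fL i \<equiv> bas (Fg i)"
abbreviation "hL i \<equiv> bas (Hg i)"
abbreviation "dL i \<equiv> bas (Dg i)"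
abbreviation "cL \<equiv> bas Cg"

text \<open>
  Values on pairs that are not listed in the usual presentation follow from skew-symmetry; they are
  the equations with an outer minus sign, together with zero for the remaining pairs.
\<close>

fun gen_bracket :: "gen \<Rightarrow> gen \<Rightarrow> affvir" where
  "gen_bracket (Eg i) (Fg j) = hL (i + j) + scl (if i + j = 0 then of_int i else 0) cL"
| "gen_bracket (Fg j) (Eg i) = - (hL (i + j) + scl (if i + j = 0 then of_int i else 0) cL)"
| "gen_bracket (Hg i) (Eg j) = scl 2 (eL (i + j))"
| "gen_bracket (Eg j) (Hg i) = - scl 2 (eL (i + j))"
| "gen_bracket (Hg i) (Fg j) = scl (-2) (fL (i + j))"
| "gen_bracket (Fg j) (Hg i) = - scl (-2) (fL (i + j))"
| "gen_bracket (Dg i) (Dg j) =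
     scl (of_int (j - i)) (dL (i + j)) + scl (if i + j = 0 then of_int (i ^ 3 - i) / 12 else 0) cL"
| "gen_bracket (Dg i) (Hg j) = scl (of_int j) (hL (i + j))"
| "gen_bracket (Hg j) (Dg i) = - scl (of_int j) (hL (i + j))"
| "gen_bracket (Hg i) (Hg j) = scl (if i + j = 0 then 2 * of_int i else 0) cL"
| "gen_bracket (Dg i) (Eg j) = scl (of_int j) (eL (i + j))"
| "gen_bracket (Eg j) (Dg i) = - scl (of_int j) (eL (i + j))"
| "gen_bracket (Dg i) (Fg j) = scl (of_int j) (fL (i + j))"
| "gen_bracket (Fg j) (Dg i) = - scl (of_int j) (fL (i + j))"
| "gen_bracket _ _ = 0"

definition bracket :: "affvir \<Rightarrow> affvir \<Rightarrow> affvir" where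
  "bracket x y = lin_ext (\<lambda>a. lin_ext (gen_bracket a) y) x"

lemma bracket_bas [simp]: "bracket (bas a) (bas b) = gen_bracket a b"
  by (simp add: bracket_def)

definition b_sub :: "complex \<Rightarrow> affvir set" where
  "b_sub lam = fvs.span
     ({dL (int m) - scl (lam ^ m) (dL 0) |m. m \<ge> 1} \<union> {fL (int m) |m. m \<ge> 1}
       \<union> {hL (int n) |n. True} \<union> {eL (int n) |n. True} \<union> {cL})"


section \<open>Modules over a Lie subalgebra\<close>

record 'v lie_mod = "(complex, 'v) module" +
  act :: "affvir \<Rightarrow> 'v \<Rightarrow> 'v"

locale lie_module = module complex_ring M
  for B :: "affvir set" and M :: "('v, 'm) lie_mod_scheme" +
  assumes act_closed: "\<lbrakk>x \<in> B; v \<in> carrier M\<rbrakk> \<Longrightarrow> act M x v \<in> carrier M"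
    and act_add: "\<lbrakk>x \<in> B; v \<in> carrier M; w \<in> carrier M\<rbrakk>
      \<Longrightarrow> act M x (v \<oplus>\<^bsub>M\<^esub> w) = act M x v \<oplus>\<^bsub>M\<^esub> act M x w"
    and act_smult: "\<lbrakk>x \<in> B; v \<in> carrier M\<rbrakk> \<Longrightarrow> act M x (c \<odot>\<^bsub>M\<^esub> v) = c \<odot>\<^bsub>M\<^esub> act M x v"
    and add_act: "\<lbrakk>x \<in> B; y \<in> B; v \<in> carrier M\<rbrakk>
      \<Longrightarrow> act M (x + y) v = act M x v \<oplus>\<^bsub>M\<^esub> act M y v"
    and smult_act: "\<lbrakk>x \<in> B; v \<in> carrier M\<rbrakk> \<Longrightarrow> act M (scl c x) v = c \<odot>\<^bsub>M\<^esub> act M x v"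
    and bracket_act: "\<lbrakk>x \<in> B; y \<in> B; v \<in> carrier M\<rbrakk>
      \<Longrightarrow> act M (bracket x y) v = act M x (act M y v) \<ominus>\<^bsub>M\<^esub> act M y (act M x v)"

text \<open>An isomorphism of \<open>B\<close>-modules; that both sides satisfy the module laws is part of the claim.\<close>

definition lie_module_isomorphic ::
    "affvir set \<Rightarrow> ('v, 'm) lie_mod_scheme \<Rightarrow> ('w, 'n) lie_mod_scheme \<Rightarrow> bool" where
  "lie_module_isomorphic B M N \<longleftrightarrow> lie_module B M \<and> lie_module B N \<and>
     (\<exists>\<phi>. bij_betw \<phi> (carrier M) (carrier N) \<and>
        (\<forall>v\<in>carrier M. \<forall>w\<in>carrier M. \<phi> (v \<oplus>\<^bsub>M\<^esub> w) = \<phi> v \<oplus>\<^bsub>N\<^esub> \<phi> w) \<and>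
        (\<forall>c. \<forall>v\<in>carrier M. \<phi> (c \<odot>\<^bsub>M\<^esub> v) = c \<odot>\<^bsub>N\<^esub> \<phi> v) \<and>
        (\<forall>x\<in>B. \<forall>v\<in>carrier M. \<phi> (act M x v) = act N x (\<phi> v)))"


section \<open>Universal enveloping algebras\<close>

datatype 'a fword = Fword (letters: "'a list")

instantiation fword :: (type) monoid_add
begin
definition zero_fword :: "'a fword" where "0 = Fword []"
definition plus_fword :: "'a fword \<Rightarrow> 'a fword \<Rightarrow> 'a fword" where
  "v + w = Fword (letters v @ letters w)"
instance
  by standard (auto simp: zero_fword_def plus_fword_def)
end

text \<open>
  The monoid algebra of the free monoid of words is the free associative algebra.
  \<open>Uenv B\<close> is the free algebra on the set \<open>B\<close> modulo the two-sided ideal that makes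
  \<open>x \<mapsto> lett x\<close> linear and turns brackets into commutators (equivalently, the tensor algebra
  of \<open>B\<close> modulo \<open>x \<otimes> y - y \<otimes> x - [x,y]\<close>).
\<close>

type_synonym free_alg = "affvir fword \<Rightarrow>\<^sub>0 complex"

definition lett :: "affvir \<Rightarrow> free_alg" where
  "lett x = bas (Fword [x])"

definition free_algebra :: "affvir set \<Rightarrow> (complex, free_alg) module" where
  "free_algebra B = \<lparr>carrier = {p. \<forall>w\<in>Poly_Mapping.keys p. set (letters w) \<subseteq> B},
     mult = (*), one = 1, zero = 0, add = (+), smult = scl\<rparr>"

definition env_ideal :: "affvir set \<Rightarrow> free_alg set" where
  "env_ideal B = Idl\<^bsub>free_algebra B\<^esub>
     ({lett (x + y) - (lett x + lett y) |x y. x \<in> B \<and> y \<in> B}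
       \<union> {lett (scl c x) - scl c (lett x) |c x. x \<in> B}
       \<union> {lett x * lett y - lett y * lett x - lett (bracket x y) |x y. x \<in> B \<and> y \<in> B})"

definition Uenv :: "affvir set \<Rightarrow> (complex, free_alg set) module" where
  "Uenv B = ring.extend (free_algebra B Quot env_ideal B)
     (module.fields (\<lambda>c. coset_map (free_algebra B) (env_ideal B) (scl c)))"

abbreviation UL :: "(complex, free_alg set) module" where
  "UL \<equiv> Uenv UNIV"

definition U_in :: "affvir \<Rightarrow> free_alg set" where
  "U_in x = env_ideal UNIV +>\<^bsub>free_algebra UNIV\<^esub> lett x"

text \<open>The algebra homomorphism \<open>U(B) \<rightarrow> U(L)\<close> induced by the inclusion of \<open>B\<close>.\<close>

definition U_incl :: "free_alg set \<Rightarrow> free_alg set" where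
  "U_incl = coset_map (free_algebra UNIV) (env_ideal UNIV) (\<lambda>p. p)"

text \<open>
  A \<open>B\<close>-module is a \<open>U(B)\<close>-module, words acting by composition of the actions of their letters.
  For a \<open>B\<close>-module all representatives \<open>p\<close> of the class \<open>X\<close> act in the same way.
\<close>

definition free_act :: "('v, 'm) lie_mod_scheme \<Rightarrow> free_alg \<Rightarrow> 'v \<Rightarrow> 'v" where
  "free_act N p v =
     (\<Oplus>\<^bsub>N\<^esub>w\<in>Poly_Mapping.keys p. Poly_Mapping.lookup p w \<odot>\<^bsub>N\<^esub> foldr (act N) (letters w) v)"

definition U_act :: "('v, 'm) lie_mod_scheme \<Rightarrow> free_alg set \<Rightarrow> 'v \<Rightarrow> 'v" where
  "U_act N X v = the_elem ((\<lambda>p. free_act N p v) ` X)"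


section \<open>Tensor products\<close>

text \<open>
  The tensor product of \<open>M\<close> and \<open>N\<close> over a complex algebra with underlying set \<open>A\<close>, acting on \<open>M\<close>
  from the right by \<open>ra\<close> and on \<open>N\<close> from the left by \<open>la\<close>: the free vector space on
  \<open>carrier M \<times> carrier N\<close> modulo the bilinear and balancing relations.
\<close>

definition tensor_rel :: "'a set \<Rightarrow> ('m \<Rightarrow> 'a \<Rightarrow> 'm) \<Rightarrow> ('a \<Rightarrow> 'n \<Rightarrow> 'n) \<Rightarrow>
    (complex, 'm, 'x) module_scheme \<Rightarrow> (complex, 'n, 'y) module_scheme \<Rightarrow> ('m \<times> 'n \<Rightarrow>\<^sub>0 complex) set" where
  "tensor_rel A ra la M N = fvs.span
     ({bas (m \<oplus>\<^bsub>M\<^esub> m', n) - (bas (m, n) + bas (m', n)) |m m' n.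
          m \<in> carrier M \<and> m' \<in> carrier M \<and> n \<in> carrier N}
       \<union> {bas (m, n \<oplus>\<^bsub>N\<^esub> n') - (bas (m, n) + bas (m, n')) |m n n'.
          m \<in> carrier M \<and> n \<in> carrier N \<and> n' \<in> carrier N}
       \<union> {bas (c \<odot>\<^bsub>M\<^esub> m, n) - scl c (bas (m, n)) |c m n. m \<in> carrier M \<and> n \<in> carrier N}
       \<union> {bas (m, c \<odot>\<^bsub>N\<^esub> n) - scl c (bas (m, n)) |c m n. m \<in> carrier M \<and> n \<in> carrier N}
       \<union> {bas (ra m a, n) - bas (m, la a n) |m a n. m \<in> carrier M \<and> a \<in> A \<and> n \<in> carrier N})"

definition lie_tensor ::
    "('v, 'm) lie_mod_scheme \<Rightarrow> ('w, 'n) lie_mod_scheme \<Rightarrow> ('v \<times> 'w \<Rightarrow>\<^sub>0 complex) set lie_mod" where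
  "lie_tensor M N =
     (let F = free_space (carrier M \<times> carrier N);
          W = tensor_rel (UNIV :: complex set) (\<lambda>m c. c \<odot>\<^bsub>M\<^esub> m) (\<lambda>c n. c \<odot>\<^bsub>N\<^esub> n) M N
      in module.extend (quot_space F W)
           (lie_mod.fields (\<lambda>x. coset_map F W
              (lin_ext (\<lambda>(u, v). bas (act M x u, v) + bas (u, act N x v))))))"

definition Ind ::
    "affvir set \<Rightarrow> ('v, 'm) lie_mod_scheme \<Rightarrow> (free_alg set \<times> 'v \<Rightarrow>\<^sub>0 complex) set lie_mod" where
  "Ind B N =
     (let F = free_space (carrier UL \<times> carrier N);
          W = tensor_rel (carrier (Uenv B)) (\<lambda>u a. u \<otimes>\<^bsub>UL\<^esub> U_incl a) (U_act N) UL N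
      in module.extend (quot_space F W)
           (lie_mod.fields (\<lambda>x. coset_map F W (lin_ext (\<lambda>(u, n). bas (U_in x \<otimes>\<^bsub>UL\<^esub> u, n))))))"


section \<open>Verma modules\<close>

definition left_ideal :: "'a set \<Rightarrow> ('a, 'm) ring_scheme \<Rightarrow> bool" where
  "left_ideal I R \<longleftrightarrow> additive_subgroup I R \<and> (\<forall>a\<in>carrier R. \<forall>x\<in>I. a \<otimes>\<^bsub>R\<^esub> x \<in> I)"

definition gen_left_ideal :: "('a, 'm) ring_scheme \<Rightarrow> 'a set \<Rightarrow> 'a set" where
  "gen_left_ideal R S = \<Inter>{I. left_ideal I R \<and> S \<subseteq> I}"

definition verma_ideal :: "complex \<Rightarrow> complex \<Rightarrow> complex \<Rightarrow> free_alg set set" where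
  "verma_ideal \<eta> \<epsilon> \<theta> = gen_left_ideal UL
     ({U_in (eL 0)}
       \<union> {U_in x |x i. i \<ge> 1 \<and> x \<in> {eL (int i), fL (int i), hL (int i), dL (int i)}}
       \<union> {U_in (dL 0) \<ominus>\<^bsub>UL\<^esub> (\<eta> \<odot>\<^bsub>UL\<^esub> \<one>\<^bsub>UL\<^esub>),
          U_in (hL 0) \<ominus>\<^bsub>UL\<^esub> (\<epsilon> \<odot>\<^bsub>UL\<^esub> \<one>\<^bsub>UL\<^esub>),
          U_in cL \<ominus>\<^bsub>UL\<^esub> (\<theta> \<odot>\<^bsub>UL\<^esub> \<one>\<^bsub>UL\<^esub>)})"

definition verma :: "complex \<Rightarrow> complex \<Rightarrow> complex \<Rightarrow> free_alg set set lie_mod" where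
  "verma \<eta> \<epsilon> \<theta> = module.extend (quot_space UL (verma_ideal \<eta> \<epsilon> \<theta>))
     (lie_mod.fields (\<lambda>x. coset_map UL (verma_ideal \<eta> \<epsilon> \<theta>) (\<lambda>u. U_in x \<otimes>\<^bsub>UL\<^esub> u)))"


section \<open>The modules on polynomials in s and t\<close>

text \<open>
  \<open>\<complex>[s,t]\<close> is \<open>\<complex>[t][s]\<close>: the outer variable is \<open>s\<close>, the coefficients are polynomials in \<open>t\<close>.
  \<open>shift2 a b g\<close> is \<open>g(s - a, t + b)\<close>, \<open>shift1 b g\<close> is \<open>g(t + b)\<close>, and \<open>in_t p\<close> is \<open>p(t)\<close> viewed
  in \<open>\<complex>[s,t]\<close>; the polynomial \<open>t/2 + c\<close> is \<open>[:c, 1/2:]\<close>.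
\<close>

type_synonym poly_t = "complex poly"
type_synonym poly_st = "complex poly poly"

definition shift1 :: "complex \<Rightarrow> poly_t \<Rightarrow> poly_t" where
  "shift1 b g = pcompose g [:b, 1:]"

definition shift2 :: "complex \<Rightarrow> complex \<Rightarrow> poly_st \<Rightarrow> poly_st" where
  "shift2 a b g = pcompose (map_poly (shift1 b) g) [:[:- a:], 1:]"

definition in_t :: "poly_t \<Rightarrow> poly_st" where
  "in_t p = [:p:]"

definition s_var :: poly_st where
  "s_var = [:0, 1:]"

lemma poly_shift1: "poly (shift1 b g) y = poly g (y + b)"
  by (simp add: shift1_def poly_pcompose add.commute)

lemma poly_shift2: "poly (poly (shift2 a b g) [:x:]) y = poly (poly g [:x - a:]) (y + b)"
proof -
  have "poly (poly (map_poly (shift1 b) g) [:z:]) y = poly (poly g [:z:]) (y + b)" for z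
  proof (induction g)
    case (pCons a g)
    have "map_poly (shift1 b) (pCons a g) = pCons (shift1 b a) (map_poly (shift1 b) g)"
      by (rule poly_eqI) (simp add: coeff_map_poly shift1_def coeff_pCons split: nat.split)
    then show ?case
      using pCons by (simp add: poly_shift1)
  qed simp
  then show ?thesis
    by (simp add: shift2_def poly_pcompose)
qed

text \<open>The common part of the three modules; \<open>ea\<close> and \<open>fa\<close> are the actions of \<open>eL i\<close> and \<open>fL i\<close>.\<close>

fun st_act :: "complex \<Rightarrow> complex \<Rightarrow> (int \<Rightarrow> poly_st \<Rightarrow> poly_st) \<Rightarrow> (int \<Rightarrow> poly_st \<Rightarrow> poly_st)
    \<Rightarrow> gen \<Rightarrow> poly_st \<Rightarrow> poly_st" where
  "st_act lam \<gamma> ea fa (Eg i) g = ea i g"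
| "st_act lam \<gamma> ea fa (Fg i) g = fa i g"
| "st_act lam \<gamma> ea fa (Hg i) g = in_t [:0, lam powi i:] * shift2 (of_int i) 0 g"
| "st_act lam \<gamma> ea fa (Dg i) g =
     in_t [:lam powi i:] * (s_var + in_t [:of_int i * \<gamma>:]) * shift2 (of_int i) 0 g"
| "st_act lam \<gamma> ea fa Cg g = 0"

definition st_module :: "complex \<Rightarrow> complex \<Rightarrow> (int \<Rightarrow> poly_st \<Rightarrow> poly_st) \<Rightarrow> (int \<Rightarrow> poly_st \<Rightarrow> poly_st)
    \<Rightarrow> poly_st lie_mod" where
  "st_module lam \<gamma> ea fa = \<lparr>carrier = UNIV, mult = undefined, one = undefined,
     zero = 0, add = (+), smult = (\<lambda>c g. in_t [:c:] * g),
     act = (\<lambda>x g. \<Sum>k\<in>Poly_Mapping.keys x.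
              in_t [:Poly_Mapping.lookup x k:] * st_act lam \<gamma> ea fa k g)\<rparr>"

definition Omega :: "complex \<Rightarrow> complex \<Rightarrow> complex \<Rightarrow> complex \<Rightarrow> poly_st lie_mod" where
  "Omega lam \<alpha> \<beta> \<gamma> = st_module lam \<gamma>
     (\<lambda>i g. in_t [:lam powi i * \<alpha>:] * shift2 (of_int i) (-2) g)
     (\<lambda>i g. in_t ([:- (lam powi i / \<alpha>):] * [:- \<beta>, 1/2:] * [:\<beta> + 1, 1/2:]) * shift2 (of_int i) 2 g)"

definition Delta :: "complex \<Rightarrow> complex \<Rightarrow> complex \<Rightarrow> complex \<Rightarrow> poly_st lie_mod" where
  "Delta lam \<alpha> \<beta> \<gamma> = st_module lam \<gamma>
     (\<lambda>i g. in_t ([:- (lam powi i / \<alpha>):] * [:\<beta>, 1/2:] * [:- \<beta> - 1, 1/2:]) * shift2 (of_int i) (-2) g)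
     (\<lambda>i g. in_t [:lam powi i * \<alpha>:] * shift2 (of_int i) 2 g)"

definition Theta :: "complex \<Rightarrow> complex \<Rightarrow> complex \<Rightarrow> complex \<Rightarrow> poly_st lie_mod" where
  "Theta lam \<alpha> \<beta> \<gamma> = st_module lam \<gamma>
     (\<lambda>i g. in_t ([:lam powi i * \<alpha>:] * [:\<beta>, 1/2:]) * shift2 (of_int i) (-2) g)
     (\<lambda>i g. in_t ([:- (lam powi i / \<alpha>):] * [:- \<beta>, 1/2:]) * shift2 (of_int i) 2 g)"


section \<open>The modules on polynomials in t over the subalgebra\<close>

text \<open>
  In the basis of \<open>b_sub lam\<close> given by its spanning set, the coordinate of \<open>x\<close> at
  \<open>dL m - lam ^ m dL 0\<close> is the coordinate of \<open>x\<close> at \<open>dL m\<close> (\<open>m \<ge> 1\<close>), and the other coordinates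
  are those in the basis of the whole algebra.  Hence the linear extension to \<open>b_sub lam\<close> of the
  prescribed action is obtained by letting \<open>dL m\<close> act as prescribed for \<open>dL m - lam ^ m dL 0\<close> and
  \<open>dL 0\<close> act by zero; see \<open>act_t_module_bas\<close> and \<open>act_t_module_d\<close> below.  Values of \<open>act\<close> outside
  \<open>b_sub lam\<close> are irrelevant.
\<close>

fun t_act :: "complex \<Rightarrow> complex \<Rightarrow> complex \<Rightarrow> complex \<Rightarrow> complex
    \<Rightarrow> (int \<Rightarrow> poly_t \<Rightarrow> poly_t) \<Rightarrow> (int \<Rightarrow> poly_t \<Rightarrow> poly_t) \<Rightarrow> gen \<Rightarrow> poly_t \<Rightarrow> poly_t" where
  "t_act lam \<gamma> \<eta> \<epsilon> \<theta> ea fa (Eg n) g = ea n g"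
| "t_act lam \<gamma> \<eta> \<epsilon> \<theta> ea fa (Fg m) g = fa m g"
| "t_act lam \<gamma> \<eta> \<epsilon> \<theta> ea fa (Hg n) g = [:lam powi n:] * [:if n = 0 then \<epsilon> else 0, 1:] * g"
| "t_act lam \<gamma> \<eta> \<epsilon> \<theta> ea fa (Dg m) g =
     (if m = 0 then 0 else [:lam powi m * (of_int m * \<gamma> - \<eta>):] * g)"
| "t_act lam \<gamma> \<eta> \<epsilon> \<theta> ea fa Cg g = [:\<theta>:] * g"

definition t_module :: "complex \<Rightarrow> complex \<Rightarrow> complex \<Rightarrow> complex \<Rightarrow> complex
    \<Rightarrow> (int \<Rightarrow> poly_t \<Rightarrow> poly_t) \<Rightarrow> (int \<Rightarrow> poly_t \<Rightarrow> poly_t) \<Rightarrow> poly_t lie_mod" where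
  "t_module lam \<gamma> \<eta> \<epsilon> \<theta> ea fa = \<lparr>carrier = UNIV, mult = undefined, one = undefined,
     zero = 0, add = (+), smult = (\<lambda>c g. [:c:] * g),
     act = (\<lambda>x g. \<Sum>k\<in>Poly_Mapping.keys x.
              [:Poly_Mapping.lookup x k:] * t_act lam \<gamma> \<eta> \<epsilon> \<theta> ea fa k g)\<rparr>"

lemma act_t_module_bas:
  "act (t_module lam \<gamma> \<eta> \<epsilon> \<theta> ea fa) (bas k) g = t_act lam \<gamma> \<eta> \<epsilon> \<theta> ea fa k g"
  by (simp add: t_module_def)

lemma act_t_module_d:
  assumes "m \<ge> 1"
  shows "act (t_module lam \<gamma> \<eta> \<epsilon> \<theta> ea fa) (dL (int m) - scl (lam ^ m) (dL 0)) g =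
    [:lam ^ m * (of_nat m * \<gamma> - \<eta>):] * g"
proof -
  let ?x = "dL (int m) - scl (lam ^ m) (dL 0)"
  have keys: "Poly_Mapping.keys ?x \<subseteq> {Dg (int m), Dg 0}"
    by (auto simp: in_keys_iff lookup_minus lookup_single when_def split: if_splits)
  have "act (t_module lam \<gamma> \<eta> \<epsilon> \<theta> ea fa) ?x g =
    (\<Sum>k\<in>{Dg (int m), Dg 0}. [:Poly_Mapping.lookup ?x k:] * t_act lam \<gamma> \<eta> \<epsilon> \<theta> ea fa k g)"
    unfolding t_module_def
    by (simp del: t_act.simps, rule sum.mono_neutral_left)
       (use keys in \<open>auto simp: in_keys_iff simp del: t_act.simps\<close>)
  also have "\<dots> = [:lam ^ m * (of_nat m * \<gamma> - \<eta>):] * g"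
    using assms by (simp add: lookup_minus lookup_single)
  finally show ?thesis .
qed

definition t_Omega :: "complex \<Rightarrow> complex \<Rightarrow> complex \<Rightarrow> complex \<Rightarrow> complex \<Rightarrow> complex \<Rightarrow> complex
    \<Rightarrow> poly_t lie_mod" where
  "t_Omega lam \<alpha> \<beta> \<gamma> \<eta> \<epsilon> \<theta> = t_module lam \<gamma> \<eta> \<epsilon> \<theta>
     (\<lambda>n g. [:lam powi n * \<alpha>:] * shift1 (-2) g)
     (\<lambda>m g. [:- (lam powi m / \<alpha>):] * [:- \<beta>, 1/2:] * [:\<beta> + 1, 1/2:] * shift1 2 g)"

definition t_Delta :: "complex \<Rightarrow> complex \<Rightarrow> complex \<Rightarrow> complex \<Rightarrow> complex \<Rightarrow> complex \<Rightarrow> complex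
    \<Rightarrow> poly_t lie_mod" where
  "t_Delta lam \<alpha> \<beta> \<gamma> \<eta> \<epsilon> \<theta> = t_module lam \<gamma> \<eta> \<epsilon> \<theta>
     (\<lambda>n g. [:- (lam powi n / \<alpha>):] * [:\<beta>, 1/2:] * [:- \<beta> - 1, 1/2:] * shift1 (-2) g)
     (\<lambda>m g. [:lam powi m * \<alpha>:] * shift1 2 g)"

definition t_Theta :: "complex \<Rightarrow> complex \<Rightarrow> complex \<Rightarrow> complex \<Rightarrow> complex \<Rightarrow> complex \<Rightarrow> complex
    \<Rightarrow> poly_t lie_mod" where
  "t_Theta lam \<alpha> \<beta> \<gamma> \<eta> \<epsilon> \<theta> = t_module lam \<gamma> \<eta> \<epsilon> \<theta>
     (\<lambda>n g. [:lam powi n * \<alpha>:] * [:\<beta>, 1/2:] * shift1 (-2) g)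
     (\<lambda>m g. [:- (lam powi m / \<alpha>):] * [:- \<beta>, 1/2:] * shift1 2 g)"

end

theory Submission
  imports Defs
begin

text \<open>
  By their universal properties, the two modules have the same homomorphisms into any module \<open>X\<close>.

  A homomorphism from the induced module to \<open>X\<close> is, by Frobenius reciprocity, a homomorphism
  \<open>\<complex>[t] \<rightarrow> X\<close> over \<open>b_sub lam\<close> (\<open>Ind_hom_lift\<close>, \<open>Ind_hom_eqI\<close>).  A homomorphism from
  \<open>\<complex>[s,t] \<otimes> V\<close> to \<open>X\<close>, where \<open>V\<close> is the Verma module, is a homomorphism from \<open>V\<close> to the linear maps
  \<open>\<complex>[s,t] \<rightarrow> X\<close>, and hence a highest weight vector among these maps.  Let \<open>b_plus\<close> be the subalgebra
  spanned by the generators of nonnegative degree without \<open>f\<^sub>0\<close>; it acts on the highest weight vector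
  of \<open>V\<close> by a character \<open>\<chi>\<close>.  A highest weight vector among the linear maps is then a homomorphism
  over \<open>b_plus\<close> from \<open>\<complex>[s,t]\<close>, with action twisted by \<open>\<chi>\<close>, to \<open>X\<close>
  (\<open>hom_lift\<close>, \<open>hom_eqI\<close>).

  It remains to compare \<open>b_sub lam\<close> with \<open>b_plus\<close>.  The former has codimension one in the latter, with
  complement spanned by \<open>d\<^sub>0\<close>: it consists of the elements whose component \<open>\<Sum> x\<^sub>m d\<^sub>m\<close> satisfies
  \<open>\<Sum> x\<^sub>m lam\<^sup>m = 0\<close> (\<open>b_sub_eq\<close>).  In the twisted module, \<open>d\<^sub>0\<close> acts as multiplication by \<open>s + \<eta>\<close>,
  and \<open>b_sub lam\<close> preserves \<open>\<complex>[t]\<close> and acts on it in the prescribed way (\<open>twisted_in_t\<close>).  Since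
  \<open>\<complex>[s,t]\<close> is free on \<open>\<complex>[t]\<close> over \<open>\<complex>[s]\<close>, a homomorphism \<open>\<complex>[t] \<rightarrow> X\<close> over \<open>b_sub lam\<close> extends
  to exactly one homomorphism \<open>\<complex>[s,t] \<rightarrow> X\<close> over \<open>b_plus\<close>
  (\<open>twisted_hom_lift\<close>, \<open>twisted_unique\<close>).

  The families \<open>\<Omega>\<close>, \<open>\<Delta>\<close> and \<open>\<Theta>\<close> differ in two polynomials \<open>A\<close> and \<open>B\<close> by which \<open>e\<^sub>i\<close> and \<open>f\<^sub>i\<close>
  act; the argument uses only \<open>A(t) B(t - 2) - B(t) A(t + 2) = t\<close>.
\<close>

section \<open>Complex vector spaces, linear maps and quotients\<close>

text \<open>
  Complex vector spaces are handled abstractly, by their carrier and operations: the spaces that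
  occur are quotients of quotients, so that their elements are sets and do not fill a type.
\<close>

abbreviation cmodule :: "(complex, 'a, 'm) module_scheme \<Rightarrow> bool" where
  "cmodule M \<equiv> module complex_ring M"

lemma complex_ring_simps [simp]:
  "carrier complex_ring = UNIV" "mult complex_ring = (*)" "one complex_ring = 1"
  "zero complex_ring = 0" "add complex_ring = (+)"
  by (simp_all add: complex_ring_def)

lemma cring_complex_ring: "cring complex_ring"
proof (rule cringI)
  show "abelian_group complex_ring"
    by (rule abelian_groupI) (auto intro: exI[of _ "- x" for x] simp: add_eq_0_iff2)
  show "Group.comm_monoid complex_ring"
    by (rule comm_monoidI) auto
qed (auto simp: algebra_simps)

lemma a_inv_complex_ring [simp]: "\<ominus>\<^bsub>complex_ring\<^esub> c = - c"
proof -
  interpret cring complex_ring by (rule cring_complex_ring)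
  show ?thesis by (rule minus_equality) auto
qed

text \<open>
  The assumption on multiplication by \<open>0\<close> replaces the existence of additive inverses, since
  then \<open>(-1) \<odot> x\<close> is inverse to \<open>x\<close>.  In this form the axioms pass to quotients by checking
  equations on representatives.
\<close>

lemma cmoduleI:
  fixes M (structure)
  assumes "\<And>x y. \<lbrakk>x \<in> carrier M; y \<in> carrier M\<rbrakk> \<Longrightarrow> x \<oplus> y \<in> carrier M"
    and "\<And>x y z. \<lbrakk>x \<in> carrier M; y \<in> carrier M; z \<in> carrier M\<rbrakk> \<Longrightarrow> (x \<oplus> y) \<oplus> z = x \<oplus> (y \<oplus> z)"
    and comm: "\<And>x y. \<lbrakk>x \<in> carrier M; y \<in> carrier M\<rbrakk> \<Longrightarrow> x \<oplus> y = y \<oplus> x"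
    and "\<zero> \<in> carrier M"
    and "\<And>x. x \<in> carrier M \<Longrightarrow> \<zero> \<oplus> x = x"
    and smult: "\<And>c x. x \<in> carrier M \<Longrightarrow> c \<odot>\<^bsub>M\<^esub> x \<in> carrier M"
    and ldistr: "\<And>b c x. x \<in> carrier M \<Longrightarrow> (b + c) \<odot>\<^bsub>M\<^esub> x = b \<odot>\<^bsub>M\<^esub> x \<oplus> c \<odot>\<^bsub>M\<^esub> x"
    and "\<And>c x y. \<lbrakk>x \<in> carrier M; y \<in> carrier M\<rbrakk> \<Longrightarrow> c \<odot>\<^bsub>M\<^esub> (x \<oplus> y) = c \<odot>\<^bsub>M\<^esub> x \<oplus> c \<odot>\<^bsub>M\<^esub> y"
    and "\<And>b c x. x \<in> carrier M \<Longrightarrow> (b * c) \<odot>\<^bsub>M\<^esub> x = b \<odot>\<^bsub>M\<^esub> (c \<odot>\<^bsub>M\<^esub> x)"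
    and one: "\<And>x. x \<in> carrier M \<Longrightarrow> 1 \<odot>\<^bsub>M\<^esub> x = x"
    and zero: "\<And>x. x \<in> carrier M \<Longrightarrow> 0 \<odot>\<^bsub>M\<^esub> x = \<zero>"
  shows "cmodule M"
proof (rule moduleI)
  show "abelian_group M"
  proof (rule abelian_groupI)
    fix x assume x: "x \<in> carrier M"
    have "(-1) \<odot>\<^bsub>M\<^esub> x \<oplus> x = (-1 + 1) \<odot>\<^bsub>M\<^esub> x"
      unfolding ldistr[OF x] using one[OF x] by simp
    then have "(-1) \<odot>\<^bsub>M\<^esub> x \<oplus> x = \<zero>"
      using zero[OF x] by simp
    then show "\<exists>y\<in>carrier M. y \<oplus> x = \<zero>"
      using smult[OF x] by blast
  qed (use assms in auto)
qed (use assms cring_complex_ring in auto)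

lemma cmoduleD:
  assumes "cmodule M"
  shows "x \<in> carrier M \<Longrightarrow> c \<odot>\<^bsub>M\<^esub> x \<in> carrier M"
    and "x \<in> carrier M \<Longrightarrow> (b + c) \<odot>\<^bsub>M\<^esub> x = b \<odot>\<^bsub>M\<^esub> x \<oplus>\<^bsub>M\<^esub> c \<odot>\<^bsub>M\<^esub> x"
    and "\<lbrakk>x \<in> carrier M; y \<in> carrier M\<rbrakk> \<Longrightarrow> c \<odot>\<^bsub>M\<^esub> (x \<oplus>\<^bsub>M\<^esub> y) = c \<odot>\<^bsub>M\<^esub> x \<oplus>\<^bsub>M\<^esub> c \<odot>\<^bsub>M\<^esub> y"
    and "x \<in> carrier M \<Longrightarrow> (b * c) \<odot>\<^bsub>M\<^esub> x = b \<odot>\<^bsub>M\<^esub> (c \<odot>\<^bsub>M\<^esub> x)"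
    and "x \<in> carrier M \<Longrightarrow> 1 \<odot>\<^bsub>M\<^esub> x = x"
    and "x \<in> carrier M \<Longrightarrow> 0 \<odot>\<^bsub>M\<^esub> x = \<zero>\<^bsub>M\<^esub>"
proof -
  interpret M: module complex_ring M by fact
  show "x \<in> carrier M \<Longrightarrow> c \<odot>\<^bsub>M\<^esub> x \<in> carrier M"
    and "x \<in> carrier M \<Longrightarrow> (b + c) \<odot>\<^bsub>M\<^esub> x = b \<odot>\<^bsub>M\<^esub> x \<oplus>\<^bsub>M\<^esub> c \<odot>\<^bsub>M\<^esub> x"
    and "\<lbrakk>x \<in> carrier M; y \<in> carrier M\<rbrakk> \<Longrightarrow> c \<odot>\<^bsub>M\<^esub> (x \<oplus>\<^bsub>M\<^esub> y) = c \<odot>\<^bsub>M\<^esub> x \<oplus>\<^bsub>M\<^esub> c \<odot>\<^bsub>M\<^esub> y"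
    and "x \<in> carrier M \<Longrightarrow> (b * c) \<odot>\<^bsub>M\<^esub> x = b \<odot>\<^bsub>M\<^esub> (c \<odot>\<^bsub>M\<^esub> x)"
    and "x \<in> carrier M \<Longrightarrow> 1 \<odot>\<^bsub>M\<^esub> x = x"
    and "x \<in> carrier M \<Longrightarrow> 0 \<odot>\<^bsub>M\<^esub> x = \<zero>\<^bsub>M\<^esub>"
    using M.smult_closed[of c x] M.smult_l_distr[of b c x] M.smult_r_distr[of c x y]
      M.smult_assoc1[of b c x] M.smult_one[of x] M.smult_l_null[of x] by simp_all
qed

lemma cmodule_smult_commute:
  assumes "cmodule M" "x \<in> carrier M"
  shows "b \<odot>\<^bsub>M\<^esub> (c \<odot>\<^bsub>M\<^esub> x) = c \<odot>\<^bsub>M\<^esub> (b \<odot>\<^bsub>M\<^esub> x)"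
  using cmoduleD(4)[OF assms, of b c] cmoduleD(4)[OF assms, of c b] by (simp add: mult.commute)

text \<open>
  This is the cancellation of the mixed terms in
  \<open>x (y (u \<otimes> v)) - y (x (u \<otimes> v))\<close>.
\<close>

lemma (in abelian_group) add_cancel_middle:
  assumes "p \<in> carrier G" "q \<in> carrier G" "r \<in> carrier G" "s \<in> carrier G" "t \<in> carrier G" "u \<in> carrier G"
  shows "(p \<oplus> q \<oplus> (r \<oplus> s)) \<ominus> (t \<oplus> r \<oplus> (q \<oplus> u)) = (p \<ominus> t) \<oplus> (s \<ominus> u)"
proof -
  let ?x = "p \<ominus> t" and ?y = "s \<ominus> u"
  have x: "?x \<in> carrier G" "?y \<in> carrier G" using assms by auto
  have "p = ?x \<oplus> t" "s = ?y \<oplus> u"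
    using assms by (auto simp: minus_eq a_assoc l_neg)
  moreover have "(x \<oplus> t) \<oplus> q \<oplus> (r \<oplus> (y \<oplus> u)) = (x \<oplus> y) \<oplus> (t \<oplus> r \<oplus> (q \<oplus> u))"
    if "x \<in> carrier G" "y \<in> carrier G" for x y
    using assms that by (simp add: a_ac)
  ultimately have "p \<oplus> q \<oplus> (r \<oplus> s) = (?x \<oplus> ?y) \<oplus> (t \<oplus> r \<oplus> (q \<oplus> u))"
    using x by metis
  then show ?thesis
    using assms x by (simp add: minus_eq a_assoc r_neg)
qed

definition clinear ::
    "(complex, 'a, 'm) module_scheme \<Rightarrow> (complex, 'b, 'n) module_scheme \<Rightarrow> ('a \<Rightarrow> 'b) \<Rightarrow> bool" where
  "clinear M N f \<longleftrightarrow> (\<forall>v\<in>carrier M. f v \<in> carrier N) \<and>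
     (\<forall>v\<in>carrier M. \<forall>w\<in>carrier M. f (v \<oplus>\<^bsub>M\<^esub> w) = f v \<oplus>\<^bsub>N\<^esub> f w) \<and>
     (\<forall>c. \<forall>v\<in>carrier M. f (c \<odot>\<^bsub>M\<^esub> v) = c \<odot>\<^bsub>N\<^esub> f v)"

lemma clinearI:
  assumes "\<And>v. v \<in> carrier M \<Longrightarrow> f v \<in> carrier N"
    and "\<And>v w. \<lbrakk>v \<in> carrier M; w \<in> carrier M\<rbrakk> \<Longrightarrow> f (v \<oplus>\<^bsub>M\<^esub> w) = f v \<oplus>\<^bsub>N\<^esub> f w"
    and "\<And>c v. v \<in> carrier M \<Longrightarrow> f (c \<odot>\<^bsub>M\<^esub> v) = c \<odot>\<^bsub>N\<^esub> f v"
  shows "clinear M N f"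
  using assms by (auto simp: clinear_def)

lemma clinearD:
  assumes "clinear M N f"
  shows "v \<in> carrier M \<Longrightarrow> f v \<in> carrier N"
    and "\<lbrakk>v \<in> carrier M; w \<in> carrier M\<rbrakk> \<Longrightarrow> f (v \<oplus>\<^bsub>M\<^esub> w) = f v \<oplus>\<^bsub>N\<^esub> f w"
    and "v \<in> carrier M \<Longrightarrow> f (c \<odot>\<^bsub>M\<^esub> v) = c \<odot>\<^bsub>N\<^esub> f v"
  using assms by (auto simp: clinear_def)

lemma clinear_zero:
  assumes "cmodule M" "cmodule N" "clinear M N f"
  shows "f \<zero>\<^bsub>M\<^esub> = \<zero>\<^bsub>N\<^esub>"
proof -
  interpret M: module complex_ring M by fact
  interpret N: module complex_ring N by fact
  have "f \<zero>\<^bsub>M\<^esub> = f (0 \<odot>\<^bsub>M\<^esub> \<zero>\<^bsub>M\<^esub>)" using M.smult_l_null[of "\<zero>\<^bsub>M\<^esub>"] by simp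
  also have "\<dots> = 0 \<odot>\<^bsub>N\<^esub> f \<zero>\<^bsub>M\<^esub>" using clinearD(3)[OF assms(3), of "\<zero>\<^bsub>M\<^esub>" 0] by simp
  also have "\<dots> = \<zero>\<^bsub>N\<^esub>" using N.smult_l_null[of "f \<zero>\<^bsub>M\<^esub>"] clinearD(1)[OF assms(3)] by simp
  finally show ?thesis .
qed

lemma cmodule_minus:
  assumes "cmodule M" "v \<in> carrier M" "w \<in> carrier M"
  shows "v \<ominus>\<^bsub>M\<^esub> w = v \<oplus>\<^bsub>M\<^esub> (-1) \<odot>\<^bsub>M\<^esub> w"
proof -
  interpret M: module complex_ring M by fact
  show ?thesis using M.smult_l_minus[of 1 w] M.smult_one[of w] assms(2,3) by (simp add: M.minus_eq)
qed

lemma clinear_compose: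
  "clinear M N f \<Longrightarrow> clinear N P g \<Longrightarrow> clinear M P (\<lambda>v. g (f v))"
  by (simp add: clinear_def)

lemma clinear_add:
  assumes "cmodule N" "clinear M N f" "clinear M N g"
  shows "clinear M N (\<lambda>v. f v \<oplus>\<^bsub>N\<^esub> g v)"
proof -
  interpret N: module complex_ring N by fact
  note L = clinearD[OF assms(2)] clinearD[OF assms(3)]
  show ?thesis
    by (rule clinearI) (simp_all add: L N.a_ac cmoduleD[OF assms(1)])
qed

lemma clinear_smult:
  assumes "cmodule N" "clinear M N f"
  shows "clinear M N (\<lambda>v. c \<odot>\<^bsub>N\<^esub> f v)"
proof -
  interpret N: module complex_ring N by fact
  note L = clinearD[OF assms(2)]
  show ?thesis
    by (rule clinearI)
      (simp_all add: L cmoduleD(1,3)[OF assms(1)] cmodule_smult_commute[OF assms(1), of _ c])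
qed

lemma clinear_cong:
  assumes "cmodule M" "\<And>v. v \<in> carrier M \<Longrightarrow> f v = g v"
  shows "clinear M N f = clinear M N g"
proof -
  interpret M: module complex_ring M by fact
  show ?thesis unfolding clinear_def using assms(2) by (auto cong: ball_cong)
qed

lemma clinear_diff:
  assumes "cmodule M" "cmodule N" "clinear M N f" "clinear M N g"
  shows "clinear M N (\<lambda>v. f v \<ominus>\<^bsub>N\<^esub> g v)"
proof -
  have "clinear M N (\<lambda>v. f v \<oplus>\<^bsub>N\<^esub> (-1) \<odot>\<^bsub>N\<^esub> g v)"
    by (intro clinear_add clinear_smult assms)
  then show ?thesis
    by (subst clinear_cong[OF assms(1) cmodule_minus[OF assms(2)]])
      (simp_all add: clinearD(1)[OF assms(3)] clinearD(1)[OF assms(4)])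
qed

lemma module_extend_simps [simp]:
  "carrier (module.extend M x) = carrier M" "add (module.extend M x) = add M"
  "zero (module.extend M x) = zero M" "smult (module.extend M x) = smult M"
  "act (module.extend M (lie_mod.fields a)) = a"
  by (simp_all add: module.defs lie_mod.defs)

lemma cmodule_transfer:
  assumes "cmodule M" "carrier N = carrier M" "add N = add M" "zero N = zero M" "smult N = smult M"
  shows "cmodule N"
proof -
  interpret M: module complex_ring M by fact
  show ?thesis
    by (rule cmoduleI) (simp_all add: assms(2-5) M.a_ac cmoduleD[OF assms(1)])
qed

lemma cmodule_extend: "cmodule M \<Longrightarrow> cmodule (module.extend M x)"
  by (rule cmodule_transfer) simp_all

lemma clinear_extend [simp]:
  "clinear (module.extend M x) N f = clinear M N f"
  "clinear N' (module.extend M x) g = clinear N' M g"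
  by (simp_all add: clinear_def)

text \<open>
  Quotients by subspaces.  Everything about \<^const>\<open>quot_space\<close> that is needed later is that
  the projection is a surjective linear map with kernel \<open>W\<close>, and that \<^const>\<open>coset_map\<close> computes
  on representatives.
\<close>

locale csubspace = module complex_ring M for M (structure) + fixes W
  assumes W_sub: "W \<subseteq> carrier M" and W_zero: "\<zero> \<in> W"
    and W_add: "\<lbrakk>v \<in> W; w \<in> W\<rbrakk> \<Longrightarrow> v \<oplus> w \<in> W"
    and W_smult: "v \<in> W \<Longrightarrow> c \<odot>\<^bsub>M\<^esub> v \<in> W"
begin

lemma cmod: "cmodule M" by (rule module_axioms)

lemma abelian_subgroup: "abelian_subgroup W M"
proof (rule abelian_subgroupI3)
  show "additive_subgroup W M"
  proof (rule additive_subgroupI, rule add.subgroupI)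
    show "W \<noteq> {}" using W_zero by auto
    fix v assume v: "v \<in> W"
    then have "\<ominus> v = (-1) \<odot>\<^bsub>M\<^esub> v"
      using W_sub smult_l_minus[of 1 v] smult_one[of v] by auto
    then show "\<ominus> v \<in> W" using v W_smult by simp
  qed (use W_sub W_add in auto)
qed unfold_locales

lemmas coset_add = abelian_subgroup.a_rcos_sum[OF abelian_subgroup]
lemmas coset_self = abelian_subgroup.a_rcos_self[OF abelian_subgroup]

lemma mem_coset_iff:
  assumes "v \<in> carrier M"
  shows "w \<in> W +> v \<longleftrightarrow> (\<exists>u\<in>W. w = u \<oplus> v)"
  by (auto simp: a_r_coset_def')

lemma coset_shift:
  assumes "v \<in> carrier M" "u \<in> W"
  shows "W +> (u \<oplus> v) = W +> v"
proof -
  have "u \<oplus> v \<in> W +> v" using assms by (auto simp: mem_coset_iff)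
  then show ?thesis
    using a_repr_independence assms additive_subgroup.a_subgroup
      abelian_subgroup[unfolded abelian_subgroup_def] by blast
qed

lemma coset_zero: "W +> \<zero> = W"
  using W_sub by simp

lemma coset_eqI:
  assumes "v \<in> carrier M" "w \<in> carrier M" "v \<ominus> w \<in> W"
  shows "W +> v = W +> w"
proof -
  have "v = (v \<ominus> w) \<oplus> w" using assms by (auto simp: minus_eq a_assoc l_neg)
  then show ?thesis using coset_shift[OF assms(2,3)] by simp
qed

lemma coset_eqD:
  assumes "v \<in> carrier M" "w \<in> carrier M" "W +> v = W +> w"
  shows "v \<ominus> w \<in> W"
proof -
  have "v \<in> W +> w" using coset_self[OF assms(1)] assms(3) by simp
  then obtain u where "u \<in> W" "v = u \<oplus> w" using assms by (auto simp: mem_coset_iff)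
  then show ?thesis using assms W_sub by (auto simp: minus_eq a_assoc r_neg)
qed

lemma coset_eq_zero_iff:
  assumes "v \<in> carrier M"
  shows "W +> v = W \<longleftrightarrow> v \<in> W"
proof -
  have "v \<ominus> \<zero> = v" using assms by (simp add: minus_eq add.inv_one)
  then show ?thesis
    using coset_eqI[OF assms zero_closed] coset_eqD[OF assms zero_closed] by (auto simp: coset_zero)
qed

lemma coset_map_coset:
  assumes N: "csubspace N X" and f: "clinear M N f" and fW: "\<And>w. w \<in> W \<Longrightarrow> f w \<in> X"
    and v: "v \<in> carrier M"
  shows "coset_map N X f (W +> v) = X +>\<^bsub>N\<^esub> f v"
proof -
  interpret N: csubspace N X by fact
  have "X +>\<^bsub>N\<^esub> f p = X +>\<^bsub>N\<^esub> f v" if p: "p \<in> W +> v" for p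
  proof -
    obtain u where u: "u \<in> W" "p = u \<oplus> v" using p v by (auto simp: mem_coset_iff)
    then have "f p = f u \<oplus>\<^bsub>N\<^esub> f v" using clinearD(2)[OF f] v W_sub by auto
    then show ?thesis using N.coset_shift[OF clinearD(1)[OF f v] fW[OF u(1)]] by simp
  qed
  then show ?thesis
    unfolding coset_map_def using coset_self[OF v] by (intro SUP_eq_const) blast+
qed

lemma smult_clinear: "clinear M M (\<lambda>v. c \<odot>\<^bsub>M\<^esub> v)"
  by (rule clinearI)
    (simp_all add: cmoduleD(1,3)[OF cmod] cmodule_smult_commute[OF cmod, of _ c])

lemma quot_carrier: "carrier (quot_space M W) = (\<lambda>v. W +> v) ` carrier M"
  by (auto simp: quot_space_def A_RCOSETS_def')

lemma quot_carrierI [intro]: "v \<in> carrier M \<Longrightarrow> W +> v \<in> carrier (quot_space M W)"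
  by (simp add: quot_carrier)

lemma quot_zero: "\<zero>\<^bsub>quot_space M W\<^esub> = W +> \<zero>"
  by (simp add: quot_space_def coset_zero)

lemma quot_add:
  "\<lbrakk>v \<in> carrier M; w \<in> carrier M\<rbrakk> \<Longrightarrow> (W +> v) \<oplus>\<^bsub>quot_space M W\<^esub> (W +> w) = W +> (v \<oplus> w)"
  by (simp add: quot_space_def coset_add)

lemma quot_smult:
  "v \<in> carrier M \<Longrightarrow> c \<odot>\<^bsub>quot_space M W\<^esub> (W +> v) = W +> (c \<odot>\<^bsub>M\<^esub> v)"
  using coset_map_coset[OF csubspace_axioms smult_clinear W_smult, of v c]
  by (simp add: quot_space_def)

lemma quot_cmodule: "cmodule (quot_space M W)"
  by (rule cmoduleI)
    (auto simp: quot_carrier quot_zero quot_add quot_smult a_ac cmoduleD[OF cmod])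

lemma proj_clinear: "clinear M (quot_space M W) (\<lambda>v. W +> v)"
  by (rule clinearI) (auto simp: quot_add quot_smult)

lemma quot_clinearI:
  assumes "\<And>v. v \<in> carrier M \<Longrightarrow> g (W +> v) = f v" and f: "clinear M N f"
  shows "clinear (quot_space M W) N g"
  using clinearD[OF f] assms(1) by (intro clinearI) (auto simp: quot_carrier quot_add quot_smult)

text \<open>
  A linear map that kills \<open>W\<close> is constant on cosets, so that its value on a coset is the only
  element of the image.  This form is also the one in which a module over a Lie algebra becomes a
  module over its enveloping algebra.
\<close>

lemma the_elem_image_coset:
  assumes N: "cmodule N" and f: "clinear M N f" and fW: "\<And>w. w \<in> W \<Longrightarrow> f w = \<zero>\<^bsub>N\<^esub>"
    and v: "v \<in> carrier M"
  shows "the_elem (f ` (W +> v)) = f v"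
proof -
  interpret N: module complex_ring N by fact
  have "f p = f v" if p: "p \<in> W +> v" for p
  proof -
    obtain u where u: "u \<in> W" "p = u \<oplus> v" using p v by (auto simp: mem_coset_iff)
    then have "f p = f u \<oplus>\<^bsub>N\<^esub> f v" using clinearD(2)[OF f] v W_sub by auto
    then show ?thesis using fW[OF u(1)] N.l_zero[OF clinearD(1)[OF f v]] by simp
  qed
  then have "f ` (W +> v) = {f v}" using coset_self[OF v] by blast
  then show ?thesis by simp
qed

text \<open>
  The universal property of the quotient.
\<close>

lemma quot_lift:
  assumes N: "cmodule N" and f: "clinear M N f" and fW: "\<And>w. w \<in> W \<Longrightarrow> f w = \<zero>\<^bsub>N\<^esub>"
  shows "\<exists>g. clinear (quot_space M W) N g \<and> (\<forall>v\<in>carrier M. g (W +> v) = f v)"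
  using quot_clinearI[OF the_elem_image_coset[OF N f fW] f] the_elem_image_coset[OF N f fW]
  by (intro exI[of _ "\<lambda>X. the_elem (f ` X)"]) blast

end

section \<open>Free vector spaces\<close>

lemma free_space_simps [simp]:
  "carrier (free_space S) = {p. Poly_Mapping.keys p \<subseteq> S}" "add (free_space S) = (+)"
  "zero (free_space S) = 0" "smult (free_space S) = scl"
  by (simp_all add: free_space_def)

lemma keys_scl: "Poly_Mapping.keys (scl c p) \<subseteq> Poly_Mapping.keys p"
  by (auto simp: in_keys_iff)

lemma keys_sub:
  "Poly_Mapping.keys p \<subseteq> S \<Longrightarrow> Poly_Mapping.keys (scl c p) \<subseteq> S"
  "\<lbrakk>Poly_Mapping.keys p \<subseteq> S; Poly_Mapping.keys q \<subseteq> S\<rbrakk> \<Longrightarrow> Poly_Mapping.keys (p + q) \<subseteq> S"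
  using keys_scl[of c p] keys_add[of p q] by auto

lemma minus_eq_scl: "p - q = p + scl (-1) q"
  by (rule poly_mapping_eqI) (simp add: lookup_add lookup_minus)

lemma keys_sub_minus:
  "\<lbrakk>Poly_Mapping.keys p \<subseteq> S; Poly_Mapping.keys q \<subseteq> S\<rbrakk> \<Longrightarrow> Poly_Mapping.keys (p - q :: _ \<Rightarrow>\<^sub>0 complex) \<subseteq> S"
  unfolding minus_eq_scl by (intro keys_sub)

lemma cmodule_free_space: "cmodule (free_space S)"
  by (rule cmoduleI)
    (simp_all add: add_ac fvs.scale_left_distrib fvs.scale_right_distrib keys_sub)

lemma poly_mapping_eq_sum:
  "p = (\<Sum>a\<in>Poly_Mapping.keys p. scl (Poly_Mapping.lookup p a) (bas a))"
proof (rule poly_mapping_eqI)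
  fix b
  show "Poly_Mapping.lookup p b =
    Poly_Mapping.lookup (\<Sum>a\<in>Poly_Mapping.keys p. scl (Poly_Mapping.lookup p a) (bas a)) b"
    by (auto simp: lookup_sum lookup_single when_def in_keys_iff if_distrib sum.delta' cong: if_cong)
qed

text \<open>
  Linear statements about finitely supported functions only need to be checked on the basis
  vectors from the prescribed support.
\<close>

lemma free_space_induct [consumes 1, case_names zero bas add scl]:
  assumes "Poly_Mapping.keys p \<subseteq> S" and "P 0" "\<And>a. a \<in> S \<Longrightarrow> P (bas a)"
    "\<And>p q. \<lbrakk>Poly_Mapping.keys p \<subseteq> S; Poly_Mapping.keys q \<subseteq> S; P p; P q\<rbrakk> \<Longrightarrow> P (p + q)"
    "\<And>c p. \<lbrakk>Poly_Mapping.keys p \<subseteq> S; P p\<rbrakk> \<Longrightarrow> P (scl c p)"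
  shows "P p"
proof -
  let ?s = "\<lambda>A. \<Sum>a\<in>A. scl (Poly_Mapping.lookup p a) (bas a)"
  have "Poly_Mapping.keys (?s A) \<subseteq> S \<and> P (?s A)" if "finite A" "A \<subseteq> S" for A
    using that
  proof (induction A)
    case empty
    then show ?case using assms(2) by simp
  next
    case (insert a A)
    have k: "Poly_Mapping.keys (bas a :: _ \<Rightarrow>\<^sub>0 complex) \<subseteq> S" and a: "a \<in> S" using insert by auto
    show ?case
      using insert(1,2) assms(4)[OF keys_sub(1)[OF k] _ assms(5)[OF k assms(3)[OF a]], of "?s A"]
        insert(3,4) keys_sub(2)[OF keys_sub(1)[OF k], of "?s A"] by simp
  qed
  from this[of "Poly_Mapping.keys p"] assms(1) show ?thesis
    using poly_mapping_eq_sum[of p] by simp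
qed

lemma free_space_clinear_eqI:
  assumes "cmodule M" "clinear (free_space S) M f" "clinear (free_space S) M g"
    and "\<And>a. a \<in> S \<Longrightarrow> f (bas a) = g (bas a)" and "Poly_Mapping.keys p \<subseteq> S"
  shows "f p = g p"
  using assms(5)
proof (induction p rule: free_space_induct)
  case zero
  then show ?case
    using clinear_zero[OF cmodule_free_space assms(1,2)] clinear_zero[OF cmodule_free_space assms(1,3)] by simp
next
  case (add p q)
  then show ?case using clinearD(2)[OF assms(2), of p q] clinearD(2)[OF assms(3), of p q] by simp
next
  case (scl c p)
  then show ?case using clinearD(3)[OF assms(2), of p c] clinearD(3)[OF assms(3), of p c] by simp
qed (use assms(4) in auto)

text \<open>
  The linear extension with values in an abstract module.  Unlike \<^const>\<open>lin_ext\<close>, it can take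
  its values in a quotient space.
\<close>

definition lext :: "(complex, 'v, 'm) module_scheme \<Rightarrow> ('a \<Rightarrow> 'v) \<Rightarrow> ('a \<Rightarrow>\<^sub>0 complex) \<Rightarrow> 'v" where
  "lext M f p = (\<Oplus>\<^bsub>M\<^esub>a\<in>Poly_Mapping.keys p. Poly_Mapping.lookup p a \<odot>\<^bsub>M\<^esub> f a)"

context
  fixes M (structure) and S f
  assumes M: "cmodule M" and f: "\<And>a. a \<in> S \<Longrightarrow> f a \<in> carrier M"
begin

interpretation M: module complex_ring M by (rule M)

lemma lext_superset:
  assumes "finite A" "Poly_Mapping.keys p \<subseteq> A" "A \<subseteq> S"
  shows "lext M f p = (\<Oplus>a\<in>A. Poly_Mapping.lookup p a \<odot>\<^bsub>M\<^esub> f a)"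
  unfolding lext_def
  by (rule M.add.finprod_mono_neutral_cong_left)
    (use assms f in \<open>auto simp: in_keys_iff subset_iff cmoduleD[OF M]\<close>)

lemma lext_bas: "a \<in> S \<Longrightarrow> lext M f (bas a) = f a"
  using f by (simp add: lext_def M.finsum_insert cmoduleD[OF M])

lemma clinear_lext: "clinear (free_space S) M (lext M f)"
proof (rule clinearI)
  fix p assume p: "p \<in> carrier (free_space S)"
  then show "lext M f p \<in> carrier M"
    unfolding lext_def using f by (intro M.finsum_closed) auto
  show "lext M f (c \<odot>\<^bsub>free_space S\<^esub> p) = c \<odot>\<^bsub>M\<^esub> lext M f p" for c
  proof -
    have "lext M f (scl c p) = (\<Oplus>a\<in>Poly_Mapping.keys p. (c * Poly_Mapping.lookup p a) \<odot>\<^bsub>M\<^esub> f a)"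
      using lext_superset[of "Poly_Mapping.keys p" "scl c p"] keys_scl[of c p] p by simp
    also have "\<dots> = (\<Oplus>a\<in>Poly_Mapping.keys p. c \<odot>\<^bsub>M\<^esub> (Poly_Mapping.lookup p a \<odot>\<^bsub>M\<^esub> f a))"
      using p f by (intro M.finsum_cong') (auto simp: cmoduleD[OF M])
    also have "\<dots> = c \<odot>\<^bsub>M\<^esub> lext M f p"
      unfolding lext_def using p f
      by (intro M.finsum_smult_ldistr[symmetric]) auto
    finally show ?thesis by simp
  qed
next
  fix p q assume pq: "p \<in> carrier (free_space S)" "q \<in> carrier (free_space S)"
  let ?A = "Poly_Mapping.keys p \<union> Poly_Mapping.keys q"
  have A: "finite ?A" "?A \<subseteq> S" using pq by auto
  have "lext M f (p + q) = (\<Oplus>a\<in>?A. Poly_Mapping.lookup (p + q) a \<odot>\<^bsub>M\<^esub> f a)"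
    by (rule lext_superset[OF A(1) keys_add A(2)])
  also have "\<dots> = (\<Oplus>a\<in>?A. Poly_Mapping.lookup p a \<odot>\<^bsub>M\<^esub> f a \<oplus> Poly_Mapping.lookup q a \<odot>\<^bsub>M\<^esub> f a)"
    using A f by (intro M.finsum_cong') (auto simp: lookup_add subset_iff cmoduleD[OF M])
  also have "\<dots> = (\<Oplus>a\<in>?A. Poly_Mapping.lookup p a \<odot>\<^bsub>M\<^esub> f a) \<oplus> (\<Oplus>a\<in>?A. Poly_Mapping.lookup q a \<odot>\<^bsub>M\<^esub> f a)"
    using A f by (intro M.finsum_addf) (auto simp: subset_iff)
  also have "\<dots> = lext M f p \<oplus> lext M f q"
    using lext_superset[OF A(1) _ A(2)] by simp
  finally show "lext M f (p \<oplus>\<^bsub>free_space S\<^esub> q) = lext M f p \<oplus> lext M f q" by simp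
qed

end

lemma finsum_eq_sum:
  fixes M :: "('v::comm_monoid_add, 'm) ring_scheme"
  assumes "abelian_group M" "add M = (+)" "zero M = 0" "\<And>a. a \<in> A \<Longrightarrow> f a \<in> carrier M"
  shows "finsum M f A = sum f A"
proof -
  interpret M: abelian_group M by fact
  show ?thesis
    using assms(4)
  proof (induction A rule: infinite_finite_induct)
    case (infinite A)
    then show ?case using assms by (simp add: M.finsum_infinite)
  next
    case empty
    then show ?case using assms by simp
  next
    case (insert a A)
    then show ?case using assms(2) by (subst M.finsum_insert) auto
  qed
qed

lemma lin_ext_eq_lext:
  assumes "\<And>a. a \<in> Poly_Mapping.keys p \<Longrightarrow> Poly_Mapping.keys (g a) \<subseteq> S"
  shows "lin_ext g p = lext (free_space S) g p"
  unfolding lext_def lin_ext_def free_space_simps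
  by (rule finsum_eq_sum[symmetric])
    (simp_all add: module.axioms(2)[OF cmodule_free_space] assms keys_sub)

lemma clinear_lin_ext:
  assumes "\<And>a. a \<in> S \<Longrightarrow> Poly_Mapping.keys (g a) \<subseteq> T"
  shows "clinear (free_space S) (free_space T) (lin_ext g)"
proof -
  have "clinear (free_space S) (free_space T) (lext (free_space T) g)"
    by (rule clinear_lext) (use cmodule_free_space assms in auto)
  moreover have "lin_ext g p = lext (free_space T) g p" if "p \<in> carrier (free_space S)" for p
    using lin_ext_eq_lext[of p g T] assms that by auto
  ultimately show ?thesis
    by (subst clinear_cong[OF cmodule_free_space])
qed

lemma lin_ext_add: "lin_ext g (p + q) = lin_ext g p + lin_ext g q"
  using clinearD(2)[OF clinear_lin_ext[of UNIV g UNIV], of p q] by simp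

lemma lin_ext_scl: "lin_ext g (scl c p) = scl c (lin_ext g p)"
  using clinearD(3)[OF clinear_lin_ext[of UNIV g UNIV], of p c] by simp

lemma free_space_minus:
  assumes "Poly_Mapping.keys p \<subseteq> S" "Poly_Mapping.keys q \<subseteq> S"
  shows "p \<ominus>\<^bsub>free_space S\<^esub> q = p - q"
  unfolding minus_eq_scl using cmodule_minus[OF cmodule_free_space, of p S q] assms by simp

lemma free_space_clinear_eq_zero:
  assumes "cmodule M" "clinear (free_space S) M f"
    and "Poly_Mapping.keys p \<subseteq> S" "Poly_Mapping.keys q \<subseteq> S" "f p = f q"
  shows "f (p - q) = \<zero>\<^bsub>M\<^esub>"
proof -
  interpret M: module complex_ring M by fact
  have fq: "f q \<in> carrier M" using clinearD(1)[OF assms(2)] assms(4) by simp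
  have "f (p - q) = f q \<oplus>\<^bsub>M\<^esub> (-1) \<odot>\<^bsub>M\<^esub> f q"
    unfolding minus_eq_scl
    using clinearD(2)[OF assms(2), of p "scl (-1) q"] clinearD(3)[OF assms(2), of q "-1"]
      assms(3-5) keys_sub(1)[OF assms(4)] by simp
  also have "\<dots> = f q \<ominus>\<^bsub>M\<^esub> f q" using cmodule_minus[OF assms(1) fq fq] by simp
  finally show ?thesis using fq by (simp add: M.minus_eq M.r_neg)
qed

text \<open>
  Relations are given by spans, and this is how a linear map is shown to respect them.
\<close>

lemma clinear_kill_span:
  assumes "cmodule M" "clinear (free_space S) M f"
    and "\<And>p. p \<in> G \<Longrightarrow> Poly_Mapping.keys p \<subseteq> S \<and> f p = \<zero>\<^bsub>M\<^esub>" and p: "p \<in> fvs.span G"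
  shows "Poly_Mapping.keys p \<subseteq> S \<and> f p = \<zero>\<^bsub>M\<^esub>"
proof -
  interpret M: module complex_ring M by fact
  note f = clinearD[OF assms(2), simplified]
  show ?thesis using p
  proof (induction rule: fvs.span_induct_alt)
    case base
    then show ?case using clinear_zero[OF cmodule_free_space assms(1,2)] by simp
  next
    case (step c p q)
    have p: "Poly_Mapping.keys p \<subseteq> S" "f p = \<zero>\<^bsub>M\<^esub>" using assms(3)[OF step(1)] by auto
    have q: "Poly_Mapping.keys q \<subseteq> S" "f q = \<zero>\<^bsub>M\<^esub>" using step(2) by auto
    have "f (scl c p) = \<zero>\<^bsub>M\<^esub>" using f(3)[OF p(1)] p(2) M.smult_r_null[of c] by simp
    then show ?case
      using f(2)[OF keys_sub(1)[OF p(1)] q(1)] q keys_sub(2)[OF keys_sub(1)[OF p(1)] q(1)] by simp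
  qed
qed

lemma csubspace_span:
  assumes "\<And>p. p \<in> G \<Longrightarrow> Poly_Mapping.keys p \<subseteq> S"
  shows "csubspace (free_space S) (fvs.span G)"
proof -
  interpret module complex_ring "free_space S" by (rule cmodule_free_space)
  show ?thesis
  proof unfold_locales
    show "fvs.span G \<subseteq> carrier (free_space S)"
    proof
      fix p assume "p \<in> fvs.span G"
      then show "p \<in> carrier (free_space S)"
      proof (induction rule: fvs.span_induct_alt)
        case (step c p q)
        then show ?case using a_closed[of "scl c p" q] assms[of p] smult_closed[of c p] by simp
      qed simp
    qed
  qed (auto intro: fvs.span_add fvs.span_scale fvs.span_zero)
qed

section \<open>Balanced tensor products\<close>

text \<open>
  Tensor products over the complex numbers and induced modules are both quotients of a free space
  on pairs by bilinearity together with a balancing relation.  The universal property, the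
  uniqueness of linear maps and the construction of operators are proved once for both.
\<close>

locale tensor_relations =
  fixes A :: "'a set" and ra :: "'m \<Rightarrow> 'a \<Rightarrow> 'm" and la :: "'a \<Rightarrow> 'n \<Rightarrow> 'n"
    and M :: "(complex, 'm, 'x) module_scheme" and N :: "(complex, 'n, 'y) module_scheme"
  assumes cmodM: "cmodule M" and cmodN: "cmodule N"
    and ra_closed: "\<lbrakk>m \<in> carrier M; a \<in> A\<rbrakk> \<Longrightarrow> ra m a \<in> carrier M"
    and la_closed: "\<lbrakk>n \<in> carrier N; a \<in> A\<rbrakk> \<Longrightarrow> la a n \<in> carrier N"
begin

abbreviation "F \<equiv> free_space (carrier M \<times> carrier N)"
abbreviation "W \<equiv> tensor_rel A ra la M N"
abbreviation "Q \<equiv> quot_space F W"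

definition pt :: "'m \<Rightarrow> 'n \<Rightarrow> ('m \<times> 'n \<Rightarrow>\<^sub>0 complex) set" where
  "pt m n = W +>\<^bsub>F\<^esub> bas (m, n)"

definition balanced :: "(complex, 'v, 'z) module_scheme \<Rightarrow> ('m \<Rightarrow> 'n \<Rightarrow> 'v) \<Rightarrow> bool" where
  "balanced X \<beta> \<longleftrightarrow> (\<forall>m\<in>carrier M. clinear N X (\<beta> m)) \<and>
     (\<forall>n\<in>carrier N. clinear M X (\<lambda>m. \<beta> m n)) \<and>
     (\<forall>m\<in>carrier M. \<forall>a\<in>A. \<forall>n\<in>carrier N. \<beta> (ra m a) n = \<beta> m (la a n))"

lemma balancedI:
  assumes "\<And>m. m \<in> carrier M \<Longrightarrow> clinear N X (\<beta> m)"
    and "\<And>n. n \<in> carrier N \<Longrightarrow> clinear M X (\<lambda>m. \<beta> m n)"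
    and "\<And>m a n. \<lbrakk>m \<in> carrier M; a \<in> A; n \<in> carrier N\<rbrakk> \<Longrightarrow> \<beta> (ra m a) n = \<beta> m (la a n)"
  shows "balanced X \<beta>"
  using assms by (simp add: balanced_def)

lemma balanced_cong:
  assumes "\<And>m n. \<lbrakk>m \<in> carrier M; n \<in> carrier N\<rbrakk> \<Longrightarrow> \<beta> m n = \<beta>' m n"
  shows "balanced X \<beta> = balanced X \<beta>'"
proof -
  have "clinear N X (\<beta> m) = clinear N X (\<beta>' m)" if "m \<in> carrier M" for m
    by (rule clinear_cong[OF cmodN assms[OF that]])
  moreover have "clinear M X (\<lambda>m. \<beta> m n) = clinear M X (\<lambda>m. \<beta>' m n)" if "n \<in> carrier N" for n
    by (rule clinear_cong[OF cmodM assms[OF _ that]])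
  ultimately show ?thesis by (simp add: balanced_def assms ra_closed la_closed)
qed

interpretation M: module complex_ring M by (rule cmodM)
interpretation N: module complex_ring N by (rule cmodN)

lemma keys_bas: "\<lbrakk>m \<in> carrier M; n \<in> carrier N\<rbrakk> \<Longrightarrow>
    Poly_Mapping.keys (bas (m, n) :: _ \<Rightarrow>\<^sub>0 complex) \<subseteq> carrier M \<times> carrier N"
  by simp

lemma csubspace_W: "csubspace F W"
  unfolding tensor_rel_def
  by (rule csubspace_span)
    (elim UnE CollectE exE conjE; simp only:;
     intro keys_sub_minus keys_sub keys_bas; simp add: ra_closed la_closed)

text \<open>
  The only place where the five families of relations are inspected in order to map out of the
  quotient.
\<close>

lemma relation_kill:
  assumes X: "cmodule X" and \<beta>: "balanced X \<beta>" and L: "clinear F X L"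
    and L\<beta>: "\<And>m n. \<lbrakk>m \<in> carrier M; n \<in> carrier N\<rbrakk> \<Longrightarrow> L (bas (m, n)) = \<beta> m n"
    and w: "w \<in> W"
  shows "L w = \<zero>\<^bsub>X\<^esub>"
proof -
  have b1: "clinear N X (\<beta> m)" if "m \<in> carrier M" for m using \<beta> that by (simp add: balanced_def)
  have b2: "clinear M X (\<lambda>m. \<beta> m n)" if "n \<in> carrier N" for n using \<beta> that by (simp add: balanced_def)
  have b3: "\<beta> (ra m a) n = \<beta> m (la a n)" if "m \<in> carrier M" "a \<in> A" "n \<in> carrier N" for m a n
    using \<beta> that by (simp add: balanced_def)
  note Ladd = clinearD(2)[OF L, simplified] and Lscl = clinearD(3)[OF L, simplified]
  note simps = Ladd Lscl L\<beta> clinearD(2,3)[OF b1] clinearD(2,3)[OF b2] b3 ra_closed la_closed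
  show ?thesis
    using w unfolding tensor_rel_def
    by (rule clinear_kill_span[OF X L, THEN conjunct2, rotated])
      (elim UnE CollectE exE conjE; simp only:;
       intro conjI keys_sub_minus keys_sub keys_bas free_space_clinear_eq_zero[OF X L];
       simp add: simps)
qed

lemma minus_mem_imp_eq:
  assumes "Poly_Mapping.keys p \<subseteq> carrier M \<times> carrier N" "Poly_Mapping.keys q \<subseteq> carrier M \<times> carrier N"
    and "p - q \<in> W"
  shows "W +>\<^bsub>F\<^esub> p = W +>\<^bsub>F\<^esub> q"
  using csubspace.coset_eqI[OF csubspace_W, of p q] assms free_space_minus[OF assms(1,2)] by simp

lemma cmodule_Q: "cmodule Q"
  by (rule csubspace.quot_cmodule[OF csubspace_W])

lemma pt_closed: "\<lbrakk>m \<in> carrier M; n \<in> carrier N\<rbrakk> \<Longrightarrow> pt m n \<in> carrier Q"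
  unfolding pt_def by (rule csubspace.quot_carrierI[OF csubspace_W]) simp

lemma pt_balanced: "balanced Q pt"
proof -
  have add: "(W +>\<^bsub>F\<^esub> p) \<oplus>\<^bsub>Q\<^esub> (W +>\<^bsub>F\<^esub> q) = W +>\<^bsub>F\<^esub> (p + q)"
    if "Poly_Mapping.keys p \<subseteq> carrier M \<times> carrier N" "Poly_Mapping.keys q \<subseteq> carrier M \<times> carrier N" for p q
    using csubspace.quot_add[OF csubspace_W, of p q] that by simp
  have scl: "c \<odot>\<^bsub>Q\<^esub> (W +>\<^bsub>F\<^esub> p) = W +>\<^bsub>F\<^esub> scl c p"
    if "Poly_Mapping.keys p \<subseteq> carrier M \<times> carrier N" for p c
    using csubspace.quot_smult[OF csubspace_W, of p c] that by simp
  show ?thesis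
  proof (intro balancedI clinearI)
    fix m n a assume "m \<in> carrier M" "a \<in> A" "n \<in> carrier N"
    then show "pt (ra m a) n = pt m (la a n)"
      unfolding pt_def
      by (intro minus_mem_imp_eq) (auto simp: ra_closed la_closed tensor_rel_def intro!: fvs.span_base)
  next
    fix m m' n assume *: "m \<in> carrier M" "m' \<in> carrier M" "n \<in> carrier N"
    show "pt (m \<oplus>\<^bsub>M\<^esub> m') n = pt m n \<oplus>\<^bsub>Q\<^esub> pt m' n"
      unfolding pt_def add[OF keys_bas[OF *(1,3)] keys_bas[OF *(2,3)]]
      by (intro minus_mem_imp_eq keys_sub keys_bas)
        (use * in \<open>auto simp: tensor_rel_def intro!: fvs.span_base\<close>)
  next
    fix m n n' assume *: "m \<in> carrier M" "n \<in> carrier N" "n' \<in> carrier N"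
    show "pt m (n \<oplus>\<^bsub>N\<^esub> n') = pt m n \<oplus>\<^bsub>Q\<^esub> pt m n'"
      unfolding pt_def add[OF keys_bas[OF *(1,2)] keys_bas[OF *(1,3)]]
      by (intro minus_mem_imp_eq keys_sub keys_bas)
        (use * in \<open>auto simp: tensor_rel_def intro!: fvs.span_base\<close>)
  next
    fix c m n assume *: "m \<in> carrier M" "n \<in> carrier N"
    show "pt (c \<odot>\<^bsub>M\<^esub> m) n = c \<odot>\<^bsub>Q\<^esub> pt m n"
      unfolding pt_def scl[OF keys_bas[OF *]]
      by (intro minus_mem_imp_eq keys_sub keys_bas)
        (use * cmoduleD(1)[OF cmodM] in \<open>auto simp: tensor_rel_def intro!: fvs.span_base\<close>)
    show "pt m (c \<odot>\<^bsub>N\<^esub> n) = c \<odot>\<^bsub>Q\<^esub> pt m n"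
      unfolding pt_def scl[OF keys_bas[OF *]]
      by (intro minus_mem_imp_eq keys_sub keys_bas)
        (use * cmoduleD(1)[OF cmodN] in \<open>auto simp: tensor_rel_def intro!: fvs.span_base\<close>)
  qed (auto intro: pt_closed)
qed

lemma lift:
  assumes X: "cmodule X" and \<beta>: "balanced X \<beta>"
  shows "\<exists>g. clinear Q X g \<and> (\<forall>m\<in>carrier M. \<forall>n\<in>carrier N. g (pt m n) = \<beta> m n)"
proof -
  have \<beta>c: "\<beta> m n \<in> carrier X" if "m \<in> carrier M" "n \<in> carrier N" for m n
    using \<beta> that clinearD(1)[of N X "\<beta> m"] by (auto simp: balanced_def)
  let ?L = "lext X (\<lambda>(m, n). \<beta> m n)"
  have L: "clinear F X ?L" by (rule clinear_lext[OF X]) (auto intro: \<beta>c)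
  have L\<beta>: "?L (bas (m, n)) = \<beta> m n" if "m \<in> carrier M" "n \<in> carrier N" for m n
    using lext_bas[OF X, of "carrier M \<times> carrier N" "\<lambda>(m, n). \<beta> m n" "(m, n)"] \<beta>c that by auto
  obtain g where "clinear Q X g" and g: "\<forall>v\<in>carrier F. g (W +>\<^bsub>F\<^esub> v) = ?L v"
    using csubspace.quot_lift[OF csubspace_W X L relation_kill[OF X \<beta> L L\<beta>]] by blast
  moreover have "g (pt m n) = \<beta> m n" if "m \<in> carrier M" "n \<in> carrier N" for m n
    unfolding pt_def using g[rule_format, of "bas (m, n)"] L\<beta>[OF that] that by simp
  ultimately show ?thesis by blast
qed

lemma clinear_eqI:
  assumes X: "cmodule X" and f: "clinear Q X f" and g: "clinear Q X g"
    and eq: "\<And>m n. \<lbrakk>m \<in> carrier M; n \<in> carrier N\<rbrakk> \<Longrightarrow> f (pt m n) = g (pt m n)"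
    and v: "v \<in> carrier Q"
  shows "f v = g v"
proof -
  obtain p where p: "p \<in> carrier F" "v = W +>\<^bsub>F\<^esub> p"
    using v unfolding csubspace.quot_carrier[OF csubspace_W] by blast
  note proj = csubspace.proj_clinear[OF csubspace_W]
  have "f (W +>\<^bsub>F\<^esub> p) = g (W +>\<^bsub>F\<^esub> p)"
    by (rule free_space_clinear_eqI[OF X clinear_compose[OF proj f] clinear_compose[OF proj g]])
      (use p eq in \<open>auto simp: pt_def\<close>)
  then show ?thesis using p by simp
qed

text \<open>
  Well-definedness of an operator \<open>h\<close> given on pairs: the composite of its linear extension with
  the projection comes from a balanced map, hence kills the relations, so that the extension maps
  the relations to themselves.
\<close>

lemma operator:
  assumes h: "\<forall>m\<in>carrier M. \<forall>n\<in>carrier N. Poly_Mapping.keys (h (m, n)) \<subseteq> carrier M \<times> carrier N"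
    and \<beta>: "balanced Q (\<lambda>m n. W +>\<^bsub>F\<^esub> h (m, n))"
  shows "clinear Q Q (coset_map F W (lin_ext h))"
    and "\<lbrakk>m \<in> carrier M; n \<in> carrier N\<rbrakk> \<Longrightarrow> coset_map F W (lin_ext h) (pt m n) = W +>\<^bsub>F\<^esub> h (m, n)"
proof -
  have L: "clinear F F (lin_ext h)" by (rule clinear_lin_ext) (use h in auto)
  note proj = csubspace.proj_clinear[OF csubspace_W]
  have "W +>\<^bsub>F\<^esub> lin_ext h w = \<zero>\<^bsub>Q\<^esub>" if "w \<in> W" for w
    by (rule relation_kill[OF cmodule_Q \<beta> clinear_compose[OF L proj] _ that]) simp
  then have W: "lin_ext h w \<in> W" if "w \<in> W" for w
    using that clinearD(1)[OF L, of w] csubspace.W_sub[OF csubspace_W]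
      csubspace.coset_eq_zero_iff[OF csubspace_W, of "lin_ext h w"]
      csubspace.quot_zero[OF csubspace_W] csubspace.coset_zero[OF csubspace_W] by auto
  note cm = csubspace.coset_map_coset[OF csubspace_W csubspace_W L W]
  show "clinear Q Q (coset_map F W (lin_ext h))"
    by (rule csubspace.quot_clinearI[OF csubspace_W cm clinear_compose[OF L proj]])
  show "coset_map F W (lin_ext h) (pt m n) = W +>\<^bsub>F\<^esub> h (m, n)" if "m \<in> carrier M" "n \<in> carrier N"
    unfolding pt_def using cm[of "bas (m, n)"] that by simp
qed

end

section \<open>Modules over Lie algebras\<close>

lemma cmodule_lie: "lie_module B M \<Longrightarrow> cmodule M"
  by (simp add: lie_module_def)

lemma lie_module_mono: "lie_module B M \<Longrightarrow> C \<subseteq> B \<Longrightarrow> lie_module C M"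
  unfolding lie_module_def lie_module_axioms_def by (auto simp: subset_iff)

lemma lie_module_act_clinear: "lie_module B M \<Longrightarrow> x \<in> B \<Longrightarrow> clinear M M (act M x)"
  by (rule clinearI) (auto intro: lie_module.act_closed lie_module.act_add lie_module.act_smult)

definition lie_hom ::
    "affvir set \<Rightarrow> ('v, 'm) lie_mod_scheme \<Rightarrow> ('w, 'n) lie_mod_scheme \<Rightarrow> ('v \<Rightarrow> 'w) \<Rightarrow> bool" where
  "lie_hom B M N \<phi> \<longleftrightarrow> clinear M N \<phi> \<and> (\<forall>x\<in>B. \<forall>v\<in>carrier M. \<phi> (act M x v) = act N x (\<phi> v))"

lemma lie_homI:
  assumes "clinear M N \<phi>" "\<And>x v. \<lbrakk>x \<in> B; v \<in> carrier M\<rbrakk> \<Longrightarrow> \<phi> (act M x v) = act N x (\<phi> v)"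
  shows "lie_hom B M N \<phi>"
  using assms by (simp add: lie_hom_def)

lemma lie_homD:
  assumes "lie_hom B M N \<phi>"
  shows "clinear M N \<phi>" "\<lbrakk>x \<in> B; v \<in> carrier M\<rbrakk> \<Longrightarrow> \<phi> (act M x v) = act N x (\<phi> v)"
    "v \<in> carrier M \<Longrightarrow> \<phi> v \<in> carrier N"
  using assms clinearD(1)[of M N \<phi>] by (auto simp: lie_hom_def)

lemma lie_hom_compose:
  assumes "lie_hom B M N \<phi>" "lie_hom B N P \<psi>"
  shows "lie_hom B M P (\<lambda>v. \<psi> (\<phi> v))"
  using assms clinear_compose[of M N \<phi> P \<psi>] clinearD(1)[of M N \<phi>] by (auto simp: lie_hom_def)

lemma lie_module_isomorphicI:
  assumes "lie_module B M" "lie_module B N" "lie_hom B M N \<phi>" "lie_hom B N M \<psi>"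
    and "\<And>v. v \<in> carrier M \<Longrightarrow> \<psi> (\<phi> v) = v" "\<And>w. w \<in> carrier N \<Longrightarrow> \<phi> (\<psi> w) = w"
  shows "lie_module_isomorphic B M N"
proof -
  have "bij_betw \<phi> (carrier M) (carrier N)"
    using assms(5,6) lie_homD(3)[OF assms(3)] lie_homD(3)[OF assms(4)]
    by (intro bij_betw_byWitness[where f' = \<psi>]) blast+
  then show ?thesis
    unfolding lie_module_isomorphic_def
    using assms(1,2) clinearD(2,3)[OF lie_homD(1)[OF assms(3)]] lie_homD(2)[OF assms(3)] by blast
qed

text \<open>
  The module laws are identities between linear maps, so that it suffices to check them on a set
  \<open>G\<close> that separates linear maps.
\<close>

lemma lie_module_generatedI:
  assumes M: "cmodule M" and G: "G \<subseteq> carrier M"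
    and sep: "\<And>f g v. \<lbrakk>clinear M M f; clinear M M g; \<And>u. u \<in> G \<Longrightarrow> f u = g u; v \<in> carrier M\<rbrakk> \<Longrightarrow> f v = g v"
    and lin: "\<And>x. clinear M M (act M x)"
    and add: "\<And>x y u. u \<in> G \<Longrightarrow> act M (x + y) u = act M x u \<oplus>\<^bsub>M\<^esub> act M y u"
    and smult: "\<And>x c u. u \<in> G \<Longrightarrow> act M (scl c x) u = c \<odot>\<^bsub>M\<^esub> act M x u"
    and bracket: "\<And>x y u. u \<in> G \<Longrightarrow>
      act M (bracket x y) u = act M x (act M y u) \<ominus>\<^bsub>M\<^esub> act M y (act M x u)"
  shows "lie_module UNIV M"
proof (intro lie_module.intro lie_module_axioms.intro M)
  note L = clinearD[OF lin]
  show "act M x v \<in> carrier M" if "v \<in> carrier M" for x v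
    by (rule L(1)[OF that])
  show "act M x (v \<oplus>\<^bsub>M\<^esub> w) = act M x v \<oplus>\<^bsub>M\<^esub> act M x w" if "v \<in> carrier M" "w \<in> carrier M" for x v w
    by (rule L(2)[OF that])
  show "act M x (c \<odot>\<^bsub>M\<^esub> v) = c \<odot>\<^bsub>M\<^esub> act M x v" if "v \<in> carrier M" for x v c
    by (rule L(3)[OF that])
  show "act M (x + y) v = act M x v \<oplus>\<^bsub>M\<^esub> act M y v" if "v \<in> carrier M" for x y v
    by (rule sep[OF lin clinear_add[OF M lin lin] add that])
  show "act M (scl c x) v = c \<odot>\<^bsub>M\<^esub> act M x v" if "v \<in> carrier M" for x v c
    by (rule sep[OF lin clinear_smult[OF M lin] smult that])
  show "act M (bracket x y) v = act M x (act M y v) \<ominus>\<^bsub>M\<^esub> act M y (act M x v)" if "v \<in> carrier M" for x y v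
    by (rule sep[OF lin clinear_diff[OF M M clinear_compose[OF lin lin] clinear_compose[OF lin lin]]
          bracket that])
qed

section \<open>Universal enveloping algebras\<close>

definition lie_subalgebra :: "affvir set \<Rightarrow> bool" where
  "lie_subalgebra B \<longleftrightarrow> (\<forall>x\<in>B. \<forall>y\<in>B. x + y \<in> B \<and> bracket x y \<in> B) \<and> (\<forall>c. \<forall>x\<in>B. scl c x \<in> B)"

lemma lie_subalgebra_UNIV: "lie_subalgebra UNIV"
  by (simp add: lie_subalgebra_def)

abbreviation words :: "affvir set \<Rightarrow> affvir fword set" where
  "words B \<equiv> {w. set (letters w) \<subseteq> B}"

lemma letters_simps [simp]: "letters 0 = []" "letters (v + w) = letters v @ letters w"
  by (simp_all add: zero_fword_def plus_fword_def)

lemma zero_in_words: "0 \<in> words B" and plus_in_words: "v \<in> words B \<Longrightarrow> w \<in> words B \<Longrightarrow> v + w \<in> words B"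
  by (auto simp: zero_fword_def plus_fword_def)

lemma free_algebra_simps [simp]:
  "carrier (free_algebra B) = {p. Poly_Mapping.keys p \<subseteq> words B}"
  "mult (free_algebra B) = (*)" "one (free_algebra B) = 1" "zero (free_algebra B) = 0"
  "add (free_algebra B) = (+)" "smult (free_algebra B) = scl"
  by (auto simp: free_algebra_def)

lemma cmodule_free_algebra: "cmodule (free_algebra B)"
  by (rule cmodule_transfer[OF cmodule_free_space[of "words B"]]) simp_all

lemma clinear_free_algebra [simp]:
  "clinear (free_algebra B) M f = clinear (free_space (words B)) M f"
  "clinear N (free_algebra B) g = clinear N (free_space (words B)) g"
  by (simp_all add: clinear_def)

lemma free_algebra_minus:
  assumes "Poly_Mapping.keys p \<subseteq> words B" "Poly_Mapping.keys q \<subseteq> words B"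
  shows "p \<ominus>\<^bsub>free_algebra B\<^esub> q = p - q"
  unfolding minus_eq_scl using cmodule_minus[OF cmodule_free_algebra, of p B q] assms by simp

lemma scl_single: "scl c (Poly_Mapping.single a z) = Poly_Mapping.single a (c * z)"
  by (rule poly_mapping_eqI) (simp add: lookup_single when_def)

text \<open>
  Scalars are central in the monoid algebra; this turns ideals into subspaces and makes the
  product bilinear over the complex numbers.
\<close>

lemma scl_eq_mult:
  fixes p :: "'a::monoid_add \<Rightarrow>\<^sub>0 complex"
  shows "scl c p = Poly_Mapping.single 0 c * p" and "scl c p = p * Poly_Mapping.single 0 c"
proof -
  have p: "p = (\<Sum>a\<in>Poly_Mapping.keys p. Poly_Mapping.single a (Poly_Mapping.lookup p a))"
    using poly_mapping_eq_sum[of p] by (simp add: scl_single)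
  have "scl c p = (\<Sum>a\<in>Poly_Mapping.keys p. Poly_Mapping.single a (c * Poly_Mapping.lookup p a))"
    by (subst p) (simp only: fvs.scale_sum_right scl_single)
  moreover have "\<dots> = Poly_Mapping.single 0 c * p"
    by (subst (2) p) (simp add: sum_distrib_left mult_single)
  moreover have "(\<Sum>a\<in>Poly_Mapping.keys p. Poly_Mapping.single a (c * Poly_Mapping.lookup p a)) = p * Poly_Mapping.single 0 c"
    by (subst (2) p) (simp add: sum_distrib_right mult_single mult.commute)
  ultimately show "scl c p = Poly_Mapping.single 0 c * p" "scl c p = p * Poly_Mapping.single 0 c"
    by simp_all
qed

lemma scl_mult_left: "scl c p * q = scl c (p * (q :: free_alg))"
  by (simp add: scl_eq_mult(1) mult.assoc)

lemma scl_mult_right: "p * scl c q = scl c (p * (q :: free_alg))"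
  by (simp add: scl_eq_mult(2) mult.assoc)

lemma keys_mult_words:
  assumes "Poly_Mapping.keys p \<subseteq> words B" "Poly_Mapping.keys q \<subseteq> words B"
  shows "Poly_Mapping.keys (p * q :: free_alg) \<subseteq> words B"
proof
  fix w assume "w \<in> Poly_Mapping.keys (p * q)"
  then obtain a b where "w = a + b" "a \<in> Poly_Mapping.keys p" "b \<in> Poly_Mapping.keys q"
    using keys_mult[of p q] by blast
  then show "w \<in> words B" using assms plus_in_words[of a B b] by blast
qed

lemma keys_lett: "x \<in> B \<Longrightarrow> Poly_Mapping.keys (lett x) \<subseteq> words B"
  by (simp add: lett_def)

lemma keys_one: "Poly_Mapping.keys (1 :: free_alg) \<subseteq> words B"
  by (simp flip: single_one)

lemma ring_free_algebra: "ring (free_algebra B)"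
proof (rule ringI)
  show "abelian_group (free_algebra B)"
    using cmodule_free_algebra by (rule module.axioms(2))
  show "Group.monoid (free_algebra B)"
    by (rule monoidI) (auto simp: keys_mult_words keys_one mult.assoc simp del: single_one)
qed (auto simp: distrib_left distrib_right)

text \<open>
  Closure under negation is part of closure under scalars.
\<close>

lemma ideal_free_algebraI:
  assumes "I \<subseteq> carrier (free_algebra B)" "0 \<in> I"
    and "\<And>p q. \<lbrakk>p \<in> I; q \<in> I\<rbrakk> \<Longrightarrow> p + q \<in> I" "\<And>p c. p \<in> I \<Longrightarrow> scl c p \<in> I"
    and "\<And>p q. \<lbrakk>p \<in> I; q \<in> carrier (free_algebra B)\<rbrakk> \<Longrightarrow> q * p \<in> I"
    and "\<And>p q. \<lbrakk>p \<in> I; q \<in> carrier (free_algebra B)\<rbrakk> \<Longrightarrow> p * q \<in> I"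
  shows "ideal I (free_algebra B)"
proof -
  have "csubspace (free_algebra B) I"
    using assms by (intro csubspace.intro csubspace_axioms.intro cmodule_free_algebra) simp_all
  then have "subgroup I (add_monoid (free_algebra B))"
    using csubspace.abelian_subgroup abelian_subgroup.axioms(1) additive_subgroup.a_subgroup by blast
  then show ?thesis
    using assms(5,6) by (intro idealI[OF ring_free_algebra]) simp_all
qed

lemma bas_fword_Cons: "bas (Fword (x # l)) = lett x * bas (Fword l)"
  by (simp add: lett_def mult_single plus_fword_def)

definition env_gens :: "affvir set \<Rightarrow> free_alg set" where
  "env_gens B = {lett (x + y) - (lett x + lett y) |x y. x \<in> B \<and> y \<in> B}
       \<union> {lett (scl c x) - scl c (lett x) |c x. x \<in> B}
       \<union> {lett x * lett y - lett y * lett x - lett (bracket x y) |x y. x \<in> B \<and> y \<in> B}"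

lemma env_ideal_eq: "env_ideal B = Idl\<^bsub>free_algebra B\<^esub> (env_gens B)"
  by (simp add: env_ideal_def env_gens_def)

context
  fixes B assumes B: "lie_subalgebra B"
begin

interpretation FA: ring "free_algebra B" by (rule ring_free_algebra)

lemma env_gens_sub: "env_gens B \<subseteq> carrier (free_algebra B)"
proof
  fix p assume "p \<in> env_gens B"
  then have "Poly_Mapping.keys p \<subseteq> words B"
    unfolding env_gens_def
    by (elim UnE CollectE exE conjE; simp only:;
        intro keys_sub_minus keys_sub keys_mult_words keys_lett; use B in \<open>simp add: lie_subalgebra_def\<close>)
  then show "p \<in> carrier (free_algebra B)" by simp
qed

lemma ideal_env: "ideal (env_ideal B) (free_algebra B)"
  unfolding env_ideal_eq by (rule FA.genideal_ideal[OF env_gens_sub])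

lemma env_gens_sub_ideal: "env_gens B \<subseteq> env_ideal B"
  unfolding env_ideal_eq by (rule FA.genideal_self[OF env_gens_sub])

lemma env_ideal_minimal: "ideal I (free_algebra B) \<Longrightarrow> env_gens B \<subseteq> I \<Longrightarrow> env_ideal B \<subseteq> I"
  unfolding env_ideal_eq by (rule FA.genideal_minimal)

lemma csubspace_env: "csubspace (free_algebra B) (env_ideal B)"
proof -
  interpret I: ideal "env_ideal B" "free_algebra B" by (rule ideal_env)
  show ?thesis
  proof (intro csubspace.intro csubspace_axioms.intro cmodule_free_algebra)
    show "env_ideal B \<subseteq> carrier (free_algebra B)" by (rule I.a_subset)
    show "v \<oplus>\<^bsub>free_algebra B\<^esub> w \<in> env_ideal B" if "v \<in> env_ideal B" "w \<in> env_ideal B" for v w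
      using that by (rule I.a_closed)
    show "c \<odot>\<^bsub>free_algebra B\<^esub> v \<in> env_ideal B" if "v \<in> env_ideal B" for c v
      using I.I_l_closed[OF that, of "scl c 1"] keys_sub(1)[OF keys_one]
      by (simp add: scl_mult_left)
  qed (rule I.zero_closed)
qed

end

text \<open>
  The class of an element of the free algebra in the enveloping algebra.
\<close>

definition cls :: "affvir set \<Rightarrow> free_alg \<Rightarrow> free_alg set" where
  "cls B p = env_ideal B +>\<^bsub>free_algebra B\<^esub> p"

lemma Uenv_fields:
  "carrier (Uenv B) = carrier (quot_space (free_algebra B) (env_ideal B))"
  "add (Uenv B) = add (quot_space (free_algebra B) (env_ideal B))"
  "zero (Uenv B) = zero (quot_space (free_algebra B) (env_ideal B))"
  "smult (Uenv B) = smult (quot_space (free_algebra B) (env_ideal B))"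
  "mult (Uenv B) = rcoset_mult (free_algebra B) (env_ideal B)"
  "one (Uenv B) = cls B 1"
  by (simp_all add: Uenv_def quot_space_def FactRing_def ring.defs module.defs cls_def)

context
  fixes B assumes B: "lie_subalgebra B"
begin

lemma cmodule_Uenv: "cmodule (Uenv B)"
  by (rule cmodule_transfer[OF csubspace.quot_cmodule[OF csubspace_env[OF B]]])
    (simp_all add: Uenv_fields)

lemma Uenv_carrier: "carrier (Uenv B) = cls B ` carrier (free_algebra B)"
  by (simp add: Uenv_fields csubspace.quot_carrier[OF csubspace_env[OF B]] cls_def)

lemma cls_closed: "Poly_Mapping.keys p \<subseteq> words B \<Longrightarrow> cls B p \<in> carrier (Uenv B)"
  by (auto simp: Uenv_carrier)

lemma cls_add: "\<lbrakk>Poly_Mapping.keys p \<subseteq> words B; Poly_Mapping.keys q \<subseteq> words B\<rbrakk> \<Longrightarrow>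
    cls B p \<oplus>\<^bsub>Uenv B\<^esub> cls B q = cls B (p + q)"
  using csubspace.quot_add[OF csubspace_env[OF B], of p q] by (simp add: Uenv_fields cls_def)

lemma cls_smult: "Poly_Mapping.keys p \<subseteq> words B \<Longrightarrow> c \<odot>\<^bsub>Uenv B\<^esub> cls B p = cls B (scl c p)"
  using csubspace.quot_smult[OF csubspace_env[OF B], of p c] by (simp add: Uenv_fields cls_def)

lemma cls_mult: "\<lbrakk>Poly_Mapping.keys p \<subseteq> words B; Poly_Mapping.keys q \<subseteq> words B\<rbrakk> \<Longrightarrow>
    cls B p \<otimes>\<^bsub>Uenv B\<^esub> cls B q = cls B (p * q)"
  using ideal.rcoset_mult_add[OF ideal_env[OF B], of p q] by (simp add: Uenv_fields cls_def)

lemma cls_eq: "\<lbrakk>Poly_Mapping.keys p \<subseteq> words B; Poly_Mapping.keys q \<subseteq> words B; p - q \<in> env_gens B\<rbrakk> \<Longrightarrow>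
    cls B p = cls B q"
  unfolding cls_def
  by (rule csubspace.coset_eqI[OF csubspace_env[OF B]])
    (use env_gens_sub_ideal[OF B] in \<open>simp_all add: free_algebra_minus subset_iff\<close>)

end

lemma U_in_eq: "U_in x = cls UNIV (lett x)"
  by (simp add: U_in_def cls_def)

text \<open>
  The inclusion of free algebras respects the relations because the elements of the smaller free
  algebra that vanish in \<open>U(L)\<close> form an ideal which contains the generating relations.
\<close>

lemma U_incl_cls:
  assumes B: "lie_subalgebra B" and p: "Poly_Mapping.keys p \<subseteq> words B"
  shows "U_incl (cls B p) = cls UNIV p"
proof -
  note U = lie_subalgebra_UNIV
  interpret IU: ideal "env_ideal UNIV" "free_algebra UNIV" by (rule ideal_env[OF U])
  let ?I = "env_ideal UNIV \<inter> carrier (free_algebra B)"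
  have "ideal ?I (free_algebra B)"
  proof (rule ideal_free_algebraI)
    fix p q c
    assume "p \<in> ?I" "q \<in> ?I"
    then show "p + q \<in> ?I"
      using csubspace.W_add[OF csubspace_env[OF U], of p q] keys_sub(2)[of p "words B" q] by simp
  next
    fix p c assume "p \<in> ?I"
    then show "scl c p \<in> ?I"
      using csubspace.W_smult[OF csubspace_env[OF U], of p c] keys_sub(1)[of p "words B" c] by simp
  next
    fix a x assume a: "a \<in> ?I" and x: "x \<in> carrier (free_algebra B)"
    show "x * a \<in> ?I" "a * x \<in> ?I"
      using a x IU.I_l_closed[of a x] IU.I_r_closed[of a x] by (simp_all add: keys_mult_words)
  qed (use csubspace.W_zero[OF csubspace_env[OF U]] in auto)
  moreover have "env_gens B \<subseteq> env_gens UNIV" by (auto simp: env_gens_def)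
  ultimately have sub: "env_ideal B \<subseteq> env_ideal UNIV"
    using env_ideal_minimal[OF B, of ?I] env_gens_sub[OF B] env_gens_sub_ideal[OF U] by blast
  have "clinear (free_algebra B) (free_algebra UNIV) (\<lambda>p. p)"
    by (rule clinearI) auto
  then show ?thesis
    unfolding U_incl_def cls_def
    by (rule csubspace.coset_map_coset[OF csubspace_env[OF B] csubspace_env[OF U]])
      (use p sub in auto)
qed

section \<open>Actions of enveloping algebras\<close>

lemma free_act_eq_lext: "free_act N p v = lext N (\<lambda>w. foldr (act N) (letters w) v) p"
  by (simp add: free_act_def lext_def)

context
  fixes B and N :: "('v, 'm) lie_mod_scheme"
  assumes N: "lie_module B N"
begin

lemma foldr_act_clinear: "set l \<subseteq> B \<Longrightarrow> clinear N N (foldr (act N) l)"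
proof (induction l)
  case Nil
  show ?case by (rule clinearI) simp_all
next
  case (Cons x l)
  then have "clinear N N (foldr (act N) l)" "clinear N N (act N x)"
    using lie_module_act_clinear[OF N] by simp_all
  then show ?case
    using clinear_compose[of N N "foldr (act N) l" N "act N x"] by (simp add: comp_def)
qed

lemma word_clinear: "w \<in> words B \<Longrightarrow> clinear N N (foldr (act N) (letters w))"
  by (simp add: foldr_act_clinear)

lemma free_act_clinear1:
  assumes "v \<in> carrier N"
  shows "clinear (free_space (words B)) N (\<lambda>p. free_act N p v)"
  unfolding free_act_eq_lext
  by (rule clinear_lext[OF cmodule_lie[OF N] clinearD(1)[OF word_clinear assms]])

lemma free_act_bas:
  assumes "w \<in> words B" "v \<in> carrier N"
  shows "free_act N (bas w) v = foldr (act N) (letters w) v"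
  unfolding free_act_eq_lext
  by (rule lext_bas[OF cmodule_lie[OF N], of "words B"])
    (rule clinearD(1)[OF word_clinear assms(2)] assms(1) | assumption)+

lemma free_act_clinear2: "Poly_Mapping.keys p \<subseteq> words B \<Longrightarrow> clinear N N (free_act N p)"
proof (induction p rule: free_space_induct)
  note cN = cmodule_lie[OF N]
  interpret N: module complex_ring N by (rule cN)
  note L = clinearD[OF free_act_clinear1, simplified]
  {
    case zero
    have "free_act N 0 v = \<zero>\<^bsub>N\<^esub>" for v by (simp add: free_act_def)
    moreover have "clinear N N (\<lambda>v. \<zero>\<^bsub>N\<^esub>)"
      by (rule clinearI) (simp_all add: N.smult_r_null[of c for c, simplified])
    ultimately show ?case by simp
  next
    case (bas w)
    show ?case
      by (subst clinear_cong[OF cN free_act_bas[OF bas]]) (assumption | rule word_clinear[OF bas])+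
  next
    case (add p q)
    show ?case
      by (subst clinear_cong[OF cN L(2)]) (use add in \<open>auto intro: clinear_add[OF cN]\<close>)
  next
    case (scl c p)
    show ?case
      by (subst clinear_cong[OF cN L(3)]) (use scl in \<open>auto intro: clinear_smult[OF cN]\<close>)
  }
qed

lemma free_act_closed: "Poly_Mapping.keys p \<subseteq> words B \<Longrightarrow> v \<in> carrier N \<Longrightarrow> free_act N p v \<in> carrier N"
  using clinearD(1)[OF free_act_clinear2] .

lemma free_act_mult:
  assumes p: "Poly_Mapping.keys p \<subseteq> words B" and q: "Poly_Mapping.keys q \<subseteq> words B" and v: "v \<in> carrier N"
  shows "free_act N (p * q) v = free_act N p (free_act N q v)"
proof -
  note cN = cmodule_lie[OF N]
  have left: "clinear (free_space (words B)) (free_space (words B)) (\<lambda>q. p * q)"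
    if "Poly_Mapping.keys p \<subseteq> words B" for p
    by (rule clinearI) (use that in \<open>simp_all add: keys_mult_words distrib_left scl_mult_right\<close>)
  have right: "clinear (free_space (words B)) (free_space (words B)) (\<lambda>p. p * q)"
    by (rule clinearI) (use q in \<open>simp_all add: keys_mult_words distrib_right scl_mult_left\<close>)
  have "free_act N (bas w * q) v = free_act N (bas w) (free_act N q v)" if w: "w \<in> words B" for w
  proof (rule free_space_clinear_eqI[OF cN _ _ _ q])
    have k: "Poly_Mapping.keys (bas w) \<subseteq> words B" using w by simp
    show "clinear (free_space (words B)) N (\<lambda>q. free_act N (bas w * q) v)"
      by (rule clinear_compose[OF left[OF k] free_act_clinear1[OF v]])
    show "clinear (free_space (words B)) N (\<lambda>q. free_act N (bas w) (free_act N q v))"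
      by (rule clinear_compose[OF free_act_clinear1[OF v] free_act_clinear2[OF k]])
    fix w' assume w': "w' \<in> words B"
    have "foldr (act N) (letters w') v \<in> carrier N"
      using clinearD(1)[OF word_clinear[OF w'] v] .
    then show "free_act N (bas w * bas w') v = free_act N (bas w) (free_act N (bas w') v)"
      using w w' v plus_in_words[OF w w'] by (simp add: mult_single free_act_bas)
  qed
  then show ?thesis
    by (intro free_space_clinear_eqI[OF cN clinear_compose[OF right free_act_clinear1[OF v]]
          free_act_clinear1[OF free_act_closed[OF q v]] _ p]) auto
qed

lemma free_act_lett: "x \<in> B \<Longrightarrow> v \<in> carrier N \<Longrightarrow> free_act N (lett x) v = act N x v"
  by (simp add: lett_def free_act_bas)

lemma free_act_one: "v \<in> carrier N \<Longrightarrow> free_act N 1 v = v"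
  using free_act_bas[of 0 v] by (simp add: zero_in_words[simplified])

context
  assumes B: "lie_subalgebra B"
begin

text \<open>
  The elements of the free algebra that annihilate a module form a two-sided ideal, and the module
  laws say exactly that this ideal contains the relations of the enveloping algebra.
\<close>

lemma free_act_env_ideal:
  assumes "p \<in> env_ideal B" "v \<in> carrier N"
  shows "free_act N p v = \<zero>\<^bsub>N\<^esub>"
proof -
  note cN = cmodule_lie[OF N]
  interpret N: module complex_ring N by (rule cN)
  let ?K = "{p. Poly_Mapping.keys p \<subseteq> words B \<and> (\<forall>v\<in>carrier N. free_act N p v = \<zero>\<^bsub>N\<^esub>)}"
  note L = clinearD[OF free_act_clinear1, simplified]
  have "ideal ?K (free_algebra B)"
  proof (rule ideal_free_algebraI)
    show "p + q \<in> ?K" if "p \<in> ?K" "q \<in> ?K" for p q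
      using that L(2) keys_sub(2)[of p "words B" q] by simp
    show "scl c p \<in> ?K" if "p \<in> ?K" for c p
      using that L(3) keys_sub(1)[of p "words B" c] N.smult_r_null[of c] by simp
    show "q * p \<in> ?K" if "p \<in> ?K" "q \<in> carrier (free_algebra B)" for p q
      using that clinear_zero[OF cN cN free_act_clinear2] by (simp add: keys_mult_words free_act_mult)
    show "p * q \<in> ?K" if "p \<in> ?K" "q \<in> carrier (free_algebra B)" for p q
      using that by (simp add: keys_mult_words free_act_mult free_act_closed)
  qed (auto simp: free_act_def)
  moreover have "env_gens B \<subseteq> ?K"
  proof
    fix p assume p: "p \<in> env_gens B"
    have "free_act N p v = \<zero>\<^bsub>N\<^esub>" if v: "v \<in> carrier N" for v
    proof -
      note zero = free_space_clinear_eq_zero[OF cN free_act_clinear1[OF v]]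
      have xy: "x + y \<in> B" "bracket x y \<in> B" "scl c x \<in> B" if "x \<in> B" "y \<in> B" for x y c
        using B that by (auto simp: lie_subalgebra_def)
      have comm: "free_act N (lett x * lett y - lett y * lett x) v = free_act N (lett (bracket x y)) v"
        if "x \<in> B" "y \<in> B" for x y
      proof -
        have "free_act N (lett x * lett y - lett y * lett x) v
            = free_act N (lett x * lett y) v \<ominus>\<^bsub>N\<^esub> free_act N (lett y * lett x) v"
          unfolding minus_eq_scl
          using L(2)[OF v, of "lett x * lett y" "scl (-1) (lett y * lett x)"] 
            L(3)[OF v, of "lett y * lett x" "-1"] that v
            cmodule_minus[OF cN, of "free_act N (lett x * lett y) v" "free_act N (lett y * lett x) v"]
          by (simp add: keys_mult_words keys_lett keys_sub free_act_closed)
        then show ?thesis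
          using that v xy by (simp add: free_act_mult keys_lett free_act_lett lie_module.act_closed[OF N]
              lie_module.bracket_act[OF N])
      qed
      show ?thesis
        using p unfolding env_gens_def
        by (elim UnE CollectE exE conjE; simp only:; intro zero keys_sub_minus keys_sub keys_mult_words keys_lett)
          (use xy v in \<open>simp_all add: L keys_lett free_act_lett lie_module.add_act[OF N] lie_module.smult_act[OF N] comm\<close>)
    qed
    then show "p \<in> ?K" using p env_gens_sub[OF B] by auto
  qed
  ultimately show ?thesis
    using env_ideal_minimal[OF B, of ?K] assms by blast
qed

text \<open>
  Hence the action of the enveloping algebra can be computed on any representative.
\<close>

lemma U_act_cls:
  assumes "Poly_Mapping.keys p \<subseteq> words B" "v \<in> carrier N"
  shows "U_act N (cls B p) v = free_act N p v"
  unfolding U_act_def cls_def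
  by (rule csubspace.the_elem_image_coset[OF csubspace_env[OF B] cmodule_lie[OF N]])
    (use assms free_act_clinear1 free_act_env_ideal in auto)

lemma U_act_clinear1:
  assumes v: "v \<in> carrier N"
  shows "clinear (Uenv B) N (\<lambda>u. U_act N u v)"
  using clinearD[OF free_act_clinear1[OF v], simplified]
  by (intro clinearI)
    (auto simp: Uenv_carrier[OF B] cls_add[OF B] cls_smult[OF B] U_act_cls v keys_sub)

lemma U_act_clinear2: "u \<in> carrier (Uenv B) \<Longrightarrow> clinear N N (U_act N u)"
  using clinearD[OF free_act_clinear2]
  by (intro clinearI) (auto simp: Uenv_carrier[OF B] U_act_cls cmoduleD(1)[OF cmodule_lie[OF N]]
      abelian_monoid.a_closed[OF abelian_group.axioms(1)[OF module.axioms(2)[OF cmodule_lie[OF N]]]])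

lemma U_act_mult: "\<lbrakk>u \<in> carrier (Uenv B); u' \<in> carrier (Uenv B); v \<in> carrier N\<rbrakk> \<Longrightarrow>
    U_act N (u \<otimes>\<^bsub>Uenv B\<^esub> u') v = U_act N u (U_act N u' v)"
  by (auto simp: Uenv_carrier[OF B] cls_mult[OF B] U_act_cls keys_mult_words free_act_mult free_act_closed)

lemma U_act_one: "v \<in> carrier N \<Longrightarrow> U_act N \<one>\<^bsub>Uenv B\<^esub> v = v"
  by (simp add: Uenv_fields U_act_cls keys_one free_act_one del: Uenv_fields(1-5))

end
end

lemma U_act_in: "\<lbrakk>lie_module UNIV N; v \<in> carrier N\<rbrakk> \<Longrightarrow> U_act N (U_in x) v = act N x v"
  by (simp add: U_in_eq U_act_cls[OF _ lie_subalgebra_UNIV] free_act_lett[of UNIV])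

lemma lie_hom_free_act:
  assumes M: "lie_module B M" and N: "lie_module B N" and \<phi>: "lie_hom B M N \<phi>"
    and p: "Poly_Mapping.keys p \<subseteq> words B" and v: "v \<in> carrier M"
  shows "\<phi> (free_act M p v) = free_act N p (\<phi> v)"
proof (rule free_space_clinear_eqI[OF cmodule_lie[OF N] _ _ _ p])
  note \<phi>v = lie_homD(3)[OF \<phi> v]
  show "clinear (free_space (words B)) N (\<lambda>p. \<phi> (free_act M p v))"
    by (rule clinear_compose[OF free_act_clinear1[OF M v] lie_homD(1)[OF \<phi>]])
  show "clinear (free_space (words B)) N (\<lambda>p. free_act N p (\<phi> v))"
    by (rule free_act_clinear1[OF N \<phi>v])
  fix w assume w: "w \<in> words B"
  have "foldr (act M) l v \<in> carrier M \<and> \<phi> (foldr (act M) l v) = foldr (act N) l (\<phi> v)" if "set l \<subseteq> B" for l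
    using that
    by (induction l) (auto simp: v lie_homD(2)[OF \<phi>] lie_module.act_closed[OF M])
  then show "\<phi> (free_act M (bas w) v) = free_act N (bas w) (\<phi> v)"
    using w v \<phi>v by (simp add: free_act_bas[OF M] free_act_bas[OF N])
qed

subsection \<open>The enveloping algebra of the whole algebra\<close>

lemmas UL_add = cls_add[OF lie_subalgebra_UNIV, simplified]
lemmas UL_smult = cls_smult[OF lie_subalgebra_UNIV, simplified]
lemmas UL_mult = cls_mult[OF lie_subalgebra_UNIV, simplified]

lemma UL_carrier: "carrier UL = range (cls UNIV)"
  using Uenv_carrier[OF lie_subalgebra_UNIV] by simp

lemma UL_one: "\<one>\<^bsub>UL\<^esub> = cls UNIV 1" by (simp add: Uenv_fields)

lemmas cmodule_UL = cmodule_Uenv[OF lie_subalgebra_UNIV]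

lemma U_in_closed: "U_in x \<in> carrier UL"
  by (simp add: U_in_eq UL_carrier)

lemma UL_one_closed: "\<one>\<^bsub>UL\<^esub> \<in> carrier UL"
  by (simp add: UL_one UL_carrier)

lemma UL_mult_closed: "u \<in> carrier UL \<Longrightarrow> v \<in> carrier UL \<Longrightarrow> u \<otimes>\<^bsub>UL\<^esub> v \<in> carrier UL"
  by (auto simp: UL_carrier UL_mult)

lemma UL_mult_assoc: "\<lbrakk>u \<in> carrier UL; v \<in> carrier UL; w \<in> carrier UL\<rbrakk> \<Longrightarrow>
    u \<otimes>\<^bsub>UL\<^esub> v \<otimes>\<^bsub>UL\<^esub> w = u \<otimes>\<^bsub>UL\<^esub> (v \<otimes>\<^bsub>UL\<^esub> w)"
  by (auto simp: UL_carrier UL_mult mult.assoc)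

lemma UL_r_one: "u \<in> carrier UL \<Longrightarrow> u \<otimes>\<^bsub>UL\<^esub> \<one>\<^bsub>UL\<^esub> = u"
  and UL_l_one: "u \<in> carrier UL \<Longrightarrow> \<one>\<^bsub>UL\<^esub> \<otimes>\<^bsub>UL\<^esub> u = u"
  by (auto simp: UL_carrier UL_mult UL_one simp del: single_one)

lemma UL_left_clinear: "u \<in> carrier UL \<Longrightarrow> clinear UL UL (\<lambda>v. u \<otimes>\<^bsub>UL\<^esub> v)"
  by (rule clinearI) (auto simp: UL_carrier UL_mult UL_add UL_smult distrib_left scl_mult_right)

lemma UL_right_clinear: "u \<in> carrier UL \<Longrightarrow> clinear UL UL (\<lambda>v. v \<otimes>\<^bsub>UL\<^esub> u)"
  by (rule clinearI) (auto simp: UL_carrier UL_mult UL_add UL_smult distrib_right scl_mult_left)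

lemma U_in_add: "U_in (x + y) = U_in x \<oplus>\<^bsub>UL\<^esub> U_in y"
  unfolding U_in_eq UL_add
  by (rule cls_eq[OF lie_subalgebra_UNIV]) (auto simp: env_gens_def)

lemma U_in_smult: "U_in (scl c x) = c \<odot>\<^bsub>UL\<^esub> U_in x"
  unfolding U_in_eq UL_smult
  by (rule cls_eq[OF lie_subalgebra_UNIV]) (auto simp: env_gens_def)

lemma U_in_bracket: "U_in (bracket x y) = U_in x \<otimes>\<^bsub>UL\<^esub> U_in y \<ominus>\<^bsub>UL\<^esub> U_in y \<otimes>\<^bsub>UL\<^esub> U_in x"
proof -
  have "cls UNIV (lett x * lett y - lett y * lett x) = cls UNIV (lett (bracket x y))"
    by (rule cls_eq[OF lie_subalgebra_UNIV]) (auto simp: env_gens_def)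
  then show ?thesis
    using cmodule_minus[OF cmodule_UL, of "cls UNIV p" "cls UNIV q" for p q]
    unfolding U_in_eq UL_mult minus_eq_scl by (simp add: UL_carrier UL_smult UL_add)
qed

text \<open>
  The enveloping algebra is spanned by products of elements of the Lie algebra; building them from
  the left matches the left action on every module considered here.
\<close>

lemma UL_induct [consumes 1, case_names one mult add smult]:
  assumes u: "u \<in> carrier UL" and one: "P \<one>\<^bsub>UL\<^esub>"
    and mult: "\<And>x u. u \<in> carrier UL \<Longrightarrow> P u \<Longrightarrow> P (U_in x \<otimes>\<^bsub>UL\<^esub> u)"
    and add: "\<And>u v. \<lbrakk>u \<in> carrier UL; v \<in> carrier UL; P u; P v\<rbrakk> \<Longrightarrow> P (u \<oplus>\<^bsub>UL\<^esub> v)"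
    and smult: "\<And>c u. \<lbrakk>u \<in> carrier UL; P u\<rbrakk> \<Longrightarrow> P (c \<odot>\<^bsub>UL\<^esub> u)"
  shows "P u"
proof -
  have "Poly_Mapping.keys p \<subseteq> UNIV \<Longrightarrow> P (cls UNIV p)" for p
  proof (induction p rule: free_space_induct)
    case zero
    have "P (0 \<odot>\<^bsub>UL\<^esub> \<one>\<^bsub>UL\<^esub>)" by (rule smult[OF UL_one_closed one])
    then show ?case by (simp add: UL_one UL_smult)
  next
    case (bas w)
    have "P (cls UNIV (bas (Fword l)))" for l
    proof (induction l)
      case Nil
      then show ?case using one by (simp add: UL_one flip: zero_fword_def)
    next
      case (Cons x l)
      then have "P (U_in x \<otimes>\<^bsub>UL\<^esub> cls UNIV (bas (Fword l)))" by (intro mult) (auto simp: UL_carrier)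
      then show ?case by (simp add: U_in_eq UL_mult bas_fword_Cons[of x l])
    qed
    then show ?case by (metis fword.exhaust)
  next
    case (add p q)
    then show ?case using assms(4)[of "cls UNIV p" "cls UNIV q"] by (simp add: UL_carrier UL_add)
  next
    case (scl c p)
    then show ?case using smult[of "cls UNIV p" c] by (simp add: UL_carrier UL_smult)
  qed
  then show ?thesis using u by (auto simp: UL_carrier)
qed

section \<open>Tensor products of modules\<close>

locale lie_tensor_product =
  fixes M :: "('v, 'm) lie_mod_scheme" and N :: "('w, 'n) lie_mod_scheme"
  assumes lie_M: "lie_module UNIV M" and lie_N: "lie_module UNIV N"
begin

sublocale T: tensor_relations "UNIV :: complex set" "\<lambda>m c. c \<odot>\<^bsub>M\<^esub> m" "\<lambda>c n. c \<odot>\<^bsub>N\<^esub> n" M N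
  by (rule tensor_relations.intro) (simp_all add: cmodule_lie[OF lie_M] cmodule_lie[OF lie_N] cmoduleD(1))

lemmas act_M_clinear = lie_module_act_clinear[OF lie_M UNIV_I]
lemmas act_N_clinear = lie_module_act_clinear[OF lie_N UNIV_I]

lemma lie_tensor_eq: "lie_tensor M N = module.extend T.Q (lie_mod.fields (\<lambda>x. coset_map T.F T.W
    (lin_ext (\<lambda>(u, v). bas (act M x u, v) + bas (u, act N x v)))))"
  by (simp add: lie_tensor_def Let_def)

lemma lie_tensor_simps [simp]:
  "carrier (lie_tensor M N) = carrier T.Q" "add (lie_tensor M N) = add T.Q"
  "zero (lie_tensor M N) = zero T.Q" "smult (lie_tensor M N) = smult T.Q"
  by (simp_all add: lie_tensor_eq)

lemma clinear_lie_tensor [simp]: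
  "clinear (lie_tensor M N) X f = clinear T.Q X f"
  "clinear X' (lie_tensor M N) g = clinear X' T.Q g"
  by (simp_all add: lie_tensor_eq)

lemma cmodule_lie_tensor: "cmodule (lie_tensor M N)"
  unfolding lie_tensor_eq by (intro cmodule_extend T.cmodule_Q)

lemma
  shows act_clinear: "clinear T.Q T.Q (act (lie_tensor M N) x)"
    and act_pt: "\<lbrakk>u \<in> carrier M; v \<in> carrier N\<rbrakk> \<Longrightarrow>
      act (lie_tensor M N) x (T.pt u v) = T.pt (act M x u) v \<oplus>\<^bsub>T.Q\<^esub> T.pt u (act N x v)"
proof -
  \<comment> \<open>representatives of \<open>x (u \<otimes> v)\<close> in the free space\<close>
  let ?h = "\<lambda>(u, v). bas (act M x u, v) + bas (u, act N x v)"
  note cM = clinearD(1)[OF act_M_clinear] and cN = clinearD(1)[OF act_N_clinear]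
  note b = T.pt_balanced[unfolded T.balanced_def, rule_format, THEN conjunct1, rule_format]
    T.pt_balanced[unfolded T.balanced_def, THEN conjunct2, THEN conjunct1, rule_format]
    T.pt_balanced[unfolded T.balanced_def, THEN conjunct2, THEN conjunct2, rule_format]
  have h: "T.W +>\<^bsub>T.F\<^esub> ?h (u, v) = T.pt (act M x u) v \<oplus>\<^bsub>T.Q\<^esub> T.pt u (act N x v)"
    if "u \<in> carrier M" "v \<in> carrier N" for u v
    using csubspace.quot_add[OF T.csubspace_W, of "bas (act M x u, v)" "bas (u, act N x v)"] that cM cN
    by (simp add: T.pt_def)
  have keys: "\<forall>u\<in>carrier M. \<forall>v\<in>carrier N. Poly_Mapping.keys (?h (u, v)) \<subseteq> carrier M \<times> carrier N"
    unfolding split_conv by (intro ballI keys_sub(2)) (simp_all add: cM cN)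
  have "T.balanced T.Q (\<lambda>u v. T.pt (act M x u) v \<oplus>\<^bsub>T.Q\<^esub> T.pt u (act N x v))"
  proof (rule T.balancedI)
    show "clinear N T.Q (\<lambda>v. T.pt (act M x u) v \<oplus>\<^bsub>T.Q\<^esub> T.pt u (act N x v))" if "u \<in> carrier M" for u
      by (intro clinear_add T.cmodule_Q b(1) clinear_compose[OF act_N_clinear b(1)] cM that)
    show "clinear M T.Q (\<lambda>u. T.pt (act M x u) v \<oplus>\<^bsub>T.Q\<^esub> T.pt u (act N x v))" if "v \<in> carrier N" for v
      by (intro clinear_add T.cmodule_Q b(2) clinear_compose[OF act_M_clinear b(2)] cN that)
    fix u c v assume uv: "u \<in> carrier M" "v \<in> carrier N"
    show "T.pt (act M x (c \<odot>\<^bsub>M\<^esub> u)) v \<oplus>\<^bsub>T.Q\<^esub> T.pt (c \<odot>\<^bsub>M\<^esub> u) (act N x v)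
        = T.pt (act M x u) (c \<odot>\<^bsub>N\<^esub> v) \<oplus>\<^bsub>T.Q\<^esub> T.pt u (act N x (c \<odot>\<^bsub>N\<^esub> v))"
      using uv cM cN by (simp add: clinearD(3)[OF act_M_clinear] clinearD(3)[OF act_N_clinear] b(3))
  qed
  then have "T.balanced T.Q (\<lambda>u v. T.W +>\<^bsub>T.F\<^esub> ?h (u, v))"
    by (subst T.balanced_cong) (rule h)
  note op = T.operator[where h = ?h, OF keys this]
  show "clinear T.Q T.Q (act (lie_tensor M N) x)"
    using op(1) by (simp add: lie_tensor_eq)
  show "act (lie_tensor M N) x (T.pt u v) = T.pt (act M x u) v \<oplus>\<^bsub>T.Q\<^esub> T.pt u (act N x v)"
    if "u \<in> carrier M" "v \<in> carrier N"
    using op(2)[OF that] h[OF that] by (simp add: lie_tensor_eq)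
qed

lemma pt_clinear:
  "u \<in> carrier M \<Longrightarrow> clinear N T.Q (T.pt u)"
  "v \<in> carrier N \<Longrightarrow> clinear M T.Q (\<lambda>u. T.pt u v)"
  using T.pt_balanced by (simp_all add: T.balanced_def)

text \<open>
  On pure tensors the mixed terms of the two iterated actions coincide and cancel in the
  commutator.
\<close>

lemma lie_module_lie_tensor: "lie_module UNIV (lie_tensor M N)"
proof (rule lie_module_generatedI[OF cmodule_lie_tensor])
  let ?G = "{T.pt u v |u v. u \<in> carrier M \<and> v \<in> carrier N}"
  interpret Q: module complex_ring T.Q by (rule T.cmodule_Q)
  note cM = clinearD(1)[OF act_M_clinear] and cN = clinearD(1)[OF act_N_clinear]
  show "?G \<subseteq> carrier (lie_tensor M N)" by (auto intro: T.pt_closed)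
  show "f v = g v" if "clinear (lie_tensor M N) (lie_tensor M N) f" "clinear (lie_tensor M N) (lie_tensor M N) g"
    "\<And>u. u \<in> ?G \<Longrightarrow> f u = g u" "v \<in> carrier (lie_tensor M N)" for f g v
    by (rule T.clinear_eqI[OF T.cmodule_Q]) (use that in auto)
  show "clinear (lie_tensor M N) (lie_tensor M N) (act (lie_tensor M N) x)" for x
    using act_clinear by simp
  fix x y z c assume "z \<in> ?G"
  then obtain u v where z: "z = T.pt u v" and u: "u \<in> carrier M" and v: "v \<in> carrier N" by blast
  note p1 = clinearD[OF pt_clinear(1)] and p2 = clinearD[OF pt_clinear(2)]
  note s = act_pt u v cM cN T.pt_closed p1 p2 lie_module.add_act[OF lie_M] lie_module.add_act[OF lie_N]
    lie_module.smult_act[OF lie_M] lie_module.smult_act[OF lie_N]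
  show "act (lie_tensor M N) (x + y) z = act (lie_tensor M N) x z \<oplus>\<^bsub>lie_tensor M N\<^esub> act (lie_tensor M N) y z"
    unfolding z by (simp add: s Q.a_ac)
  show "act (lie_tensor M N) (scl c x) z = c \<odot>\<^bsub>lie_tensor M N\<^esub> act (lie_tensor M N) x z"
    unfolding z by (simp add: s cmoduleD(3)[OF T.cmodule_Q])
  have minus: "p \<ominus>\<^bsub>lie_tensor M N\<^esub> q = p \<ominus>\<^bsub>T.Q\<^esub> q" if "p \<in> carrier T.Q" "q \<in> carrier T.Q" for p q
    using cmodule_minus[OF cmodule_lie_tensor, of p q] cmodule_minus[OF T.cmodule_Q, of p q] that by simp
  have pm: "T.pt (m \<ominus>\<^bsub>M\<^esub> m') v = T.pt m v \<ominus>\<^bsub>T.Q\<^esub> T.pt m' v" if "m \<in> carrier M" "m' \<in> carrier M" for m m'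
    using cmodule_minus[OF T.cmodM that] cmodule_minus[OF T.cmodule_Q, of "T.pt m v" "T.pt m' v"] that v
    by (simp add: p2 T.pt_closed cmoduleD(1)[OF T.cmodM])
  have pn: "T.pt u (n \<ominus>\<^bsub>N\<^esub> n') = T.pt u n \<ominus>\<^bsub>T.Q\<^esub> T.pt u n'" if "n \<in> carrier N" "n' \<in> carrier N" for n n'
    using cmodule_minus[OF T.cmodN that] cmodule_minus[OF T.cmodule_Q, of "T.pt u n" "T.pt u n'"] that u
    by (simp add: p1 T.pt_closed cmoduleD(1)[OF T.cmodN])
  have ac: "act (lie_tensor M N) x (p \<oplus>\<^bsub>T.Q\<^esub> q) = act (lie_tensor M N) x p \<oplus>\<^bsub>T.Q\<^esub> act (lie_tensor M N) x q"
    if "p \<in> carrier T.Q" "q \<in> carrier T.Q" for p q x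
    using clinearD(2)[OF act_clinear that] .
  show "act (lie_tensor M N) (bracket x y) z = act (lie_tensor M N) x (act (lie_tensor M N) y z)
      \<ominus>\<^bsub>lie_tensor M N\<^esub> act (lie_tensor M N) y (act (lie_tensor M N) x z)"
    unfolding z
    by (simp add: act_pt u v cM cN T.pt_closed ac minus pm pn lie_module.bracket_act[OF lie_M]
        lie_module.bracket_act[OF lie_N] Q.add_cancel_middle)
qed

text \<open>
  A balanced map for which \<open>x\<close> acts by the product rule induces a homomorphism.
\<close>

lemma tensor_hom_lift:
  assumes X: "lie_module UNIV X" and \<beta>: "T.balanced X \<beta>"
    and hom: "\<And>x u v. \<lbrakk>u \<in> carrier M; v \<in> carrier N\<rbrakk> \<Longrightarrow>
      act X x (\<beta> u v) = \<beta> (act M x u) v \<oplus>\<^bsub>X\<^esub> \<beta> u (act N x v)"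
  shows "\<exists>\<phi>. lie_hom UNIV (lie_tensor M N) X \<phi> \<and> (\<forall>u\<in>carrier M. \<forall>v\<in>carrier N. \<phi> (T.pt u v) = \<beta> u v)"
proof -
  note cX = cmodule_lie[OF X]
  obtain \<phi> where \<phi>: "clinear T.Q X \<phi>" and pt: "\<And>u v. \<lbrakk>u \<in> carrier M; v \<in> carrier N\<rbrakk> \<Longrightarrow> \<phi> (T.pt u v) = \<beta> u v"
    using T.lift[OF cX \<beta>] by blast
  have "\<phi> (act (lie_tensor M N) x z) = act X x (\<phi> z)" if "z \<in> carrier T.Q" for x z
  proof (rule T.clinear_eqI[OF cX clinear_compose[OF act_clinear \<phi>]
        clinear_compose[OF \<phi> lie_module_act_clinear[OF X UNIV_I]] _ that])
    fix u v assume "u \<in> carrier M" "v \<in> carrier N"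
    then show "\<phi> (act (lie_tensor M N) x (T.pt u v)) = act X x (\<phi> (T.pt u v))"
      using clinearD(1)[OF act_M_clinear] clinearD(1)[OF act_N_clinear]
      by (simp add: act_pt pt hom clinearD(2)[OF \<phi>] T.pt_closed)
  qed
  then show ?thesis using \<phi> pt by (intro exI[of _ \<phi>]) (simp add: lie_hom_def)
qed

end

section \<open>Induced modules\<close>

locale induced_module =
  fixes B and N :: "('v, 'm) lie_mod_scheme"
  assumes B: "lie_subalgebra B" and lie_N: "lie_module B N"
begin

lemma U_incl_closed: "a \<in> carrier (Uenv B) \<Longrightarrow> U_incl a \<in> carrier UL"
  by (auto simp: Uenv_carrier[OF B] U_incl_cls[OF B] UL_carrier)

sublocale T: tensor_relations "carrier (Uenv B)" "\<lambda>u a. u \<otimes>\<^bsub>UL\<^esub> U_incl a" "U_act N" UL N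
  by (rule tensor_relations.intro)
    (simp_all add: cmodule_lie[OF lie_N] cmodule_UL UL_mult_closed U_incl_closed
      clinearD(1)[OF U_act_clinear2[OF lie_N B]])

lemma Ind_eq: "Ind B N = module.extend T.Q (lie_mod.fields (\<lambda>x. coset_map T.F T.W
    (lin_ext (\<lambda>(u, n). bas (U_in x \<otimes>\<^bsub>UL\<^esub> u, n)))))"
  by (simp add: Ind_def Let_def)

lemma Ind_simps [simp]:
  "carrier (Ind B N) = carrier T.Q" "add (Ind B N) = add T.Q"
  "zero (Ind B N) = zero T.Q" "smult (Ind B N) = smult T.Q"
  by (simp_all add: Ind_eq)

lemma clinear_Ind [simp]:
  "clinear (Ind B N) X f = clinear T.Q X f"
  "clinear X' (Ind B N) g = clinear X' T.Q g"
  by (simp_all add: Ind_eq)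

lemma cmodule_Ind: "cmodule (Ind B N)"
  unfolding Ind_eq by (intro cmodule_extend T.cmodule_Q)

lemma pt_clinear:
  "u \<in> carrier UL \<Longrightarrow> clinear N T.Q (T.pt u)"
  "n \<in> carrier N \<Longrightarrow> clinear UL T.Q (\<lambda>u. T.pt u n)"
  using T.pt_balanced by (simp_all add: T.balanced_def)

lemma pt_move: "\<lbrakk>u \<in> carrier UL; a \<in> carrier (Uenv B); n \<in> carrier N\<rbrakk> \<Longrightarrow>
    T.pt (u \<otimes>\<^bsub>UL\<^esub> U_incl a) n = T.pt u (U_act N a n)"
  using T.pt_balanced by (simp add: T.balanced_def)

lemma
  shows act_clinear: "clinear T.Q T.Q (act (Ind B N) x)"
    and act_pt: "\<lbrakk>u \<in> carrier UL; n \<in> carrier N\<rbrakk> \<Longrightarrow>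
      act (Ind B N) x (T.pt u n) = T.pt (U_in x \<otimes>\<^bsub>UL\<^esub> u) n"
proof -
  let ?h = "\<lambda>(u, n). bas (U_in x \<otimes>\<^bsub>UL\<^esub> u, n)"
  have keys: "\<forall>u\<in>carrier UL. \<forall>n\<in>carrier N. Poly_Mapping.keys (?h (u, n)) \<subseteq> carrier UL \<times> carrier N"
    using UL_mult_closed[OF U_in_closed] by simp
  have "T.balanced T.Q (\<lambda>u n. T.pt (U_in x \<otimes>\<^bsub>UL\<^esub> u) n)"
    by (intro T.balancedI pt_clinear clinear_compose[OF UL_left_clinear pt_clinear(2)])
      (simp_all add: U_in_closed UL_mult_closed UL_mult_assoc[symmetric] U_incl_closed pt_move)
  then have "T.balanced T.Q (\<lambda>u n. T.W +>\<^bsub>T.F\<^esub> ?h (u, n))"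
    by (simp add: T.pt_def)
  note op = T.operator[where h = ?h, OF keys this]
  show "clinear T.Q T.Q (act (Ind B N) x)"
    using op(1) by (simp add: Ind_eq)
  show "act (Ind B N) x (T.pt u n) = T.pt (U_in x \<otimes>\<^bsub>UL\<^esub> u) n"
    if "u \<in> carrier UL" "n \<in> carrier N"
    using op(2)[OF that] by (simp add: Ind_eq T.pt_def)
qed

lemma lie_module_Ind: "lie_module UNIV (Ind B N)"
proof (rule lie_module_generatedI[OF cmodule_Ind])
  let ?G = "{T.pt u n |u n. u \<in> carrier UL \<and> n \<in> carrier N}"
  note c = UL_mult_closed[OF U_in_closed]
  show "?G \<subseteq> carrier (Ind B N)" by (auto intro: T.pt_closed)
  show "f v = g v" if "clinear (Ind B N) (Ind B N) f" "clinear (Ind B N) (Ind B N) g"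
    "\<And>u. u \<in> ?G \<Longrightarrow> f u = g u" "v \<in> carrier (Ind B N)" for f g v
    by (rule T.clinear_eqI[OF T.cmodule_Q]) (use that in auto)
  show "clinear (Ind B N) (Ind B N) (act (Ind B N) x)" for x
    using act_clinear by simp
  fix x y z k assume "z \<in> ?G"
  then obtain u n where z: "z = T.pt u n" and u: "u \<in> carrier UL" and n: "n \<in> carrier N" by blast
  note p = clinearD[OF pt_clinear(2)[OF n]] and r = clinearD[OF UL_right_clinear[OF u]]
  show "act (Ind B N) (x + y) z = act (Ind B N) x z \<oplus>\<^bsub>Ind B N\<^esub> act (Ind B N) y z"
    unfolding z by (simp add: act_pt u n U_in_add U_in_closed r p c)
  show "act (Ind B N) (scl k x) z = k \<odot>\<^bsub>Ind B N\<^esub> act (Ind B N) x z"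
    unfolding z by (simp add: act_pt u n U_in_smult U_in_closed r p c)
  have "T.pt (U_in (bracket x y) \<otimes>\<^bsub>UL\<^esub> u) n
      = T.pt (U_in x \<otimes>\<^bsub>UL\<^esub> U_in y \<otimes>\<^bsub>UL\<^esub> u) n \<ominus>\<^bsub>Ind B N\<^esub> T.pt (U_in y \<otimes>\<^bsub>UL\<^esub> U_in x \<otimes>\<^bsub>UL\<^esub> u) n"
    using cmodule_minus[OF cmodule_UL, of "U_in x \<otimes>\<^bsub>UL\<^esub> U_in y" "U_in y \<otimes>\<^bsub>UL\<^esub> U_in x"]
      cmodule_minus[OF cmodule_Ind, of "T.pt (U_in x \<otimes>\<^bsub>UL\<^esub> U_in y \<otimes>\<^bsub>UL\<^esub> u) n"
          "T.pt (U_in y \<otimes>\<^bsub>UL\<^esub> U_in x \<otimes>\<^bsub>UL\<^esub> u) n"]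
    by (simp add: U_in_bracket U_in_closed UL_mult_closed r p u n T.pt_closed cmoduleD(1)[OF cmodule_UL])
  then show "act (Ind B N) (bracket x y) z = act (Ind B N) x (act (Ind B N) y z)
      \<ominus>\<^bsub>Ind B N\<^esub> act (Ind B N) y (act (Ind B N) x z)"
    unfolding z by (simp add: act_pt u n c U_in_closed UL_mult_assoc)
qed

text \<open>
  The canonical map \<open>n \<mapsto> 1 \<otimes> n\<close>.
\<close>

definition emb :: "'v \<Rightarrow> (free_alg set \<times> 'v \<Rightarrow>\<^sub>0 complex) set" where
  "emb n = T.pt \<one>\<^bsub>UL\<^esub> n"

lemma emb_hom: "lie_hom B N (Ind B N) emb"
proof (rule lie_homI)
  show "clinear N (Ind B N) emb"
    using pt_clinear(1)[OF UL_one_closed] by (simp add: emb_def[abs_def])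
  fix x n assume x: "x \<in> B" and n: "n \<in> carrier N"
  let ?a = "cls B (lett x)"
  have "emb (act N x n) = T.pt \<one>\<^bsub>UL\<^esub> (U_act N ?a n)"
    by (simp add: emb_def U_act_cls[OF lie_N B] keys_lett x n free_act_lett[OF lie_N])
  also have "\<dots> = T.pt (\<one>\<^bsub>UL\<^esub> \<otimes>\<^bsub>UL\<^esub> U_incl ?a) n"
    using x n by (intro pt_move[symmetric] UL_one_closed cls_closed[OF B] keys_lett)
  also have "\<dots> = T.pt (U_in x) n"
    using x by (simp add: U_incl_cls[OF B] keys_lett UL_l_one UL_carrier U_in_eq)
  finally show "emb (act N x n) = act (Ind B N) x (emb n)"
    using n by (simp add: emb_def act_pt UL_one_closed UL_r_one U_in_closed)
qed

text \<open>
  The induced module is generated by the image of \<open>N\<close>.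
\<close>

lemma Ind_hom_eqI:
  assumes X: "lie_module UNIV X" and f: "lie_hom UNIV (Ind B N) X f" and g: "lie_hom UNIV (Ind B N) X g"
    and eq: "\<And>n. n \<in> carrier N \<Longrightarrow> f (emb n) = g (emb n)" and v: "v \<in> carrier (Ind B N)"
  shows "f v = g v"
proof (rule T.clinear_eqI[OF cmodule_lie[OF X]])
  show lin: "clinear T.Q X f" "clinear T.Q X g"
    using lie_homD(1)[OF f] lie_homD(1)[OF g] by simp_all
  show "v \<in> carrier T.Q" using v by simp
  fix u n assume "u \<in> carrier UL" and n: "n \<in> carrier N"
  then show "f (T.pt u n) = g (T.pt u n)"
  proof (induction u rule: UL_induct)
    case one
    show ?case using eq[OF n] by (simp add: emb_def)
  next
    case (mult x u)
    then have z: "T.pt u n \<in> carrier (Ind B N)" using n by (simp add: T.pt_closed)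
    show ?case
      using lie_homD(2)[OF f _ z, of x] lie_homD(2)[OF g _ z, of x] mult n by (simp add: act_pt)
  next
    case (add u v)
    then show ?case
      using n by (simp add: clinearD(2)[OF pt_clinear(2)] clinearD(2)[OF lin(1)] clinearD(2)[OF lin(2)] T.pt_closed)
  next
    case (smult c u)
    then show ?case
      using n by (simp add: clinearD(3)[OF pt_clinear(2)] clinearD(3)[OF lin(1)] clinearD(3)[OF lin(2)] T.pt_closed)
  qed
qed

text \<open>
  Frobenius reciprocity: \<open>u \<otimes> n \<mapsto> u (\<iota> n)\<close> is balanced because a homomorphism over the
  subalgebra also commutes with the action of its enveloping algebra.
\<close>

lemma Ind_hom_lift:
  assumes X: "lie_module UNIV X" and \<iota>: "lie_hom B N X \<iota>"
  shows "\<exists>\<phi>. lie_hom UNIV (Ind B N) X \<phi> \<and> (\<forall>n\<in>carrier N. \<phi> (emb n) = \<iota> n)"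
proof -
  note U = lie_subalgebra_UNIV and cX = cmodule_lie[OF X] and XB = lie_module_mono[OF X subset_UNIV]
  note \<iota>c = lie_homD(3)[OF \<iota>]
  have "T.balanced X (\<lambda>u n. U_act X u (\<iota> n))"
  proof (rule T.balancedI)
    show "clinear N X (\<lambda>n. U_act X u (\<iota> n))" if "u \<in> carrier UL" for u
      by (rule clinear_compose[OF lie_homD(1)[OF \<iota>] U_act_clinear2[OF X U that]])
    show "clinear UL X (\<lambda>u. U_act X u (\<iota> n))" if "n \<in> carrier N" for n
      by (rule U_act_clinear1[OF X U \<iota>c[OF that]])
    fix u a n assume u: "u \<in> carrier UL" and a: "a \<in> carrier (Uenv B)" and n: "n \<in> carrier N"
    obtain p where p: "a = cls B p" "Poly_Mapping.keys p \<subseteq> words B"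
      using a by (auto simp: Uenv_carrier[OF B])
    have "U_act X (U_incl a) (\<iota> n) = \<iota> (U_act N a n)"
      using lie_hom_free_act[OF lie_N XB \<iota> p(2) n] n \<iota>c
      by (simp add: p U_incl_cls[OF B] U_act_cls[OF X U] U_act_cls[OF lie_N B])
    then show "U_act X (u \<otimes>\<^bsub>UL\<^esub> U_incl a) (\<iota> n) = U_act X u (\<iota> (U_act N a n))"
      using u a n \<iota>c by (simp add: U_act_mult[OF X U] U_incl_closed)
  qed
  then obtain \<phi> where \<phi>: "clinear T.Q X \<phi>"
    and pt: "\<And>u n. \<lbrakk>u \<in> carrier UL; n \<in> carrier N\<rbrakk> \<Longrightarrow> \<phi> (T.pt u n) = U_act X u (\<iota> n)"
    using T.lift[OF cX] by blast
  have "\<phi> (act (Ind B N) x z) = act X x (\<phi> z)" if "z \<in> carrier T.Q" for x z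
  proof (rule T.clinear_eqI[OF cX clinear_compose[OF act_clinear \<phi>]
        clinear_compose[OF \<phi> lie_module_act_clinear[OF X UNIV_I]] _ that])
    fix u n assume un: "u \<in> carrier UL" "n \<in> carrier N"
    have "U_act X u (\<iota> n) \<in> carrier X" by (rule clinearD(1)[OF U_act_clinear2[OF X U un(1)] \<iota>c[OF un(2)]])
    then show "\<phi> (act (Ind B N) x (T.pt u n)) = act X x (\<phi> (T.pt u n))"
      using un \<iota>c by (simp add: act_pt pt UL_mult_closed U_in_closed U_act_mult[OF X U] U_act_in[OF X])
  qed
  moreover have "\<phi> (emb n) = \<iota> n" if "n \<in> carrier N" for n
    using that \<iota>c by (simp add: emb_def pt UL_one_closed U_act_one[OF X U])
  ultimately show ?thesis using \<phi> by (intro exI[of _ \<phi>]) (simp add: lie_hom_def)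
qed

end

section \<open>Verma modules\<close>

definition pos_gens :: "gen set" where
  "pos_gens = {Eg i |i. i \<ge> 0} \<union> {Fg i |i. i \<ge> 1} \<union> {Hg i |i. i \<ge> 0} \<union> {Dg i |i. i \<ge> 0} \<union> {Cg}"

text \<open>
  The subalgebra spanned by the generators that act on the highest weight vector of a Verma module
  by scalars, and the character \<open>weight\<close> by which they act.
\<close>

definition b_plus :: "affvir set" where
  "b_plus = {x. Poly_Mapping.keys x \<subseteq> pos_gens}"

definition weight :: "complex \<Rightarrow> complex \<Rightarrow> complex \<Rightarrow> affvir \<Rightarrow> complex" where
  "weight \<eta> \<epsilon> \<theta> x = \<eta> * Poly_Mapping.lookup x (Dg 0) + \<epsilon> * Poly_Mapping.lookup x (Hg 0)
     + \<theta> * Poly_Mapping.lookup x Cg"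

lemma weight_add: "weight \<eta> \<epsilon> \<theta> (x + y) = weight \<eta> \<epsilon> \<theta> x + weight \<eta> \<epsilon> \<theta> y"
  and weight_scl: "weight \<eta> \<epsilon> \<theta> (scl c x) = c * weight \<eta> \<epsilon> \<theta> x"
  by (simp_all add: weight_def lookup_add algebra_simps)

text \<open>
  A left ideal of an algebra with unit is a subspace, since scalars act through multiples of the
  unit.
\<close>

lemma left_ideal_csubspace:
  assumes "left_ideal I UL" shows "csubspace UL I"
proof -
  have a: "additive_subgroup I UL" and m: "\<And>u v. \<lbrakk>u \<in> carrier UL; v \<in> I\<rbrakk> \<Longrightarrow> u \<otimes>\<^bsub>UL\<^esub> v \<in> I"
    using assms by (auto simp: left_ideal_def)
  have sub: "I \<subseteq> carrier UL" by (rule additive_subgroup.a_subset[OF a])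
  have "c \<odot>\<^bsub>UL\<^esub> v \<in> I" if v: "v \<in> I" for c v
  proof -
    have vc: "v \<in> carrier UL" using v sub by blast
    have "c \<odot>\<^bsub>UL\<^esub> v = (c \<odot>\<^bsub>UL\<^esub> \<one>\<^bsub>UL\<^esub>) \<otimes>\<^bsub>UL\<^esub> v"
      using clinearD(3)[OF UL_right_clinear[OF vc] UL_one_closed, of c] vc by (simp add: UL_l_one)
    then show ?thesis using m[OF cmoduleD(1)[OF cmodule_UL UL_one_closed, of c] v] by simp
  qed
  then show ?thesis
    using sub additive_subgroup.zero_closed[OF a] additive_subgroup.a_closed[OF a]
    by (intro csubspace.intro csubspace_axioms.intro cmodule_UL) auto
qed

lemma left_idealI:
  assumes "csubspace UL I" "\<And>u v. \<lbrakk>u \<in> carrier UL; v \<in> I\<rbrakk> \<Longrightarrow> u \<otimes>\<^bsub>UL\<^esub> v \<in> I"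
  shows "left_ideal I UL"
  using assms abelian_subgroup.axioms(1)[OF csubspace.abelian_subgroup[OF assms(1)]]
  by (simp add: left_ideal_def)

lemma left_ideal_gen:
  assumes S: "S \<subseteq> carrier UL"
  shows "left_ideal (gen_left_ideal UL S) UL" and "S \<subseteq> gen_left_ideal UL S"
proof -
  interpret UL: module complex_ring UL by (rule cmodule_UL)
  have "csubspace UL (carrier UL)"
    by (intro csubspace.intro csubspace_axioms.intro cmodule_UL) (simp_all add: cmoduleD(1)[OF cmodule_UL])
  then have top: "left_ideal (carrier UL) UL"
    by (rule left_idealI) (rule UL_mult_closed)
  show "left_ideal (gen_left_ideal UL S) UL"
  proof (rule left_idealI)
    show "csubspace UL (gen_left_ideal UL S)"
    proof (intro csubspace.intro csubspace_axioms.intro cmodule_UL)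
      show "gen_left_ideal UL S \<subseteq> carrier UL" using top S by (auto simp: gen_left_ideal_def)
    next
      show "\<zero>\<^bsub>UL\<^esub> \<in> gen_left_ideal UL S"
        using csubspace.W_zero[OF left_ideal_csubspace] by (simp add: gen_left_ideal_def)
    next
      fix v w assume "v \<in> gen_left_ideal UL S" "w \<in> gen_left_ideal UL S"
      then show "v \<oplus>\<^bsub>UL\<^esub> w \<in> gen_left_ideal UL S"
        using csubspace.W_add[OF left_ideal_csubspace] by (simp add: gen_left_ideal_def)
    next
      fix v c assume "v \<in> gen_left_ideal UL S"
      then show "c \<odot>\<^bsub>UL\<^esub> v \<in> gen_left_ideal UL S"
        using csubspace.W_smult[OF left_ideal_csubspace] by (simp add: gen_left_ideal_def)
    qed
  qed (auto simp: gen_left_ideal_def left_ideal_def)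
  show "S \<subseteq> gen_left_ideal UL S" by (auto simp: gen_left_ideal_def)
qed

locale verma_module =
  fixes \<eta> \<epsilon> \<theta> :: complex
begin

abbreviation "I \<equiv> verma_ideal \<eta> \<epsilon> \<theta>"
abbreviation "V \<equiv> verma \<eta> \<epsilon> \<theta>"
abbreviation "\<chi> \<equiv> weight \<eta> \<epsilon> \<theta>"

text \<open>
  The generators of the ideal in uniform shape: \<open>k - \<chi>(k)\<close> for each basis vector \<open>k\<close> of the
  subalgebra \<open>b_plus\<close>.
\<close>

definition verma_gens :: "free_alg set set" where
  "verma_gens = (\<lambda>k. U_in (bas k) \<ominus>\<^bsub>UL\<^esub> (\<chi> (bas k) \<odot>\<^bsub>UL\<^esub> \<one>\<^bsub>UL\<^esub>)) ` pos_gens"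

lemma verma_ideal_eq: "I = gen_left_ideal UL verma_gens"
proof -
  interpret UL: module complex_ring UL by (rule cmodule_UL)
  have z: "U_in x \<ominus>\<^bsub>UL\<^esub> (0 \<odot>\<^bsub>UL\<^esub> \<one>\<^bsub>UL\<^esub>) = U_in x" for x
    by (simp add: cmoduleD(6)[OF cmodule_UL] UL_one_closed U_in_closed UL.minus_eq UL.add.inv_one)
  have w: "\<chi> (bas (Eg i)) = 0" "\<chi> (bas (Fg i)) = 0" "\<chi> (bas (Hg i)) = (if i = 0 then \<epsilon> else 0)"
    "\<chi> (bas (Dg i)) = (if i = 0 then \<eta> else 0)" "\<chi> (bas Cg) = \<theta>" for i
    by (simp_all add: weight_def lookup_single)
  have "verma_gens = {U_in (eL 0)}
       \<union> {U_in x |x i. i \<ge> 1 \<and> x \<in> {eL (int i), fL (int i), hL (int i), dL (int i)}}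
       \<union> {U_in (dL 0) \<ominus>\<^bsub>UL\<^esub> (\<eta> \<odot>\<^bsub>UL\<^esub> \<one>\<^bsub>UL\<^esub>),
          U_in (hL 0) \<ominus>\<^bsub>UL\<^esub> (\<epsilon> \<odot>\<^bsub>UL\<^esub> \<one>\<^bsub>UL\<^esub>),
          U_in cL \<ominus>\<^bsub>UL\<^esub> (\<theta> \<odot>\<^bsub>UL\<^esub> \<one>\<^bsub>UL\<^esub>)}" (is "_ = ?S")
  proof
    show "verma_gens \<subseteq> ?S"
    proof
      fix u assume "u \<in> verma_gens"
      then obtain k where k: "k \<in> pos_gens" and u: "u = U_in (bas k) \<ominus>\<^bsub>UL\<^esub> (\<chi> (bas k) \<odot>\<^bsub>UL\<^esub> \<one>\<^bsub>UL\<^esub>)"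
        by (auto simp: verma_gens_def)
      have *: "U_in x \<in> ?S" if "i \<ge> (1::int)" "x \<in> {eL i, fL i, hL i, dL i}" for x i
      proof -
        have "nat i \<ge> 1 \<and> x \<in> {eL (int (nat i)), fL (int (nat i)), hL (int (nat i)), dL (int (nat i))}"
          using that by auto
        then show ?thesis by blast
      qed
      from k consider (E) i where "k = Eg i" "i \<ge> 0" | (F) i where "k = Fg i" "i \<ge> 1"
        | (H) i where "k = Hg i" "i \<ge> 0" | (D) i where "k = Dg i" "i \<ge> 0" | (C) "k = Cg"
        by (auto simp: pos_gens_def)
      then show "u \<in> ?S"
      proof cases
        case E then show ?thesis using u *[of i "eL i"] by (cases "i = 0") (simp_all add: w z)
      next
        case F then show ?thesis using u *[of i "fL i"] by (simp add: w z)
      next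
        case H then show ?thesis using u *[of i "hL i"] by (cases "i = 0") (simp_all add: w z)
      next
        case D then show ?thesis using u *[of i "dL i"] by (cases "i = 0") (simp_all add: w z)
      next
        case C then show ?thesis using u by (simp add: w)
      qed
    qed
    have g: "U_in (bas k) \<ominus>\<^bsub>UL\<^esub> (c \<odot>\<^bsub>UL\<^esub> \<one>\<^bsub>UL\<^esub>) \<in> verma_gens" if "k \<in> pos_gens" "c = \<chi> (bas k)" for k c
      using that by (simp add: verma_gens_def)
    have g0: "U_in (bas k) \<in> verma_gens" if "k \<in> pos_gens" "\<chi> (bas k) = 0" for k
      using g[of k 0] that by (simp add: z)
    show "?S \<subseteq> verma_gens"
      by (auto simp: w pos_gens_def intro!: g g0)
  qed
  then show ?thesis by (simp add: verma_ideal_def)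
qed

lemma verma_gens_sub: "verma_gens \<subseteq> carrier UL"
proof -
  interpret UL: module complex_ring UL by (rule cmodule_UL)
  show ?thesis
    by (auto simp: verma_gens_def intro!: UL.minus_closed U_in_closed cmoduleD(1)[OF cmodule_UL] UL_one_closed)
qed

lemmas left_ideal_verma = left_ideal_gen(1)[OF verma_gens_sub, folded verma_ideal_eq]
lemmas verma_gens_ideal = left_ideal_gen(2)[OF verma_gens_sub, folded verma_ideal_eq]
lemmas csubspace_verma = left_ideal_csubspace[OF left_ideal_verma]

lemma verma_simps:
  "carrier V = carrier (quot_space UL I)" "add V = add (quot_space UL I)"
  "zero V = zero (quot_space UL I)" "smult V = smult (quot_space UL I)"
  by (simp_all add: verma_def)

lemma cmodule_verma: "cmodule V"
  unfolding verma_def by (intro cmodule_extend csubspace.quot_cmodule csubspace_verma)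

definition vcls :: "free_alg set \<Rightarrow> free_alg set set" where
  "vcls u = I +>\<^bsub>UL\<^esub> u"

lemma carrier_verma: "carrier V = vcls ` carrier UL"
  by (simp add: verma_simps csubspace.quot_carrier[OF csubspace_verma] vcls_def)

lemma vcls_clinear: "clinear UL V vcls"
  using csubspace.proj_clinear[OF csubspace_verma] by (simp add: verma_def vcls_def[abs_def])

lemma act_vcls: "u \<in> carrier UL \<Longrightarrow> act V x (vcls u) = vcls (U_in x \<otimes>\<^bsub>UL\<^esub> u)"
  using csubspace.coset_map_coset[OF csubspace_verma csubspace_verma UL_left_clinear[OF U_in_closed, of x], of u]
    left_ideal_verma U_in_closed
  by (simp add: verma_def vcls_def left_ideal_def)

lemma act_verma_clinear: "clinear V V (act V x)"
  using csubspace.quot_clinearI[OF csubspace_verma act_vcls[unfolded vcls_def]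
      clinear_compose[OF UL_left_clinear[OF U_in_closed] vcls_clinear[unfolded vcls_def[abs_def]]]]
  by (simp add: verma_def)

lemma lie_module_verma: "lie_module UNIV V"
proof (rule lie_module_generatedI[OF cmodule_verma subset_refl])
  fix x y v c assume "v \<in> carrier V"
  then obtain u where v: "v = vcls u" and u: "u \<in> carrier UL" unfolding carrier_verma by blast
  note p = clinearD[OF vcls_clinear] and r = clinearD[OF UL_right_clinear[OF u]] and c = UL_mult_closed[OF U_in_closed]
  show "act V (x + y) v = act V x v \<oplus>\<^bsub>V\<^esub> act V y v"
    unfolding v by (simp add: act_vcls u U_in_add U_in_closed r p c)
  show "act V (scl c x) v = c \<odot>\<^bsub>V\<^esub> act V x v"
    unfolding v by (simp add: act_vcls u U_in_smult U_in_closed r p c)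
  have "vcls (U_in (bracket x y) \<otimes>\<^bsub>UL\<^esub> u)
      = vcls (U_in x \<otimes>\<^bsub>UL\<^esub> U_in y \<otimes>\<^bsub>UL\<^esub> u) \<ominus>\<^bsub>V\<^esub> vcls (U_in y \<otimes>\<^bsub>UL\<^esub> U_in x \<otimes>\<^bsub>UL\<^esub> u)"
    using cmodule_minus[OF cmodule_UL, of "U_in x \<otimes>\<^bsub>UL\<^esub> U_in y" "U_in y \<otimes>\<^bsub>UL\<^esub> U_in x"]
      cmodule_minus[OF cmodule_verma, of "vcls (U_in x \<otimes>\<^bsub>UL\<^esub> U_in y \<otimes>\<^bsub>UL\<^esub> u)"
          "vcls (U_in y \<otimes>\<^bsub>UL\<^esub> U_in x \<otimes>\<^bsub>UL\<^esub> u)"]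
    by (simp add: U_in_bracket U_in_closed UL_mult_closed r p u cmoduleD(1)[OF cmodule_UL])
  then show "act V (bracket x y) v = act V x (act V y v) \<ominus>\<^bsub>V\<^esub> act V y (act V x v)"
    unfolding v by (simp add: act_vcls u c U_in_closed UL_mult_assoc)
qed (auto intro: act_verma_clinear)

text \<open>
  The canonical generator of the Verma module.
\<close>

definition vac :: "free_alg set set" where
  "vac = vcls \<one>\<^bsub>UL\<^esub>"

definition highest_weight_vector :: "('v, 'm) lie_mod_scheme \<Rightarrow> 'v \<Rightarrow> bool" where
  "highest_weight_vector Y y \<longleftrightarrow> y \<in> carrier Y \<and> (\<forall>x\<in>b_plus. act Y x y = \<chi> x \<odot>\<^bsub>Y\<^esub> y)"

lemma highest_weight_vectorI:
  assumes Y: "lie_module UNIV Y" and y: "y \<in> carrier Y"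
    and gens: "\<And>k. k \<in> pos_gens \<Longrightarrow> act Y (bas k) y = \<chi> (bas k) \<odot>\<^bsub>Y\<^esub> y"
  shows "highest_weight_vector Y y"
proof -
  note cY = cmodule_lie[OF Y]
  have "act Y x y = \<chi> x \<odot>\<^bsub>Y\<^esub> y" if "Poly_Mapping.keys x \<subseteq> pos_gens" for x
    using that
  proof (induction x rule: free_space_induct)
    case zero
    have "act Y (scl 0 0) y = 0 \<odot>\<^bsub>Y\<^esub> act Y 0 y"
      by (rule lie_module.smult_act[OF Y]) (use y in auto)
    then show ?case
      using y cmoduleD(6)[OF cY] lie_module.act_closed[OF Y _ y, of 0] by (simp add: weight_def)
  next
    case (add p q)
    then show ?case
      using lie_module.add_act[OF Y, of p q y] y by (simp add: weight_add cmoduleD(2)[OF cY])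
  next
    case (scl c p)
    then show ?case
      using lie_module.smult_act[OF Y, of p y c] y by (simp add: weight_scl cmoduleD(4)[OF cY])
  qed (rule gens)
  then show ?thesis using y by (simp add: highest_weight_vector_def b_plus_def)
qed

lemma vac_highest_weight: "highest_weight_vector V vac"
proof (rule highest_weight_vectorI[OF lie_module_verma])
  show "vac \<in> carrier V" using carrier_verma UL_one_closed by (auto simp: vac_def)
  fix k assume "k \<in> pos_gens"
  then have "U_in (bas k) \<ominus>\<^bsub>UL\<^esub> (\<chi> (bas k) \<odot>\<^bsub>UL\<^esub> \<one>\<^bsub>UL\<^esub>) \<in> I"
    using verma_gens_ideal by (auto simp: verma_gens_def)
  then have "vcls (U_in (bas k)) = vcls (\<chi> (bas k) \<odot>\<^bsub>UL\<^esub> \<one>\<^bsub>UL\<^esub>)"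
    unfolding vcls_def
    by (intro csubspace.coset_eqI[OF csubspace_verma] U_in_closed cmoduleD(1)[OF cmodule_UL] UL_one_closed)
  then show "act V (bas k) vac = \<chi> (bas k) \<odot>\<^bsub>V\<^esub> vac"
    by (simp add: vac_def act_vcls UL_one_closed UL_r_one U_in_closed clinearD(3)[OF vcls_clinear])
qed

text \<open>
  The universal property of the Verma module: the annihilator of a highest weight vector is a left
  ideal that contains the generators of the Verma ideal.
\<close>

lemma verma_hom_lift:
  assumes Y: "lie_module UNIV Y" and y: "highest_weight_vector Y y"
  shows "\<exists>g. lie_hom UNIV V Y g \<and> g vac = y"
proof -
  note cY = cmodule_lie[OF Y] and U = lie_subalgebra_UNIV
  interpret Y: module complex_ring Y by (rule cY)
  have yc: "y \<in> carrier Y" and hw: "\<And>x. x \<in> b_plus \<Longrightarrow> act Y x y = \<chi> x \<odot>\<^bsub>Y\<^esub> y"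
    using y by (auto simp: highest_weight_vector_def)
  let ?f = "\<lambda>u. U_act Y u y" and ?K = "{u \<in> carrier UL. U_act Y u y = \<zero>\<^bsub>Y\<^esub>}"
  have f: "clinear UL Y ?f" by (rule U_act_clinear1[OF Y U yc])
  note L = clinearD[OF f]
  interpret UL: module complex_ring UL by (rule cmodule_UL)
  have "csubspace UL ?K"
    by (intro csubspace.intro csubspace_axioms.intro cmodule_UL)
      (auto simp: L cmoduleD(1)[OF cmodule_UL] clinear_zero[OF cmodule_UL cY f] Y.smult_r_null[of c for c, simplified])
  moreover have "u \<otimes>\<^bsub>UL\<^esub> v \<in> ?K" if "u \<in> carrier UL" "v \<in> ?K" for u v
    using that clinear_zero[OF cY cY U_act_clinear2[OF Y U]] by (simp add: UL_mult_closed U_act_mult[OF Y U] yc)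
  ultimately have "left_ideal ?K UL" by (rule left_idealI)
  moreover have "verma_gens \<subseteq> ?K"
  proof
    fix u assume "u \<in> verma_gens"
    then obtain k where k: "k \<in> pos_gens" and u: "u = U_in (bas k) \<ominus>\<^bsub>UL\<^esub> (\<chi> (bas k) \<odot>\<^bsub>UL\<^esub> \<one>\<^bsub>UL\<^esub>)"
      by (auto simp: verma_gens_def)
    have kb: "bas k \<in> b_plus" using k by (simp add: b_plus_def)
    note cl = U_in_closed[of "bas k"] cmoduleD(1)[OF cmodule_UL UL_one_closed, of "\<chi> (bas k)"]
    have "?f u = ?f (U_in (bas k)) \<oplus>\<^bsub>Y\<^esub> (-1) \<odot>\<^bsub>Y\<^esub> (\<chi> (bas k) \<odot>\<^bsub>Y\<^esub> y)"
      unfolding u cmodule_minus[OF cmodule_UL cl]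
      by (simp add: L cl cmoduleD(1)[OF cmodule_UL] UL_one_closed U_act_one[OF Y U yc])
    also have "\<dots> = \<chi> (bas k) \<odot>\<^bsub>Y\<^esub> y \<ominus>\<^bsub>Y\<^esub> \<chi> (bas k) \<odot>\<^bsub>Y\<^esub> y"
      using yc hw[OF kb] by (simp add: U_act_in[OF Y] cmodule_minus[OF cY] cmoduleD(1)[OF cY])
    also have "\<dots> = \<zero>\<^bsub>Y\<^esub>" using yc by (simp add: Y.minus_eq Y.r_neg cmoduleD(1)[OF cY])
    finally show "u \<in> ?K" using verma_gens_sub \<open>u \<in> verma_gens\<close> by auto
  qed
  ultimately have IK: "I \<subseteq> ?K" unfolding verma_ideal_eq gen_left_ideal_def by blast
  obtain g where g: "clinear (quot_space UL I) Y g" and gv: "\<forall>u\<in>carrier UL. g (I +>\<^bsub>UL\<^esub> u) = ?f u"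
    using csubspace.quot_lift[OF csubspace_verma cY f] IK by blast
  have g': "clinear V Y g" using g by (simp add: verma_def)
  have gv': "g (vcls u) = ?f u" if "u \<in> carrier UL" for u using gv that by (simp add: vcls_def)
  have "lie_hom UNIV V Y g"
  proof (rule lie_homI[OF g'])
    fix x v assume "v \<in> carrier V"
    then obtain u where v: "v = vcls u" and u: "u \<in> carrier UL" unfolding carrier_verma by blast
    show "g (act V x v) = act Y x (g v)"
      unfolding v using u by (simp add: act_vcls gv' UL_mult_closed U_in_closed U_act_mult[OF Y U] yc U_act_in[OF Y] L(1))
  qed
  moreover have "g vac = y" by (simp add: vac_def gv' UL_one_closed U_act_one[OF Y U yc])
  ultimately show ?thesis by blast
qed

end

section \<open>Homomorphism modules\<close>

text \<open>
  The linear maps from \<open>M\<close> to \<open>X\<close>, with \<open>(x F)(w) = x (F w) - F (x w)\<close>.  Since elements are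
  functions on the whole type, this is a module when the carrier of \<open>M\<close> is the whole type.
\<close>

definition hom_mod :: "('v, 'm) lie_mod_scheme \<Rightarrow> ('w, 'n) lie_mod_scheme \<Rightarrow> ('v \<Rightarrow> 'w) lie_mod" where
  "hom_mod M X = \<lparr>carrier = {F. clinear M X F}, mult = undefined, one = undefined,
     zero = (\<lambda>_. \<zero>\<^bsub>X\<^esub>), add = (\<lambda>F G w. F w \<oplus>\<^bsub>X\<^esub> G w), smult = (\<lambda>c F w. c \<odot>\<^bsub>X\<^esub> F w),
     act = (\<lambda>x F w. act X x (F w) \<ominus>\<^bsub>X\<^esub> F (act M x w))\<rparr>"

text \<open>
  With \<open>a = x (y (F w))\<close>, \<open>b = y (x (F w))\<close>, \<open>c = F (x (y w))\<close>, \<open>d = F (y (x w))\<close>,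
  \<open>e = x (F (y w))\<close> and \<open>f = y (F (x w))\<close> this is the law for brackets in
  \<open>hom_mod M X\<close>.
\<close>

lemma (in abelian_group) commutator_identity:
  assumes "a \<in> carrier G" "b \<in> carrier G" "c \<in> carrier G" "d \<in> carrier G" "e \<in> carrier G" "f \<in> carrier G"
  shows "(a \<ominus> b) \<ominus> (c \<ominus> d) = ((a \<ominus> e) \<ominus> (f \<ominus> d)) \<ominus> ((b \<ominus> f) \<ominus> (e \<ominus> c))"
proof -
  have "((a \<ominus> e) \<ominus> (f \<ominus> d)) \<ominus> ((b \<ominus> f) \<ominus> (e \<ominus> c))
      = ((a \<ominus> b) \<ominus> (c \<ominus> d)) \<oplus> ((e \<oplus> \<ominus> e) \<oplus> (f \<oplus> \<ominus> f))"
    using assms by (simp only: minus_eq minus_add minus_minus a_ac a_closed a_inv_closed)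
  then show ?thesis using assms by (simp add: r_neg)
qed

lemma lie_module_hom_mod:
  assumes M: "lie_module UNIV M" and UNIV: "carrier M = UNIV" and X: "lie_module UNIV X"
  shows "lie_module UNIV (hom_mod M X)"
proof -
  note cX = cmodule_lie[OF X] and cM = cmodule_lie[OF M]
  interpret X: module complex_ring X by (rule cX)
  note aX = lie_module_act_clinear[OF X UNIV_I] and aM = lie_module_act_clinear[OF M UNIV_I]
  have F: "F w \<in> carrier X" if "clinear M X F" for F w
    using clinearD(1)[OF that] UNIV by simp
  have s: "carrier (hom_mod M X) = {F. clinear M X F}" "zero (hom_mod M X) = (\<lambda>_. \<zero>\<^bsub>X\<^esub>)"
    "add (hom_mod M X) = (\<lambda>F G w. F w \<oplus>\<^bsub>X\<^esub> G w)" "smult (hom_mod M X) = (\<lambda>c F w. c \<odot>\<^bsub>X\<^esub> F w)"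
    by (simp_all add: hom_mod_def)
  have zero: "clinear M X (\<lambda>_. \<zero>\<^bsub>X\<^esub>)"
    by (rule clinearI) (simp_all add: X.smult_r_null[of c for c, simplified])
  have cH: "cmodule (hom_mod M X)"
    by (rule cmoduleI)
      (auto simp: s zero F X.a_ac cmoduleD[OF cX] intro: clinear_add[OF cX] clinear_smult[OF cX])
  have act: "act (hom_mod M X) x F = (\<lambda>w. act X x (F w) \<ominus>\<^bsub>X\<^esub> F (act M x w))" for x F
    by (simp add: hom_mod_def)
  have actc: "clinear M X (\<lambda>w. act X x (F w) \<ominus>\<^bsub>X\<^esub> F (act M x w))" if "clinear M X F" for x F
    by (rule clinear_diff[OF cM cX clinear_compose[OF that aX] clinear_compose[OF aM that]])
  have aXc: "act X x v \<in> carrier X" if "v \<in> carrier X" for x v using clinearD(1)[OF aX that] .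
  have aXm: "act X x (v \<ominus>\<^bsub>X\<^esub> w) = act X x v \<ominus>\<^bsub>X\<^esub> act X x w" if "v \<in> carrier X" "w \<in> carrier X" for x v w
    using that by (simp add: cmodule_minus[OF cX] clinearD[OF aX] aXc cmoduleD(1)[OF cX])
  have Fm: "F (v \<ominus>\<^bsub>M\<^esub> w) = F v \<ominus>\<^bsub>X\<^esub> F w" if "clinear M X F" for F v w
    using that UNIV by (simp add: cmodule_minus[OF cX] cmodule_minus[OF cM] clinearD[OF that] F)
  have lin: "clinear (hom_mod M X) (hom_mod M X) (act (hom_mod M X) x)" for x
  proof (rule clinearI)
    show "act (hom_mod M X) x (F \<oplus>\<^bsub>hom_mod M X\<^esub> G) = act (hom_mod M X) x F \<oplus>\<^bsub>hom_mod M X\<^esub> act (hom_mod M X) x G"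
      if "F \<in> carrier (hom_mod M X)" "G \<in> carrier (hom_mod M X)" for F G
      using that by (auto simp: s act F clinearD[OF aX] X.minus_eq X.minus_add X.a_ac aXc)
    show "act (hom_mod M X) x (c \<odot>\<^bsub>hom_mod M X\<^esub> F) = c \<odot>\<^bsub>hom_mod M X\<^esub> act (hom_mod M X) x F"
      if "F \<in> carrier (hom_mod M X)" for c F
      using that
      by (auto simp: s act F clinearD[OF aX] cmodule_minus[OF cX] cmoduleD(1,3)[OF cX] aXc
          cmodule_smult_commute[OF cX, of _ c])
  qed (simp add: s act actc)
  show ?thesis
  proof (rule lie_module_generatedI[OF cH subset_refl _ lin])
    fix x y F c assume "F \<in> carrier (hom_mod M X)"
    then have F': "clinear M X F" by (simp add: s)
    note L = clinearD[OF F', unfolded UNIV, OF UNIV_I] clinearD(2)[OF F', unfolded UNIV, OF UNIV_I UNIV_I]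
    show "act (hom_mod M X) (x + y) F = act (hom_mod M X) x F \<oplus>\<^bsub>hom_mod M X\<^esub> act (hom_mod M X) y F"
      by (auto simp: s act F F' X.minus_eq X.minus_add X.a_ac aXc lie_module.add_act[OF X]
          lie_module.add_act[OF M] UNIV L)
    show "act (hom_mod M X) (scl c x) F = c \<odot>\<^bsub>hom_mod M X\<^esub> act (hom_mod M X) x F"
      by (auto simp: s act F F' cmodule_minus[OF cX] cmoduleD(1,3)[OF cX] aXc lie_module.smult_act[OF X]
          lie_module.smult_act[OF M] UNIV L cmodule_smult_commute[OF cX, of _ c])
    have minus: "G \<ominus>\<^bsub>hom_mod M X\<^esub> H = (\<lambda>w. G w \<ominus>\<^bsub>X\<^esub> H w)" if "clinear M X G" "clinear M X H" for G H
      using cmodule_minus[OF cH, of G H] that by (simp add: s cmodule_minus[OF cX] F)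
    show "act (hom_mod M X) (bracket x y) F = act (hom_mod M X) x (act (hom_mod M X) y F)
        \<ominus>\<^bsub>hom_mod M X\<^esub> act (hom_mod M X) y (act (hom_mod M X) x F)"
      unfolding act minus[OF actc[OF actc[OF F']] actc[OF actc[OF F']]]
      using X.commutator_identity
      by (auto simp: F F' aXc aXm Fm lie_module.bracket_act[OF X] lie_module.bracket_act[OF M] UNIV)
  qed auto
qed

section \<open>Tensor products with a Verma module\<close>

locale tensor_verma = verma_module +
  fixes M :: "('v, 'm) lie_mod_scheme"
  assumes lie_M: "lie_module UNIV M" and UNIV_M: "carrier M = UNIV"
begin

sublocale L: lie_tensor_product M V
  by (rule lie_tensor_product.intro[OF lie_M lie_module_verma])

abbreviation "MV \<equiv> lie_tensor M V"

text \<open>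
  The tensor with the canonical generator of the Verma module.
\<close>

definition inc :: "'v \<Rightarrow> ('v \<times> free_alg set set \<Rightarrow>\<^sub>0 complex) set" where
  "inc w = L.T.pt w vac"

lemma vac_closed: "vac \<in> carrier V"
  using vac_highest_weight by (simp add: highest_weight_vector_def)

lemma inc_clinear: "clinear M MV inc"
  using L.pt_clinear(2)[OF vac_closed] by (simp add: inc_def[abs_def])

lemma inc_act:
  assumes "x \<in> b_plus"
  shows "act MV x (inc w) = inc (act M x w) \<oplus>\<^bsub>MV\<^esub> \<chi> x \<odot>\<^bsub>MV\<^esub> inc w"
proof -
  have "act V x vac = \<chi> x \<odot>\<^bsub>V\<^esub> vac"
    using vac_highest_weight assms by (simp add: highest_weight_vector_def)
  then have "act MV x (inc w) = L.T.pt (act M x w) vac \<oplus>\<^bsub>L.T.Q\<^esub> L.T.pt w (\<chi> x \<odot>\<^bsub>V\<^esub> vac)"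
    using L.act_pt[of w vac x] vac_closed UNIV_M by (simp add: inc_def)
  also have "L.T.pt w (\<chi> x \<odot>\<^bsub>V\<^esub> vac) = \<chi> x \<odot>\<^bsub>L.T.Q\<^esub> L.T.pt w vac"
    using clinearD(3)[OF L.pt_clinear(1) vac_closed] UNIV_M by blast
  finally show ?thesis by (simp add: inc_def)
qed

text \<open>
  The adjunction between tensor product and homomorphism modules, followed by the universal property
  of the Verma module: homomorphisms from \<open>M \<otimes> V\<close> to \<open>X\<close> correspond to highest weight vectors
  in \<open>hom_mod M X\<close>.  The latter are the linear maps \<open>F\<close> that commute with \<open>b_plus\<close> when its action
  on \<open>M\<close> is twisted by the character.
\<close>

lemma hom_lift:
  assumes X: "lie_module UNIV X" and F: "clinear M X F"
    and hw: "\<And>x w. x \<in> b_plus \<Longrightarrow> act X x (F w) = F (act M x w) \<oplus>\<^bsub>X\<^esub> \<chi> x \<odot>\<^bsub>X\<^esub> F w"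
  shows "\<exists>\<psi>. lie_hom UNIV MV X \<psi> \<and> (\<forall>w. \<psi> (inc w) = F w)"
proof -
  let ?H = "hom_mod M X"
  note H = lie_module_hom_mod[OF lie_M UNIV_M X] and cX = cmodule_lie[OF X]
  interpret X: module complex_ring X by (rule cX)
  have Fc: "G w \<in> carrier X" if "clinear M X G" for G w
    using clinearD(1)[OF that] UNIV_M by simp
  have sub: "(p \<oplus>\<^bsub>X\<^esub> q) \<ominus>\<^bsub>X\<^esub> p = q" "p \<oplus>\<^bsub>X\<^esub> (q \<ominus>\<^bsub>X\<^esub> p) = q" if "p \<in> carrier X" "q \<in> carrier X" for p q
    using that X.a_comm[of p q] X.a_lcomm[of p q "\<ominus>\<^bsub>X\<^esub> p"]
    by (simp_all add: X.minus_eq X.a_assoc X.r_neg)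
  have "highest_weight_vector ?H F"
    unfolding highest_weight_vector_def
    by (simp add: hom_mod_def F hw sub Fc cmoduleD(1)[OF cX])
  then obtain g where g: "lie_hom UNIV V ?H g" and gvac: "g vac = F"
    using verma_hom_lift[OF H] by blast
  have gv: "clinear M X (g v)" if "v \<in> carrier V" for v
    using lie_homD(3)[OF g that] by (simp add: hom_mod_def)
  note gL = clinearD[OF lie_homD(1)[OF g]]
  let ?\<beta> = "\<lambda>w v. g v w"
  have "L.T.balanced X ?\<beta>"
  proof (rule L.T.balancedI)
    show "clinear V X (\<lambda>v. g v w)" for w
      by (rule clinearI) (simp_all add: gL Fc gv hom_mod_def)
    show "clinear M X (g v)" if "v \<in> carrier V" for v by (rule gv[OF that])
    fix w c v assume "v \<in> carrier V"
    then show "g v (c \<odot>\<^bsub>M\<^esub> w) = g (c \<odot>\<^bsub>V\<^esub> v) w"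
      using clinearD(3)[OF gv, of v w c] UNIV_M by (simp add: gL(3) hom_mod_def)
  qed
  moreover have "act X x (g v w) = g v (act M x w) \<oplus>\<^bsub>X\<^esub> g (act V x v) w" if v: "v \<in> carrier V" for x v w
  proof -
    have "g (act V x v) w = act X x (g v w) \<ominus>\<^bsub>X\<^esub> g v (act M x w)"
      using lie_homD(2)[OF g UNIV_I v, of x] by (simp add: hom_mod_def)
    then show ?thesis
      using sub(2) Fc[OF gv[OF v]] lie_module.act_closed[OF X] by simp
  qed
  ultimately obtain \<phi> where "lie_hom UNIV MV X \<phi>" "\<And>w v. v \<in> carrier V \<Longrightarrow> \<phi> (L.T.pt w v) = g v w"
    using L.tensor_hom_lift[OF X] UNIV_M by (metis UNIV_I)
  then show ?thesis using gvac vac_closed by (intro exI[of _ \<phi>]) (simp add: inc_def)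
qed

text \<open>
  The tensor product is generated by the image of \<open>inc\<close>: from \<open>w \<otimes> x v = x (w \<otimes> v) - x w \<otimes> v\<close>
  one reaches all \<open>w \<otimes> u vac\<close> by induction on \<open>u\<close>, for all \<open>w\<close> at once.
\<close>

lemma hom_eqI:
  assumes X: "lie_module UNIV X" and f: "lie_hom UNIV MV X f" and g: "lie_hom UNIV MV X g"
    and eq: "\<And>w. f (inc w) = g (inc w)" and z: "z \<in> carrier MV"
  shows "f z = g z"
proof (rule L.T.clinear_eqI[OF cmodule_lie[OF X]])
  interpret X: module complex_ring X by (rule cmodule_lie[OF X])
  show lin: "clinear L.T.Q X f" "clinear L.T.Q X g"
    using lie_homD(1)[OF f] lie_homD(1)[OF g] by simp_all
  show "z \<in> carrier L.T.Q" using z by simp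
  fix w v assume "v \<in> carrier V"
  then obtain u where v: "v = vcls u" and u: "u \<in> carrier UL" unfolding carrier_verma by blast
  have pc: "L.T.pt w (vcls u) \<in> carrier L.T.Q" if "u \<in> carrier UL" for u w
    using that UNIV_M clinearD(1)[OF vcls_clinear] by (intro L.T.pt_closed) auto
  have fc: "f (L.T.pt w (vcls u)) \<in> carrier X" "g (L.T.pt w (vcls u)) \<in> carrier X" if "u \<in> carrier UL" for u w
    using pc[OF that] clinearD(1)[OF lin(1)] clinearD(1)[OF lin(2)] by blast+
  have p: "clinear V L.T.Q (L.T.pt w)" for w
    by (rule L.pt_clinear(1)) (simp add: UNIV_M)
  note pv = clinear_compose[OF vcls_clinear p]
  from u show "f (L.T.pt w v) = g (L.T.pt w v)"
    unfolding v
  proof (induction u arbitrary: w rule: UL_induct)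
    case one
    show ?case using eq[of w] by (simp add: inc_def vac_def)
  next
    case (mult x u)
    let ?p = "L.T.pt w (vcls u)" and ?q = "L.T.pt (act M x w) (vcls u)"
      and ?r = "L.T.pt w (vcls (U_in x \<otimes>\<^bsub>UL\<^esub> u))"
    have r: "U_in x \<otimes>\<^bsub>UL\<^esub> u \<in> carrier UL" using mult by (intro UL_mult_closed U_in_closed)
    have a: "act MV x ?p = ?q \<oplus>\<^bsub>L.T.Q\<^esub> ?r"
      using L.act_pt[of w "vcls u" x] clinearD(1)[OF vcls_clinear] mult UNIV_M by (simp add: act_vcls)
    have p': "?p \<in> carrier MV" using pc[OF mult(1)] by simp
    have "f (act MV x ?p) = g (act MV x ?p)"
      using lie_homD(2)[OF f UNIV_I p'] lie_homD(2)[OF g UNIV_I p'] mult by simp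
    then have "f ?q \<oplus>\<^bsub>X\<^esub> f ?r = f ?q \<oplus>\<^bsub>X\<^esub> g ?r"
      using mult(2)[of "act M x w"]
      by (simp add: a clinearD(2)[OF lin(1)] clinearD(2)[OF lin(2)] pc mult(1) r)
    then show ?case using fc[OF mult(1)] fc[OF r] by (metis X.r_neg1)
  next
    case (add u v)
    then show ?case
      by (simp add: clinearD(2)[OF pv] clinearD(2)[OF lin(1)] clinearD(2)[OF lin(2)] pc)
  next
    case (smult c u)
    then show ?case
      by (simp add: clinearD(3)[OF pv] clinearD(3)[OF lin(1)] clinearD(3)[OF lin(2)] pc)
  qed
qed

end

section \<open>Linear functionals and subalgebras\<close>

definition lfun :: "('a \<Rightarrow> complex) \<Rightarrow> ('a \<Rightarrow>\<^sub>0 complex) \<Rightarrow> complex" where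
  "lfun c x = (\<Sum>k\<in>Poly_Mapping.keys x. Poly_Mapping.lookup x k * c k)"

lemma lfun_superset:
  "\<lbrakk>finite A; Poly_Mapping.keys x \<subseteq> A\<rbrakk> \<Longrightarrow> lfun c x = (\<Sum>k\<in>A. Poly_Mapping.lookup x k * c k)"
  unfolding lfun_def by (rule sum.mono_neutral_left) (auto simp: in_keys_iff)

lemma lfun_add: "lfun c (x + y) = lfun c x + lfun c y"
proof -
  let ?A = "Poly_Mapping.keys x \<union> Poly_Mapping.keys y"
  have "lfun c (x + y) = (\<Sum>k\<in>?A. Poly_Mapping.lookup (x + y) k * c k)"
    by (rule lfun_superset[OF _ keys_add]) simp
  also have "\<dots> = lfun c x + lfun c y"
    using lfun_superset[of ?A x c] lfun_superset[of ?A y c]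
    by (simp add: lookup_add distrib_right sum.distrib)
  finally show ?thesis .
qed

lemma lfun_scl: "lfun c (scl d x) = d * lfun c x"
  using lfun_superset[of "Poly_Mapping.keys x" "scl d x" c] keys_scl[of d x]
  by (simp add: lfun_def sum_distrib_left mult.assoc)

lemma lfun_bas [simp]: "lfun c (bas k) = c k"
  by (simp add: lfun_def)

lemma lfun_zero [simp]: "lfun c 0 = 0"
  by (simp add: lfun_def)

lemma lfun_uminus: "lfun c (- x) = - lfun c x"
  using lfun_scl[of c "-1" x] by simp

lemma lfun_minus: "lfun c (x - y) = lfun c x - lfun c y"
  using lfun_add[of c x "- y"] by (simp add: lfun_uminus)

lemma bracket_add_left: "bracket (x + x') y = bracket x y + bracket x' y"
  by (simp add: bracket_def lin_ext_add)

lemma bracket_scl_left: "bracket (scl c x) y = scl c (bracket x y)"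
  by (simp add: bracket_def lin_ext_scl)

lemma bracket_add_right: "bracket x (y + y') = bracket x y + bracket x y'"
  by (simp add: bracket_def lin_ext_add) (simp add: lin_ext_def fvs.scale_right_distrib sum.distrib)

lemma bracket_scl_right: "bracket x (scl c y) = scl c (bracket x y)"
  by (simp add: bracket_def lin_ext_scl)
    (simp add: lin_ext_def fvs.scale_sum_right mult.left_commute)

lemma bracket_zero [simp]: "bracket 0 y = 0" "bracket x 0 = 0"
  by (simp_all add: bracket_def lin_ext_def)

lemmas bracket_linear = bracket_add_left bracket_scl_left bracket_add_right bracket_scl_right

text \<open>
  Bilinear statements only need to be checked on pairs of basis vectors.
\<close>

lemma bilinear_induct:
  assumes x: "Poly_Mapping.keys x \<subseteq> S" and y: "Poly_Mapping.keys y \<subseteq> T"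
    and zero: "\<And>y. P 0 y" "\<And>x. P x 0"
    and add: "\<And>x x' y. P x y \<Longrightarrow> P x' y \<Longrightarrow> P (x + x') y" "\<And>x y y'. P x y \<Longrightarrow> P x y' \<Longrightarrow> P x (y + y')"
    and scl: "\<And>c x y. P x y \<Longrightarrow> P (scl c x) y" "\<And>c x y. P x y \<Longrightarrow> P x (scl c y)"
    and bas: "\<And>a b. a \<in> S \<Longrightarrow> b \<in> T \<Longrightarrow> P (bas a) (bas b)"
  shows "P x y"
  using x
proof (induction x rule: free_space_induct)
  case (bas a)
  show ?case
    using y
  proof (induction y rule: free_space_induct)
    case (bas b)
    show ?case by (rule assms(9)[OF \<open>a \<in> S\<close> bas])
  next
    case (add p q)
    show ?case by (rule assms(6)[OF add(3,4)])
  next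
    case (scl c p)
    show ?case by (rule assms(8)[OF scl(2)])
  qed (rule zero)
next
  case (add p q)
  show ?case by (rule assms(5)[OF add(3,4)])
next
  case (scl c p)
  show ?case by (rule assms(7)[OF scl(2)])
qed (rule zero)

lemma b_plus_iff: "x \<in> b_plus \<longleftrightarrow> (\<forall>k. k \<notin> pos_gens \<longrightarrow> Poly_Mapping.lookup x k = 0)"
  by (auto simp: b_plus_def in_keys_iff)

lemma b_plus_bracket:
  assumes "x \<in> b_plus" "y \<in> b_plus"
  shows "bracket x y \<in> b_plus"
proof (rule bilinear_induct[of x pos_gens y pos_gens])
  fix a b assume "a \<in> pos_gens" "b \<in> pos_gens"
  then show "bracket (bas a) (bas b) \<in> b_plus"
    by (cases a; cases b)
      (auto simp: b_plus_iff pos_gens_def lookup_add lookup_minus lookup_single when_def)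
qed (use assms in \<open>auto simp: b_plus_def bracket_linear keys_sub\<close>)

text \<open>
  The bracket of elements of \<open>b_plus\<close> has no component along \<open>d\<^sub>0\<close>, \<open>h\<^sub>0\<close> or \<open>C\<close>: such
  components need indices with sum zero, hence both zero, and there the structure constants vanish.
  So the weight is a character of \<open>b_plus\<close>.
\<close>

lemma weight_bracket:
  assumes "x \<in> b_plus" "y \<in> b_plus"
  shows "weight \<eta> \<epsilon> \<theta> (bracket x y) = 0"
proof (rule bilinear_induct[of x pos_gens y pos_gens])
  fix a b assume "a \<in> pos_gens" "b \<in> pos_gens"
  then show "weight \<eta> \<epsilon> \<theta> (bracket (bas a) (bas b)) = 0"
    by (cases a; cases b)
      (auto simp: weight_def pos_gens_def lookup_add lookup_minus lookup_single when_def
        add_nonneg_eq_0_iff)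
qed (use assms in \<open>auto simp: b_plus_def bracket_linear weight_add weight_scl\<close>,
    simp_all add: weight_def)

text \<open>
  Identify the Witt part of an element with the Laurent polynomial in which \<open>d\<^sub>m\<close> is the \<open>m\<close>-th
  power.  Then \<open>d_eval lam\<close> is its value at \<open>lam\<close> and \<open>d_eval_deriv lam\<close> the value of its image
  under the Euler operator.
\<close>

definition d_eval :: "complex \<Rightarrow> affvir \<Rightarrow> complex" where
  "d_eval lam = lfun (\<lambda>k. case k of Dg m \<Rightarrow> lam powi m | _ \<Rightarrow> 0)"

definition d_eval_deriv :: "complex \<Rightarrow> affvir \<Rightarrow> complex" where
  "d_eval_deriv lam = lfun (\<lambda>k. case k of Dg m \<Rightarrow> of_int m * lam powi m | _ \<Rightarrow> 0)"

lemmas d_eval_linear = lfun_add[of "\<lambda>k. case k of Dg m \<Rightarrow> lam powi m | _ \<Rightarrow> 0" for lam, folded d_eval_def]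
  lfun_scl[of "\<lambda>k. case k of Dg m \<Rightarrow> lam powi m | _ \<Rightarrow> 0" for lam, folded d_eval_def]
  lfun_add[of "\<lambda>k. case k of Dg m \<Rightarrow> of_int m * lam powi m | _ \<Rightarrow> 0" for lam, folded d_eval_deriv_def]
  lfun_scl[of "\<lambda>k. case k of Dg m \<Rightarrow> of_int m * lam powi m | _ \<Rightarrow> 0" for lam, folded d_eval_deriv_def]

text \<open>
  The bracket of the Witt algebra is the Wronskian \<open>p q' - p' q\<close> with respect to the Euler
  operator.  Hence the vector fields that vanish at \<open>lam\<close> form a subalgebra.
\<close>

lemma d_eval_bracket:
  assumes "lam \<noteq> 0"
  shows "d_eval lam (bracket x y) = d_eval lam x * d_eval_deriv lam y - d_eval_deriv lam x * d_eval lam y"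
proof (rule bilinear_induct[of x UNIV y UNIV])
  fix a b :: gen
  show "d_eval lam (bracket (bas a) (bas b)) = d_eval lam (bas a) * d_eval_deriv lam (bas b) - d_eval_deriv lam (bas a) * d_eval lam (bas b)"
    using assms by (cases a; cases b)
      (simp_all add: d_eval_def d_eval_deriv_def lfun_add lfun_uminus lfun_minus lfun_scl power_int_add algebra_simps)
next
  fix c x y assume eq: "d_eval lam (bracket x y) = d_eval lam x * d_eval_deriv lam y - d_eval_deriv lam x * d_eval lam y"
  show "d_eval lam (bracket (scl c x) y) = d_eval lam (scl c x) * d_eval_deriv lam y - d_eval_deriv lam (scl c x) * d_eval lam y"
    "d_eval lam (bracket x (scl c y)) = d_eval lam x * d_eval_deriv lam (scl c y) - d_eval_deriv lam x * d_eval lam (scl c y)"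
    unfolding bracket_linear d_eval_linear eq by (simp_all add: algebra_simps)
qed (simp_all add: bracket_linear d_eval_linear algebra_simps, simp_all add: d_eval_def d_eval_deriv_def)

text \<open>
  Along \<open>d\<^sub>0\<close>, every element of \<open>b_plus\<close> projects to \<open>b_sub lam\<close>; so \<open>b_sub lam\<close> has codimension
  one in \<open>b_plus\<close>.
\<close>

lemma b_sub_approx:
  assumes "x \<in> b_plus"
  shows "x - scl (d_eval lam x) (dL 0) \<in> b_sub lam"
  using assms unfolding b_plus_def mem_Collect_eq
proof (induction x rule: free_space_induct)
  case zero
  show ?case by (simp add: d_eval_def b_sub_def fvs.span_zero)
next
  case (bas k)
  let ?G = "{dL (int m) - scl (lam ^ m) (dL 0) |m. m \<ge> 1} \<union> {fL (int m) |m. m \<ge> 1}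
       \<union> {hL (int n) |n. True} \<union> {eL (int n) |n. True} \<union> {cL}"
  have nat: "\<exists>n. i = int n" if "i \<ge> 0" for i using that by (intro exI[of _ "nat i"]) simp
  from bas have "(\<exists>i\<ge>0. k = Eg i) \<or> (\<exists>i\<ge>1. k = Fg i) \<or> (\<exists>i\<ge>0. k = Hg i) \<or> (\<exists>i\<ge>0. k = Dg i) \<or> k = Cg"
    by (auto simp: pos_gens_def)
  then consider (E) n where "k = Eg (int n)" | (F) n where "k = Fg (int n)" "n \<ge> 1"
    | (H) n where "k = Hg (int n)" | (D) n where "k = Dg (int n)" | (C) "k = Cg"
  proof (elim disjE exE conjE)
    fix i :: int assume "1 \<le> i" "k = Fg i"
    then show thesis using that(2)[of "nat i"] by simp
  qed (use nat that in \<open>metis+\<close>)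
  then have "bas k - scl (d_eval lam (bas k)) (dL 0) = 0 \<or> bas k - scl (d_eval lam (bas k)) (dL 0) \<in> ?G"
  proof cases
    case D
    then show ?thesis by (cases "n = 0") (auto simp: d_eval_def)
  qed (auto simp: d_eval_def)
  then have "bas k - scl (d_eval lam (bas k)) (dL 0) \<in> fvs.span ?G"
  proof (elim disjE)
    assume "bas k - scl (d_eval lam (bas k)) (dL 0) = 0"
    then show ?thesis by (simp only: fvs.span_zero)
  qed (rule fvs.span_base)
  then show ?case by (simp only: b_sub_def)
next
  case (add p q)
  have eq: "p + q - scl (d_eval lam (p + q)) (dL 0) = (p - scl (d_eval lam p) (dL 0)) + (q - scl (d_eval lam q) (dL 0))"
    by (simp add: d_eval_linear fvs.scale_left_distrib)
  show ?case unfolding eq using add(3,4) unfolding b_sub_def by (rule fvs.span_add)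
next
  case (scl c p)
  have eq: "scl c p - scl (d_eval lam (scl c p)) (dL 0) = scl c (p - scl (d_eval lam p) (dL 0))"
    by (simp add: d_eval_linear fvs.scale_right_diff_distrib)
  show ?case unfolding eq using scl(2) unfolding b_sub_def by (rule fvs.span_scale)
qed

text \<open>
  The subalgebra \<open>b_sub lam\<close> is the kernel of the evaluation, which makes closure under the bracket
  visible without a case distinction on its spanning set.
\<close>

lemma b_sub_eq: "b_sub lam = {x \<in> b_plus. d_eval lam x = 0}"
proof
  show "b_sub lam \<subseteq> {x \<in> b_plus. d_eval lam x = 0}"
    unfolding b_sub_def
  proof (rule fvs.span_minimal)
    show "fvs.subspace {x \<in> b_plus. d_eval lam x = 0}"
      by (rule fvs.subspaceI) (auto simp: b_plus_def d_eval_linear keys_sub, simp add: d_eval_def)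
  qed (auto simp: d_eval_def lfun_minus lfun_scl b_plus_iff pos_gens_def lookup_minus lookup_single when_def)
  show "{x \<in> b_plus. d_eval lam x = 0} \<subseteq> b_sub lam"
    using b_sub_approx[of _ lam] by fastforce
qed

lemma lie_subalgebra_b_sub: "lam \<noteq> 0 \<Longrightarrow> lie_subalgebra (b_sub lam)"
  by (auto simp: lie_subalgebra_def b_sub_eq b_plus_bracket d_eval_bracket d_eval_linear)
    (auto simp: b_plus_def keys_sub)

section \<open>Modules given on basis vectors\<close>

lemma bracket_clinear:
  "clinear (free_space UNIV) (free_space UNIV) (\<lambda>x. bracket x y)"
  "clinear (free_space UNIV) (free_space UNIV) (\<lambda>y. bracket x y)"
  by (rule clinearI; simp add: bracket_linear)+

text \<open>
  The bracket law is bilinear in the two Lie algebra elements.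
\<close>

lemma lie_module_from_basis:
  assumes M: "cmodule M" and a: "\<And>k. clinear M M (a k)"
    and act: "\<And>x v. v \<in> carrier M \<Longrightarrow> act M x v = lext M (\<lambda>k. a k v) x"
    and br: "\<And>k l v. v \<in> carrier M \<Longrightarrow> act M (gen_bracket k l) v = a k (a l v) \<ominus>\<^bsub>M\<^esub> a l (a k v)"
  shows "lie_module UNIV M"
proof -
  have x_lin: "clinear (free_space UNIV) M (\<lambda>x. act M x v)" if v: "v \<in> carrier M" for v
    unfolding act[OF v] by (rule clinear_lext[OF M clinearD(1)[OF a v]])
  have bas: "act M (bas k) v = a k v" if v: "v \<in> carrier M" for k v
    unfolding act[OF v] by (rule lext_bas[OF M clinearD(1)[OF a v] UNIV_I])
  note X = clinearD[OF x_lin, simplified]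
  have v_lin: "clinear M M (act M x)" for x
  proof -
    have "Poly_Mapping.keys x \<subseteq> UNIV" by simp
    then show ?thesis
    proof (induction x rule: free_space_induct)
      case zero
      show ?case
        using clinear_smult[OF M a, of "0" "Cg"] 
        by (subst clinear_cong[OF M, of _ "\<lambda>v. 0 \<odot>\<^bsub>M\<^esub> a Cg v"])
          (use X(3)[of _ 0 "bas Cg"] bas in auto)
    next
      case (bas k)
      show ?case by (subst clinear_cong[OF M \<open>\<And>v k. v \<in> carrier M \<Longrightarrow> act M (bas k) v = a k v\<close>]) (use a in auto)
    next
      case (add p q)
      then show ?case by (subst clinear_cong[OF M X(2)]) (auto intro: clinear_add[OF M])
    next
      case (scl c p)
      then show ?case by (subst clinear_cong[OF M X(3)]) (auto intro: clinear_smult[OF M])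
    qed
  qed
  show ?thesis
  proof (rule lie_module_generatedI[OF M subset_refl _ v_lin])
    fix x y v c assume v: "v \<in> carrier M"
    show "act M (x + y) v = act M x v \<oplus>\<^bsub>M\<^esub> act M y v" by (rule X(2)[OF v])
    show "act M (scl c x) v = c \<odot>\<^bsub>M\<^esub> act M x v" by (rule X(3)[OF v])
    note vc = clinearD(1)[OF v_lin v]
    have basis: "act M (bracket (bas k) y) v = act M (bas k) (act M y v) \<ominus>\<^bsub>M\<^esub> act M y (act M (bas k) v)" for k
      by (rule free_space_clinear_eqI[OF M clinear_compose[OF bracket_clinear(2) x_lin[OF v]]
          clinear_diff[OF cmodule_free_space M clinear_compose[OF x_lin[OF v] v_lin] x_lin[OF vc]]])
        (simp_all add: v vc bas br clinearD(1)[OF a v])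
    show "act M (bracket x y) v = act M x (act M y v) \<ominus>\<^bsub>M\<^esub> act M y (act M x v)"
      by (rule free_space_clinear_eqI[OF M clinear_compose[OF bracket_clinear(1) x_lin[OF v]]
          clinear_diff[OF cmodule_free_space M x_lin[OF vc] clinear_compose[OF x_lin[OF v] v_lin]] basis])
        simp_all
  qed auto
qed

section \<open>The polynomial modules\<close>

subsection \<open>Evaluation of polynomials in two variables\<close>

definition ev :: "poly_st \<Rightarrow> complex \<Rightarrow> complex \<Rightarrow> complex" where
  "ev g x y = poly (poly g [:x:]) y"

lemma ev_simps [simp]:
  "ev (g + h) x y = ev g x y + ev h x y" "ev (g - h) x y = ev g x y - ev h x y"
  "ev (- g) x y = - ev g x y" "ev (g * h) x y = ev g x y * ev h x y" "ev 0 x y = 0"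
  "ev (in_t p) x y = poly p y" "ev s_var x y = x"
  "ev (shift2 a b g) x y = ev g (x - a) (y + b)"
  by (simp_all add: ev_def in_t_def s_var_def poly_shift2)

text \<open>
  Polynomials in two variables over an infinite field are determined by their values.  This reduces
  identities between the operators on \<open>\<complex>[s,t]\<close> to identities between numbers.
\<close>

lemma ev_eqI:
  assumes "\<And>x y. ev g x y = ev h x y"
  shows "g = h"
proof -
  have "ev k = ev 0 \<Longrightarrow> k = 0" for k
  proof (rule ccontr)
    assume ev: "ev k = ev 0" and "k \<noteq> 0"
    then have fin: "finite {p. poly k p = 0}" by (rule_tac poly_roots_finite)
    have "poly k [:x:] = 0" for x
    proof (rule poly_eq_poly_eq_iff[THEN iffD1], rule ext)
      fix y show "poly (poly k [:x:]) y = poly 0 y"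
        using fun_cong[OF fun_cong[OF ev, of x], of y] by (simp add: ev_def)
    qed
    then have "range (\<lambda>x. [:x::complex:]) \<subseteq> {p. poly k p = 0}" by auto
    then have "finite (range (\<lambda>x. [:x::complex:]))" using fin finite_subset by blast
    moreover have "inj (\<lambda>x. [:x::complex:])" by (rule injI) simp
    ultimately show False using finite_imageD[of "\<lambda>x. [:x::complex:]" UNIV] infinite_UNIV_char_0[where 'a = complex] by blast
  qed
  from this[of "g - h"] show ?thesis using assms by (simp add: fun_eq_iff)
qed

lemma in_t_hom: "in_t (p * q) = in_t p * in_t q" "in_t (p + q) = in_t p + in_t q" "in_t 0 = 0"
  by (simp_all add: in_t_def)

lemma in_t_const:
  "in_t [:a + b:] = in_t [:a:] + in_t [:b:]" "in_t [:a * b:] = in_t [:a:] * in_t [:b:]"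
  "in_t [:- a:] = - in_t [:a:]" "in_t [:1:] = 1" "in_t 0 = 0"
  "in_t (Polynomial.smult c p) = in_t [:c:] * in_t p"
  by (simp_all add: in_t_def one_pCons)

lemma in_t_eq_iff [simp]: "in_t p = in_t q \<longleftrightarrow> p = q"
  by (simp add: in_t_def)

subsection \<open>Modules with underlying space a type of polynomials\<close>

lemma minus_eq_type_minus:
  fixes M :: "(complex, 'a::ab_group_add, 'm) module_scheme"
  assumes "cmodule M" "carrier M = UNIV" "add M = (+)" "zero M = 0"
  shows "v \<ominus>\<^bsub>M\<^esub> w = v - w"
proof -
  interpret M: module complex_ring M by fact
  have "\<ominus>\<^bsub>M\<^esub> w = - w" by (rule M.minus_equality) (use assms in auto)
  then show ?thesis by (simp add: M.minus_eq assms)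
qed

text \<open>
  A common form of the three families: \<open>e\<^sub>i\<close> acts by \<open>lam\<^sup>i A(t) g(s - i, t - 2)\<close> and \<open>f\<^sub>i\<close> by
  \<open>lam\<^sup>i B(t) g(s - i, t + 2)\<close>.  The condition on \<open>A\<close> and \<open>B\<close> is the relation
  \<open>[e\<^sub>i, f\<^sub>j] = h\<^bsub>i+j\<^esub>\<close>, the only one that involves them both.
\<close>

locale polynomial_modules = verma_module \<eta> \<epsilon> \<theta> for \<eta> \<epsilon> \<theta> :: complex +
  fixes lam \<gamma> :: complex and A B :: poly_t
  assumes lam: "lam \<noteq> 0"
    and AB: "\<And>y. poly A y * poly B (y - 2) - poly B y * poly A (y + 2) = y"
begin

definition "eS i g = in_t ([:lam powi i:] * A) * shift2 (of_int i) (-2) g"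
definition "fS i g = in_t ([:lam powi i:] * B) * shift2 (of_int i) 2 g"
definition "eN i g = [:lam powi i:] * A * shift1 (-2) g"
definition "fN i g = [:lam powi i:] * B * shift1 2 g"

abbreviation "S \<equiv> st_module lam \<gamma> eS fS"
abbreviation "N \<equiv> t_module lam \<gamma> \<eta> \<epsilon> \<theta> eN fN"
abbreviation "aS \<equiv> st_act lam \<gamma> eS fS"
abbreviation "aN \<equiv> t_act lam \<gamma> \<eta> \<epsilon> \<theta> eN fN"

lemma S_simps [simp]:
  "carrier S = UNIV" "zero S = 0" "add S = (+)" "Module.smult S = (\<lambda>c g. in_t [:c:] * g)"
  by (simp_all add: st_module_def)

lemma N_simps [simp]:
  "carrier N = UNIV" "zero N = 0" "add N = (+)" "Module.smult N = (\<lambda>c g. [:c:] * g)"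
  by (simp_all add: t_module_def)

lemma cmodule_S: "cmodule S"
  by (rule cmoduleI) (simp_all add: in_t_const algebra_simps)

lemma cmodule_N: "cmodule N"
  by (rule cmoduleI) (simp_all add: algebra_simps smult_add_left smult_add_right)

lemmas S_minus = minus_eq_type_minus[OF cmodule_S S_simps(1,3,2)]
lemmas N_minus = minus_eq_type_minus[OF cmodule_N N_simps(1,3,2)]

lemma act_S_lext: "act S x g = lext S (\<lambda>k. aS k g) x"
proof -
  have "lext S (\<lambda>k. aS k g) x = (\<Sum>k\<in>Poly_Mapping.keys x. in_t [:Poly_Mapping.lookup x k:] * aS k g)"
    unfolding lext_def
    by (subst finsum_eq_sum) (simp_all add: module.axioms(2)[OF cmodule_S])
  then show ?thesis by (simp add: st_module_def)
qed

lemma act_N_lext: "act N x g = lext N (\<lambda>k. aN k g) x"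
proof -
  have "lext N (\<lambda>k. aN k g) x = (\<Sum>k\<in>Poly_Mapping.keys x. [:Poly_Mapping.lookup x k:] * aN k g)"
    unfolding lext_def
    by (subst finsum_eq_sum) (simp_all add: module.axioms(2)[OF cmodule_N])
  then show ?thesis by (simp add: t_module_def)
qed

lemma act_S_bas: "act S (bas k) g = aS k g"
  unfolding act_S_lext by (rule lext_bas[OF cmodule_S, of UNIV]) simp_all

lemma act_N_bas: "act N (bas k) g = aN k g"
  unfolding act_N_lext by (rule lext_bas[OF cmodule_N, of UNIV]) simp_all

lemma
  shows act_S_add: "act S (x + y) g = act S x g + act S y g"
    and act_S_scl: "act S (scl c x) g = in_t [:c:] * act S x g"
  unfolding act_S_lext
  using clinearD(2,3)[OF clinear_lext[OF cmodule_S, of UNIV "\<lambda>k. aS k g"], simplified] by auto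

lemma
  shows act_N_add: "act N (x + y) n = act N x n + act N y n"
    and act_N_scl: "act N (scl c x) n = [:c:] * act N x n"
  unfolding act_N_lext
  using clinearD(2,3)[OF clinear_lext[OF cmodule_N, of UNIV "\<lambda>k. aN k n"], simplified] by auto

lemma act_S_zero: "act S 0 g = 0"
  by (simp add: st_module_def)

lemma act_N_zero: "act N 0 g = 0"
  by (simp add: t_module_def)

lemma act_S_uminus: "act S (- x) g = - act S x g"
  using act_S_scl[of "-1" x g] by (simp add: in_t_const)

lemma act_S_diff: "act S (x - y) g = act S x g - act S y g"
  using act_S_add[of x "- y" g] by (simp add: act_S_uminus)

lemma aS_clinear: "clinear S S (aS k)"
  by (cases k; intro clinearI ev_eqI) (simp_all add: eS_def fS_def algebra_simps)

lemma aS_bracket: "act S (gen_bracket k l) g = aS k (aS l g) - aS l (aS k g)"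
proof (rule ev_eqI)
  fix x y
  note s = act_S_add act_S_scl act_S_uminus act_S_diff act_S_zero act_S_bas eS_def fS_def power_int_add lam
  show "ev (act S (gen_bracket k l) g) x y = ev (aS k (aS l g) - aS l (aS k g)) x y"
  proof (cases "(\<exists>i. k = Eg i) \<and> (\<exists>j. l = Fg j) \<or> (\<exists>i. k = Fg i) \<and> (\<exists>j. l = Eg j)")
    case True
    then consider (EF) i j where "k = Eg i" "l = Fg j" | (FE) i j where "k = Fg i" "l = Eg j" by blast
    then show ?thesis
    proof cases
      case EF
      have "ev (act S (gen_bracket k l) g) x y = lam powi i * lam powi j * y * ev g (x - of_int i - of_int j) y"
        unfolding EF by (simp add: s algebra_simps)
      also have "\<dots> = lam powi i * lam powi j * (poly A y * poly B (y - 2) - poly B y * poly A (y + 2)) * ev g (x - of_int i - of_int j) y"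
        unfolding AB ..
      also have "\<dots> = ev (aS k (aS l g) - aS l (aS k g)) x y"
        unfolding EF by (simp add: eS_def fS_def algebra_simps)
      finally show ?thesis .
    next
      case FE
      have "ev (act S (gen_bracket k l) g) x y = - (lam powi i * lam powi j * y * ev g (x - of_int i - of_int j) y)"
        unfolding FE by (simp add: s algebra_simps)
      also have "\<dots> = - (lam powi i * lam powi j * (poly A y * poly B (y - 2) - poly B y * poly A (y + 2)) * ev g (x - of_int i - of_int j) y)"
        unfolding AB ..
      also have "\<dots> = ev (aS k (aS l g) - aS l (aS k g)) x y"
        unfolding FE by (simp add: eS_def fS_def algebra_simps)
      finally show ?thesis .
    qed
  next
    case False
    then show ?thesis by (cases k; cases l) (simp_all add: s algebra_simps)
  qed
qed

lemma lie_module_S: "lie_module UNIV S"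
  by (rule lie_module_from_basis[OF cmodule_S aS_clinear])
    (simp_all add: act_S_lext[symmetric] S_minus aS_bracket)

lemmas act_S_clinear = lie_module_act_clinear[OF lie_module_S UNIV_I]
lemma act_S_linear:
  "act S x (g + h) = act S x g + act S x h"
  "act S x (in_t [:c:] * g) = in_t [:c:] * act S x g" "act S x (g * in_t [:c:]) = in_t [:c:] * act S x g"
  using clinearD(2)[OF act_S_clinear, of g h x] clinearD(3)[OF act_S_clinear, of g x c]
  by (simp_all add: mult.commute)

subsection \<open>The twisted action\<close>

text \<open>
  The action on \<open>\<complex>[s,t] \<otimes> \<complex>\<close> with the one-dimensional module given by the weight as second
  factor.
\<close>

definition twisted :: "affvir \<Rightarrow> poly_st \<Rightarrow> poly_st" where
  "twisted x g = act S x g + in_t [:\<chi> x:] * g"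

lemma twisted_clinear: "clinear S S (twisted x)"
  by (rule clinearI) (simp_all add: twisted_def act_S_linear algebra_simps)

lemmas twisted_linear = clinearD(2,3)[OF twisted_clinear, simplified]

lemma twisted_add: "twisted (x + y) g = twisted x g + twisted y g"
  by (simp add: twisted_def act_S_add weight_add in_t_const algebra_simps)

lemma twisted_scl: "twisted (scl c x) g = in_t [:c:] * twisted x g"
  by (simp add: twisted_def act_S_scl weight_scl in_t_const algebra_simps)

lemma twisted_bracket:
  assumes "x \<in> b_plus" "y \<in> b_plus"
  shows "twisted (bracket x y) g = twisted x (twisted y g) - twisted y (twisted x g)"
proof -
  have "act S (bracket x y) g = act S x (act S y g) - act S y (act S x g)"
    using lie_module.bracket_act[OF lie_module_S, of x y g] by (simp add: S_minus)
  then show ?thesis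
    by (simp add: twisted_def weight_bracket[OF assms] act_S_linear in_t_hom(3) algebra_simps)
qed

text \<open>
  Up to the scalar \<open>\<eta>\<close>, the element \<open>d\<^sub>0\<close> acts as multiplication by \<open>s\<close>.
\<close>

lemma twisted_d0: "twisted (dL 0) g = pCons 0 g + in_t [:\<eta>:] * g"
proof -
  have "pCons 0 g = s_var * g" by (simp add: s_var_def)
  then show ?thesis
    by (intro ev_eqI) (simp add: twisted_def act_S_bas weight_def lookup_single algebra_simps)
qed

text \<open>
  The polynomials in \<open>t\<close> fail to be invariant only by a multiple of \<open>s + \<eta>\<close>, and that multiple
  vanishes on \<open>b_sub lam\<close>.
\<close>

lemma twisted_in_t:
  assumes "x \<in> b_plus"
  shows "twisted x (in_t n) = in_t (act N x n) + in_t [:d_eval lam x:] * (s_var + in_t [:\<eta>:]) * in_t n"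
  using assms unfolding b_plus_def mem_Collect_eq
proof (induction x rule: free_space_induct)
  case zero
  show ?case by (simp add: twisted_def act_S_zero act_N_zero weight_def d_eval_def in_t_def)
next
  case (bas k)
  show ?case
    unfolding twisted_def act_S_bas act_N_bas using bas
    by (cases k; intro ev_eqI)
      (auto simp: pos_gens_def eS_def fS_def eN_def fN_def weight_def lookup_single d_eval_def poly_shift1 algebra_simps)
next
  case (add p q)
  then show ?case
    by (simp add: twisted_add act_N_add d_eval_linear in_t_hom in_t_const algebra_simps)
next
  case (scl c p)
  then show ?case
    by (simp add: twisted_scl act_N_scl d_eval_linear in_t_hom in_t_const algebra_simps)
qed

lemma twisted_in_t_sub: "x \<in> b_sub lam \<Longrightarrow> twisted x (in_t n) = in_t (act N x n)"
  by (simp add: b_sub_eq twisted_in_t in_t_hom(3))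

lemma b_sub_plus: "x \<in> b_sub lam \<Longrightarrow> x \<in> b_plus"
  by (simp add: b_sub_eq)

text \<open>
  The prescribed action on \<open>\<complex>[t]\<close> is the restriction of the twisted action to \<open>b_sub lam\<close> and
  inherits the module laws from it.
\<close>

lemma lie_module_N: "lie_module (b_sub lam) N"
proof -
  have in_t: "in_t (p + q) = in_t p + in_t q" "in_t (p - q) = in_t p - in_t q"
    "in_t ([:c:] * p) = in_t [:c:] * in_t p" for p q c
    by (simp_all add: in_t_def)
  have eq: "p = q" if "in_t p = in_t q" for p q using that by simp
  note sub = lie_subalgebra_b_sub[OF lam, unfolded lie_subalgebra_def]
  show ?thesis
  proof (intro lie_module.intro lie_module_axioms.intro cmodule_N)
    fix x y n m c assume x: "x \<in> b_sub lam" and y: "y \<in> b_sub lam"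
    show "act N (bracket x y) n = act N x (act N y n) \<ominus>\<^bsub>N\<^esub> act N y (act N x n)"
      unfolding N_minus
    proof (rule eq)
      have "in_t (act N (bracket x y) n) = twisted x (twisted y (in_t n)) - twisted y (twisted x (in_t n))"
        using sub x y twisted_bracket[OF b_sub_plus[OF x] b_sub_plus[OF y], of "in_t n"]
        by (simp add: twisted_in_t_sub)
      then show "in_t (act N (bracket x y) n) = in_t (act N x (act N y n) - act N y (act N x n))"
        using x y by (simp add: in_t twisted_in_t_sub)
    qed
  next
    fix x y n m c assume x: "x \<in> b_sub lam"
    have "in_t (act N x (n + m)) = in_t (act N x n + act N x m)"
      "in_t (act N x ([:c:] * n)) = in_t ([:c:] * act N x n)"
      unfolding in_t twisted_in_t_sub[OF x, symmetric] twisted_linear by simp_all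
    then show "act N x (n \<oplus>\<^bsub>N\<^esub> m) = act N x n \<oplus>\<^bsub>N\<^esub> act N x m"
      "act N x (c \<odot>\<^bsub>N\<^esub> n) = c \<odot>\<^bsub>N\<^esub> act N x n"
      by simp_all
  qed (simp_all add: act_N_add act_N_scl)
qed

text \<open>
  As a module over \<open>b_plus\<close>, the twisted module is generated from \<open>\<complex>[t]\<close> by \<open>d\<^sub>0\<close>.
\<close>

lemma twisted_induct:
  assumes zero: "P 0" and base: "\<And>n. P (in_t n)" and add: "\<And>g h. P g \<Longrightarrow> P h \<Longrightarrow> P (g + h)"
    and scl: "\<And>c g. P g \<Longrightarrow> P (in_t [:c:] * g)" and d0: "\<And>g. P g \<Longrightarrow> P (twisted (dL 0) g)"
  shows "P g"
proof (induction g)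
  case 0
  show ?case by (rule zero)
next
  case (pCons n g)
  have "pCons n g = in_t n + pCons 0 g" by (simp add: in_t_def)
  then have "pCons n g = in_t n + (twisted (dL 0) g + in_t [:- \<eta>:] * g)"
    by (simp add: twisted_d0 in_t_const)
  then show ?case using base add scl d0 pCons(2) by metis
qed

lemma twisted_unique:
  assumes X: "cmodule X" and f: "clinear S X f" and g: "clinear S X g"
    and base: "\<And>n. f (in_t n) = g (in_t n)"
    and d0: "\<And>w. f (twisted (dL 0) w) = D (f w)" "\<And>w. g (twisted (dL 0) w) = D (g w)"
  shows "f w = g w"
proof (induction w rule: twisted_induct)
  case 1
  show ?case using clinear_zero[OF cmodule_S X f] clinear_zero[OF cmodule_S X g] by simp
next
  case (3 u v)
  then show ?case using clinearD(2)[OF f, of u v] clinearD(2)[OF g, of u v] by simp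
next
  case (4 c u)
  then show ?case using clinearD(3)[OF f, of u c] clinearD(3)[OF g, of u c] by simp
qed (simp_all add: base d0)

text \<open>
  The twisted module is free over \<open>\<complex>[d\<^sub>0]\<close> on \<open>\<complex>[t]\<close>, that is, it is induced from \<open>b_sub lam\<close> to
  \<open>b_plus\<close>.  So \<open>\<iota>\<close> has one extension that commutes with \<open>d\<^sub>0\<close>.  It commutes with all of \<open>b_plus\<close>
  by induction on the degree in \<open>s\<close>, because \<open>[x, d\<^sub>0]\<close> stays in \<open>b_plus\<close>.
\<close>

lemma twisted_hom_lift:
  assumes X: "lie_module UNIV X" and \<iota>: "lie_hom (b_sub lam) N X \<iota>"
  shows "\<exists>F. clinear S X F \<and> (\<forall>n. F (in_t n) = \<iota> n) \<and>
    (\<forall>x\<in>b_plus. \<forall>w. F (twisted x w) = act X x (F w))"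
proof -
  note cX = cmodule_lie[OF X]
  interpret X: module complex_ring X by (rule cX)
  note aX = lie_module_act_clinear[OF X UNIV_I]
  note \<iota>L = clinearD[OF lie_homD(1)[OF \<iota>], simplified]
  \<comment> \<open>\<open>?D\<close> is the image of multiplication by \<open>s\<close>, and \<open>F\<close> is evaluation by Horner's scheme.\<close>
  let ?D = "\<lambda>v. act X (dL 0) v \<ominus>\<^bsub>X\<^esub> \<eta> \<odot>\<^bsub>X\<^esub> v"
  have idX: "clinear X X (\<lambda>v. v)" by (rule clinearI) auto
  have D: "clinear X X ?D"
    by (rule clinear_diff[OF cX cX aX clinear_smult[OF cX idX]])
  note DL = clinearD[OF D]
  have D0: "?D \<zero>\<^bsub>X\<^esub> = \<zero>\<^bsub>X\<^esub>" by (rule clinear_zero[OF cX cX D])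
  have \<iota>0: "\<iota> 0 = \<zero>\<^bsub>X\<^esub>" using clinear_zero[OF cmodule_N cX lie_homD(1)[OF \<iota>]] by simp
  define F where "F w = foldr (\<lambda>n v. \<iota> n \<oplus>\<^bsub>X\<^esub> ?D v) (coeffs w) \<zero>\<^bsub>X\<^esub>" for w
  have F0: "F 0 = \<zero>\<^bsub>X\<^esub>" by (simp add: F_def)
  have FpC: "F (pCons n w) = \<iota> n \<oplus>\<^bsub>X\<^esub> ?D (F w)" for n w
  proof (cases "n = 0 \<and> w = 0")
    case True
    then show ?thesis by (simp only: pCons_0_0 F0 \<iota>0 D0 X.l_zero X.zero_closed)
  qed (auto simp: F_def cCons_def)
  have Fc: "F w \<in> carrier X" for w
    by (induction w) (use F0 FpC \<iota>L(1) DL(1) in auto)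
  have Fadd: "F (v + w) = F v \<oplus>\<^bsub>X\<^esub> F w" for v w
  proof (induction v w rule: poly_induct2)
    case 0
    show ?case using F0 by simp
  next
    case (pCons n v m w)
    have "F (pCons n v + pCons m w) = (\<iota> n \<oplus>\<^bsub>X\<^esub> \<iota> m) \<oplus>\<^bsub>X\<^esub> (?D (F v) \<oplus>\<^bsub>X\<^esub> ?D (F w))"
      by (simp only: add_pCons FpC pCons DL(2)[OF Fc Fc] \<iota>L(2))
    then show ?case using DL(1)[OF Fc] \<iota>L(1) by (simp add: FpC X.a_ac)
  qed
  have Fscl: "F (in_t [:c:] * w) = c \<odot>\<^bsub>X\<^esub> F w" for c w
  proof (induction w)
    case 0
    show ?case using F0 X.smult_r_null[of c] by simp
  next
    case (pCons n w)
    have "in_t [:c:] * pCons n w = pCons ([:c:] * n) (in_t [:c:] * w)" by (simp add: in_t_def)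
    then have "F (in_t [:c:] * pCons n w) = c \<odot>\<^bsub>X\<^esub> \<iota> n \<oplus>\<^bsub>X\<^esub> c \<odot>\<^bsub>X\<^esub> ?D (F w)"
      using \<iota>L(3)[of c n] by (simp add: FpC pCons DL(3)[OF Fc] del: mult_pCons_right)
    also have "\<dots> = c \<odot>\<^bsub>X\<^esub> F (pCons n w)"
      using cmoduleD(3)[OF cX \<iota>L(1) DL(1)[OF Fc]] by (simp only: FpC)
    finally show ?case .
  qed
  have F: "clinear S X F" by (rule clinearI) (simp_all add: Fc Fadd Fscl)
  have Fin: "F (in_t n) = \<iota> n" for n
    using FpC[of n 0] \<iota>L(1) by (simp only: in_t_def F0 D0 X.r_zero)
  have Fd0: "F (twisted (dL 0) w) = act X (dL 0) (F w)" for w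
  proof -
    have a: "act X (dL 0) (F w) \<in> carrier X" and e: "\<eta> \<odot>\<^bsub>X\<^esub> F w \<in> carrier X"
      using Fc clinearD(1)[OF aX] cmoduleD(1)[OF cX] by auto
    have "F (twisted (dL 0) w) = ?D (F w) \<oplus>\<^bsub>X\<^esub> \<eta> \<odot>\<^bsub>X\<^esub> F w"
      using DL(1)[OF Fc] by (simp only: twisted_d0 Fadd FpC \<iota>0 Fscl X.l_zero)
    also have "\<dots> = act X (dL 0) (F w)"
      using a e by (simp add: X.minus_eq X.a_assoc X.l_neg)
    finally show ?thesis .
  qed
  have "\<forall>x\<in>b_plus. F (twisted x w) = act X x (F w)" for w
  proof (induction w rule: twisted_induct)
    case 1
    show ?case
      using clinear_zero[OF cX cX aX] F0 clinear_zero[OF cmodule_S cmodule_S twisted_clinear] by simp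
  next
    case (2 n)
    show ?case
    proof
      fix x assume x: "x \<in> b_plus"
      \<comment> \<open>split \<open>x\<close> into its part in \<open>b_sub lam\<close>, where \<open>\<iota>\<close> is a homomorphism, and a multiple of \<open>d\<^sub>0\<close>\<close>
      let ?x = "x - scl (d_eval lam x) (dL 0)"
      have x': "?x \<in> b_sub lam" by (rule b_sub_approx[OF x])
      have "twisted x (in_t n) = twisted ?x (in_t n) + in_t [:d_eval lam x:] * twisted (dL 0) (in_t n)"
        using twisted_add[of ?x "scl (d_eval lam x) (dL 0)" "in_t n"] by (simp add: twisted_scl)
      then have "F (twisted x (in_t n)) = act X ?x (\<iota> n) \<oplus>\<^bsub>X\<^esub> d_eval lam x \<odot>\<^bsub>X\<^esub> act X (dL 0) (\<iota> n)"
        using lie_homD(2)[OF \<iota> x', of n] by (simp add: Fadd Fscl Fd0 Fin twisted_in_t_sub[OF x'])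
      also have "\<dots> = act X x (\<iota> n)"
        using lie_module.add_act[OF X, of ?x "scl (d_eval lam x) (dL 0)" "\<iota> n"] \<iota>L(1)
        by (simp add: lie_module.smult_act[OF X])
      finally show "F (twisted x (in_t n)) = act X x (F (in_t n))" by (simp add: Fin)
    qed
  next
    case (3 g h)
    then show ?case by (simp add: twisted_linear Fadd clinearD(2)[OF aX] Fc)
  next
    case (4 c g)
    then show ?case by (simp add: twisted_linear Fscl clinearD(3)[OF aX] Fc)
  next
    case (5 g)
    show ?case
    proof
      fix x assume x: "x \<in> b_plus"
      have d: "dL 0 \<in> b_plus" by (simp add: b_plus_def pos_gens_def)
      let ?b = "bracket x (dL 0)"
      have "twisted x (twisted (dL 0) g) = twisted (dL 0) (twisted x g) + twisted ?b g"
        using twisted_bracket[OF x d, of g] by simp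
      then have "F (twisted x (twisted (dL 0) g)) = act X (dL 0) (act X x (F g)) \<oplus>\<^bsub>X\<^esub> act X ?b (F g)"
        using 5 x b_plus_bracket[OF x d] by (simp add: Fadd Fd0)
      also have "act X ?b (F g) = act X x (act X (dL 0) (F g)) \<ominus>\<^bsub>X\<^esub> act X (dL 0) (act X x (F g))"
        by (rule lie_module.bracket_act[OF X UNIV_I UNIV_I Fc])
      also have "act X (dL 0) (act X x (F g)) \<oplus>\<^bsub>X\<^esub> \<dots> = act X x (act X (dL 0) (F g))"
        using clinearD(1)[OF aX] Fc by (simp add: X.minus_eq X.a_lcomm X.r_neg)
      finally show "F (twisted x (twisted (dL 0) g)) = act X x (F (twisted (dL 0) g))" by (simp add: Fd0)
    qed
  qed
  then show ?thesis using F Fin by blast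
qed

subsection \<open>The isomorphism\<close>

sublocale TV: tensor_verma \<eta> \<epsilon> \<theta> S
  by (rule tensor_verma.intro) (simp_all add: lie_module_S)

sublocale IN: induced_module "b_sub lam" N
  by (rule induced_module.intro[OF lie_subalgebra_b_sub[OF lam] lie_module_N])

text \<open>
  Both composites of the two homomorphisms given by the universal properties are the identity on
  generators.
\<close>

theorem tensor_verma_iso_Ind:
  "lie_module_isomorphic UNIV (lie_tensor S V) (Ind (b_sub lam) N)"
proof -
  let ?T = "lie_tensor S V" and ?I = "Ind (b_sub lam) N"
  note T = TV.L.lie_module_lie_tensor and I = IN.lie_module_Ind
  note incL = clinearD[OF TV.inc_clinear, unfolded S_simps, OF UNIV_I]
    clinearD(2)[OF TV.inc_clinear, unfolded S_simps, OF UNIV_I UNIV_I]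
  have inc_twisted: "TV.inc (twisted x w) = act ?T x (TV.inc w)" if "x \<in> b_plus" for x w
    using TV.inc_act[OF that, of w] by (simp add: twisted_def incL(3,4) del: TV.L.lie_tensor_simps)
  have "lie_hom (b_sub lam) N ?T (\<lambda>n. TV.inc (in_t n))"
  proof (rule lie_homI)
    have "clinear N S in_t" by (rule clinearI) (simp_all add: in_t_def)
    then show "clinear N ?T (\<lambda>n. TV.inc (in_t n))" by (rule clinear_compose[OF _ TV.inc_clinear])
  qed (use inc_twisted twisted_in_t_sub b_sub_plus in metis)
  then obtain \<phi> where \<phi>: "lie_hom UNIV ?I ?T \<phi>" and \<phi>emb: "\<And>n. \<phi> (IN.emb n) = TV.inc (in_t n)"
    using IN.Ind_hom_lift[OF T, of "\<lambda>n. TV.inc (in_t n)"] by auto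
  obtain F where F: "clinear S ?I F" and Fin: "\<And>n. F (in_t n) = IN.emb n"
    and Ftwisted: "\<And>x w. x \<in> b_plus \<Longrightarrow> F (twisted x w) = act ?I x (F w)"
    using twisted_hom_lift[OF I IN.emb_hom] by blast
  note FL = clinearD[OF F, unfolded S_simps, OF UNIV_I] clinearD(2)[OF F, unfolded S_simps, OF UNIV_I UNIV_I]
  have "act ?I x (F w) = F (act S x w) \<oplus>\<^bsub>?I\<^esub> \<chi> x \<odot>\<^bsub>?I\<^esub> F w" if "x \<in> b_plus" for x w
    using Ftwisted[OF that, of w] by (simp add: twisted_def FL(3,4) del: IN.Ind_simps)
  then obtain \<psi> where \<psi>: "lie_hom UNIV ?T ?I \<psi>" and \<psi>inc: "\<And>w. \<psi> (TV.inc w) = F w"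
    using TV.hom_lift[OF I F] by blast
  have id: "lie_hom UNIV M M (\<lambda>v. v)" for M :: "('x, 'y) lie_mod_scheme"
    by (simp add: lie_hom_def clinear_def)
  have "\<phi> (F w) = TV.inc w" for w
  proof (rule twisted_unique[OF cmodule_lie[OF T] clinear_compose[OF F lie_homD(1)[OF \<phi>]] TV.inc_clinear])
    have d: "dL 0 \<in> b_plus" by (simp add: b_plus_def pos_gens_def)
    show "\<phi> (F (twisted (dL 0) w)) = act ?T (dL 0) (\<phi> (F w))" for w
      using lie_homD(2)[OF \<phi> UNIV_I FL(1)] by (simp only: Ftwisted[OF d])
    show "TV.inc (twisted (dL 0) w) = act ?T (dL 0) (TV.inc w)" for w by (rule inc_twisted[OF d])
  qed (simp add: Fin \<phi>emb)
  then have "\<phi> (\<psi> z) = z" if "z \<in> carrier ?T" for z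
    by (intro TV.hom_eqI[OF T lie_hom_compose[OF \<psi> \<phi>] id _ that]) (simp add: \<psi>inc)
  moreover have "\<psi> (\<phi> v) = v" if "v \<in> carrier ?I" for v
    by (intro IN.Ind_hom_eqI[OF I lie_hom_compose[OF \<phi> \<psi>] id _ that]) (simp add: \<phi>emb \<psi>inc Fin)
  ultimately show ?thesis
    by (intro lie_module_isomorphicI[OF T I \<psi> \<phi>])
qed

end

theorem theorem6p4:
  fixes lam \<alpha> \<beta> \<gamma> \<eta> \<epsilon> \<theta> :: complex
  assumes "lam \<noteq> 0" and "\<alpha> \<noteq> 0"
  shows "lie_module_isomorphic UNIV
           (lie_tensor (Omega lam \<alpha> \<beta> \<gamma>) (verma \<eta> \<epsilon> \<theta>))
           (Ind (b_sub lam) (t_Omega lam \<alpha> \<beta> \<gamma> \<eta> \<epsilon> \<theta>))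
       \<and> lie_module_isomorphic UNIV
           (lie_tensor (Delta lam \<alpha> \<beta> \<gamma>) (verma \<eta> \<epsilon> \<theta>))
           (Ind (b_sub lam) (t_Delta lam \<alpha> \<beta> \<gamma> \<eta> \<epsilon> \<theta>))
       \<and> lie_module_isomorphic UNIV
           (lie_tensor (Theta lam \<alpha> \<beta> \<gamma>) (verma \<eta> \<epsilon> \<theta>))
           (Ind (b_sub lam) (t_Theta lam \<alpha> \<beta> \<gamma> \<eta> \<epsilon> \<theta>))"
proof (intro conjI)
  have lam: "lam \<noteq> 0" and \<alpha>: "\<alpha> \<noteq> 0" by fact+
  interpret O: polynomial_modules \<eta> \<epsilon> \<theta> lam \<gamma> "[:\<alpha>:]" "[:- (1 / \<alpha>):] * [:- \<beta>, 1/2:] * [:\<beta> + 1, 1/2:]"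
    by unfold_locales (use lam \<alpha> in \<open>simp_all add: field_simps\<close>)
  interpret D: polynomial_modules \<eta> \<epsilon> \<theta> lam \<gamma> "[:- (1 / \<alpha>):] * [:\<beta>, 1/2:] * [:- \<beta> - 1, 1/2:]" "[:\<alpha>:]"
    by unfold_locales (use lam \<alpha> in \<open>simp_all add: field_simps\<close>)
  interpret H: polynomial_modules \<eta> \<epsilon> \<theta> lam \<gamma> "[:\<alpha>:] * [:\<beta>, 1/2:]" "[:- (1 / \<alpha>):] * [:- \<beta>, 1/2:]"
    by unfold_locales (use lam \<alpha> in \<open>simp_all add: field_simps\<close>)
  have c: "[:lam powi i:] * ([:- (1 / \<alpha>):] * p * q) = [:- (lam powi i / \<alpha>):] * p * q"
    "[:lam powi i:] * ([:- (1 / \<alpha>):] * p) = [:- (lam powi i / \<alpha>):] * p"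
    "[:lam powi i:] * [:\<alpha>:] = [:lam powi i * \<alpha>:]"
    "[:lam powi i:] * ([:\<alpha>:] * p) = [:lam powi i * \<alpha>:] * p" for i and p q :: poly_t
    by (simp_all add: mult.commute)
  show "lie_module_isomorphic UNIV (lie_tensor (Omega lam \<alpha> \<beta> \<gamma>) (verma \<eta> \<epsilon> \<theta>))
      (Ind (b_sub lam) (t_Omega lam \<alpha> \<beta> \<gamma> \<eta> \<epsilon> \<theta>))"
    using O.tensor_verma_iso_Ind
    unfolding O.eS_def[abs_def] O.fS_def[abs_def] O.eN_def[abs_def] O.fN_def[abs_def] Omega_def t_Omega_def c .
  show "lie_module_isomorphic UNIV (lie_tensor (Delta lam \<alpha> \<beta> \<gamma>) (verma \<eta> \<epsilon> \<theta>))
      (Ind (b_sub lam) (t_Delta lam \<alpha> \<beta> \<gamma> \<eta> \<epsilon> \<theta>))"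
    using D.tensor_verma_iso_Ind
    unfolding D.eS_def[abs_def] D.fS_def[abs_def] D.eN_def[abs_def] D.fN_def[abs_def] Delta_def t_Delta_def c .
  show "lie_module_isomorphic UNIV (lie_tensor (Theta lam \<alpha> \<beta> \<gamma>) (verma \<eta> \<epsilon> \<theta>))
      (Ind (b_sub lam) (t_Theta lam \<alpha> \<beta> \<gamma> \<eta> \<epsilon> \<theta>))"
    using H.tensor_verma_iso_Ind
    unfolding H.eS_def[abs_def] H.fS_def[abs_def] H.eN_def[abs_def] H.fN_def[abs_def] Theta_def t_Theta_def c .
qed

end
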